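(* Let $\pi$ be a bundle with total space $E=J^0\pi$ and let $\mathcal E\subset J^\infty\pi$ be an algebraic differential equation. Then the symmetry pseudogroup $\mathcal G$ of $\mathcal E$ is algebraic; this means that the defining Lie equations of $\mathcal G$ are algebraic. Here symmetries are understood to be either point symmetries or contact symmetries.
   Context: A differential equation $\mathcal E\subset J^\infty\pi$, with $k$-jet manifolds $\mathcal E^k\subset J^k\pi$, is called algebraic if for every $a\in E=J^0\pi$ and every $k\in\mathbb N$ the fiber $\mathcal E^k_a\subset J^k_a\pi$ over $a$ is an algebraic variety (possibly reducible), with respect to the natural algebraic structure in the fibers of $J^k\pi\to E$ (given by the jet coordinates $u_\sigma$, $0<|\sigma|\le k$). A point symmetry is a local diffeomorphism $\varphi\colon E\to E$ whose prolongation to jets preserves $\mathcal E$; a contact symmetry (in the case when the dependent variable $u$ is one-dimensional) is a local contact diffeomorphism $\varphi\colon J^1\pi\to J^1\pi$ whose prolongation to higher jets preserves $\mathcal E$. The symmetry pseudogroup $\mathcal G$ consists of all such $\varphi$. Its Lie equations are the differential equations on the components of $\varphi$ characterizing membership in $\mathcal G$; they are algebraic if, over a point of $E$ (resp. of $J^1\pi$ in the contact case), they are given by algebraic relations on the derivatives of the components of $\varphi$. The action of $\mathcal G$ on $J^0\pi$ is not assumed to be transitive. *)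

theory Defs
  imports "HOL-Analysis.Analysis"
begin

section \<open>Smooth maps between open subsets of Euclidean spaces\<close>

primrec iter_deriv ::
  "'v::euclidean_space list \<Rightarrow> ('v \<Rightarrow> 'w::euclidean_space) \<Rightarrow> 'v \<Rightarrow> 'w" where
  "iter_deriv [] f = f"
| "iter_deriv (v # vs) f = (\<lambda>x. frechet_derivative (iter_deriv vs f) (at x) v)"

text \<open>Meant for open sets; there it is the class \<open>C\<^sup>\<infinity>\<close>.\<close>

definition smooth_on :: "'v::euclidean_space set \<Rightarrow> ('v \<Rightarrow> 'w::euclidean_space) \<Rightarrow> bool" where
  "smooth_on S f \<longleftrightarrow>
     (\<forall>vs. set vs \<subseteq> Basis \<longrightarrow> (\<forall>x\<in>S. iter_deriv vs f differentiable (at x)))"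

section \<open>Smooth manifolds\<close>

text \<open>A manifold is given by a smooth atlas. Its underlying set is the union of the chart
  domains, which may be a proper subset of the type \<open>'p\<close>, and its topology is the one induced by
  the charts, so that no topology on \<open>'p\<close> is used.\<close>

type_synonym ('p, 'v) atlas = "('p set \<times> ('p \<Rightarrow> 'v)) set"

definition carrier :: "('p, 'v) atlas \<Rightarrow> 'p set" where
  "carrier A = \<Union> (fst ` A)"

definition mopen :: "('p, 'v::euclidean_space) atlas \<Rightarrow> 'p set \<Rightarrow> bool" where
  "mopen A V \<longleftrightarrow> V \<subseteq> carrier A \<and> (\<forall>(U, \<psi>)\<in>A. open (\<psi> ` (U \<inter> V)))"

definition smooth_manifold :: "('p, 'v::euclidean_space) atlas \<Rightarrow> bool" where
  "smooth_manifold A \<longleftrightarrow>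
     (\<forall>(U, \<psi>)\<in>A. inj_on \<psi> U) \<and>
     (\<forall>(U, \<psi>)\<in>A. \<forall>(V, \<eta>)\<in>A.
        open (\<psi> ` (U \<inter> V)) \<and> smooth_on (\<psi> ` (U \<inter> V)) (\<eta> \<circ> inv_into U \<psi>)) \<and>
     (\<forall>p\<in>carrier A. \<forall>q\<in>carrier A. p \<noteq> q \<longrightarrow>
        (\<exists>V W. mopen A V \<and> mopen A W \<and> p \<in> V \<and> q \<in> W \<and> V \<inter> W = {})) \<and>
     (\<exists>C\<subseteq>A. countable C \<and> carrier C = carrier A)"

definition euclidean_atlas :: "('v, 'v::euclidean_space) atlas" where
  "euclidean_atlas = {(UNIV, id)}"

definition prod_atlas ::
  "('p, 'v) atlas \<Rightarrow> ('q, 'w) atlas \<Rightarrow> ('p \<times> 'q, 'v \<times> 'w) atlas" where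
  "prod_atlas A B = {(U \<times> V, map_prod \<psi> \<eta>) | U \<psi> V \<eta>. (U, \<psi>) \<in> A \<and> (V, \<eta>) \<in> B}"

text \<open>For \<open>S\<close> open, openness of the sets below is continuity of \<open>f\<close> on \<open>S\<close>.\<close>

definition smooth_map ::
  "('p, 'v::euclidean_space) atlas \<Rightarrow> ('q, 'w::euclidean_space) atlas \<Rightarrow> 'p set \<Rightarrow> ('p \<Rightarrow> 'q) \<Rightarrow> bool"
where
  "smooth_map A B S f \<longleftrightarrow>
     f ` S \<subseteq> carrier B \<and>
     (\<forall>(U, \<psi>)\<in>A. \<forall>(V, \<eta>)\<in>B.
        open (\<psi> ` (U \<inter> S \<inter> f -` V)) \<and>
        smooth_on (\<psi> ` (U \<inter> S \<inter> f -` V)) (\<eta> \<circ> f \<circ> inv_into U \<psi>))"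

definition smooth_at ::
  "('p, 'v::euclidean_space) atlas \<Rightarrow> ('q, 'w::euclidean_space) atlas \<Rightarrow> 'p \<Rightarrow> ('p \<Rightarrow> 'q) \<Rightarrow> bool"
where
  "smooth_at A B p f \<longleftrightarrow> (\<exists>S. mopen A S \<and> p \<in> S \<and> smooth_map A B S f)"

definition local_diffeo ::
  "('p, 'v::euclidean_space) atlas \<Rightarrow> ('q, 'w::euclidean_space) atlas \<Rightarrow> 'p set \<Rightarrow> ('p \<Rightarrow> 'q) \<Rightarrow> bool"
where
  "local_diffeo A B S f \<longleftrightarrow>
     mopen A S \<and> smooth_map A B S f \<and> inj_on f S \<and>
     mopen B (f ` S) \<and> smooth_map B A (f ` S) (inv_into S f)"

section \<open>Jets of maps\<close>

definition same_jet ::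
  "('p, 'v::euclidean_space) atlas \<Rightarrow> ('q, 'w::euclidean_space) atlas \<Rightarrow> nat \<Rightarrow> 'p \<Rightarrow>
   ('p \<Rightarrow> 'q) \<Rightarrow> ('p \<Rightarrow> 'q) \<Rightarrow> bool"
where
  "same_jet A B k p f g \<longleftrightarrow>
     f p = g p \<and>
     (\<forall>(U, \<psi>)\<in>A. \<forall>(V, \<eta>)\<in>B. p \<in> U \<and> f p \<in> V \<longrightarrow>
        (\<forall>\<sigma>. set \<sigma> \<subseteq> Basis \<and> length \<sigma> \<le> k \<longrightarrow>
           iter_deriv \<sigma> (\<eta> \<circ> f \<circ> inv_into U \<psi>) (\<psi> p) =
           iter_deriv \<sigma> (\<eta> \<circ> g \<circ> inv_into U \<psi>) (\<psi> p)))"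

text \<open>The \<open>k\<close>-jet of \<open>f\<close> at \<open>p\<close>: the point \<open>p\<close> together with the class of all maps that are smooth
  near \<open>p\<close> and agree with \<open>f\<close> at \<open>p\<close> up to order \<open>k\<close>.\<close>

type_synonym ('p, 'q) jet = "'p \<times> ('p \<Rightarrow> 'q) set"

definition jet ::
  "('p, 'v::euclidean_space) atlas \<Rightarrow> ('q, 'w::euclidean_space) atlas \<Rightarrow> nat \<Rightarrow> 'p \<Rightarrow>
   ('p \<Rightarrow> 'q) \<Rightarrow> ('p, 'q) jet"
where
  "jet A B k p f = (p, {g. smooth_at A B p g \<and> same_jet A B k p f g})"

definition jet_target :: "('p, 'q) jet \<Rightarrow> 'q" where
  "jet_target \<theta> = (SOME s. s \<in> snd \<theta>) (fst \<theta>)"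

section \<open>Algebraic conditions on derivatives\<close>

inductive polynomial_fun :: "'i set \<Rightarrow> (('i \<Rightarrow> real) \<Rightarrow> real) \<Rightarrow> bool" for I where
  const: "polynomial_fun I (\<lambda>w. c)"
| var: "i \<in> I \<Longrightarrow> polynomial_fun I (\<lambda>w. w i)"
| add: "polynomial_fun I p \<Longrightarrow> polynomial_fun I q \<Longrightarrow> polynomial_fun I (\<lambda>w. p w + q w)"
| mult: "polynomial_fun I p \<Longrightarrow> polynomial_fun I q \<Longrightarrow> polynomial_fun I (\<lambda>w. p w * q w)"

text \<open>Coordinates on the fiber of \<open>k\<close>-jets over a fixed source and target. The multi-index \<open>\<sigma>\<close>,
  \<open>0 < \<bar>\<sigma>\<bar> \<le> k\<close>, is written as a list of coordinate directions; by symmetry of partial derivatives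
  the order of the list is irrelevant, and repeating coordinates does not change the class of
  algebraic subsets.\<close>

definition jet_vars :: "nat \<Rightarrow> ('v::euclidean_space list \<times> 'w::euclidean_space) set" where
  "jet_vars k = {(\<sigma>, b). set \<sigma> \<subseteq> Basis \<and> 0 < length \<sigma> \<and> length \<sigma> \<le> k \<and> b \<in> Basis}"

definition jet_coords ::
  "'p set \<Rightarrow> ('p \<Rightarrow> 'v::euclidean_space) \<Rightarrow> ('q \<Rightarrow> 'w::euclidean_space) \<Rightarrow> 'p \<Rightarrow> ('p \<Rightarrow> 'q) \<Rightarrow>
   'v list \<times> 'w \<Rightarrow> real"
where
  "jet_coords U \<psi> \<eta> p f = (\<lambda>(\<sigma>, b). iter_deriv \<sigma> (\<eta> \<circ> f \<circ> inv_into U \<psi>) (\<psi> p) \<bullet> b)"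

section \<open>Bundles and their jets\<close>

definition smooth_bundle ::
  "('e, (real^'n) \<times> (real^'m)) atlas \<Rightarrow> ('b, real^'n) atlas \<Rightarrow> ('f, real^'m) atlas \<Rightarrow>
   ('e \<Rightarrow> 'b) \<Rightarrow> bool"
where
  "smooth_bundle E M F \<pi> \<longleftrightarrow>
     smooth_manifold E \<and> smooth_manifold M \<and> smooth_manifold F \<and>
     smooth_map E M (carrier E) \<pi> \<and> \<pi> ` carrier E = carrier M \<and>
     (\<forall>x\<in>carrier M. \<exists>V \<Phi>. mopen M V \<and> x \<in> V \<and>
        local_diffeo E (prod_atlas M F) (carrier E \<inter> \<pi> -` V) (\<lambda>e. (\<pi> e, \<Phi> e)) \<and>
        (\<lambda>e. (\<pi> e, \<Phi> e)) ` (carrier E \<inter> \<pi> -` V) = V \<times> carrier F)"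

text \<open>Bundle coordinates \<open>(x, u)\<close> on \<open>U\<close> lying over base coordinates \<open>x = \<kappa>\<close> on \<open>\<pi> ` U\<close>.\<close>

definition adapted_chart ::
  "('e, (real^'n) \<times> (real^'m)) atlas \<Rightarrow> ('b, real^'n) atlas \<Rightarrow> ('e \<Rightarrow> 'b) \<Rightarrow>
   'e set \<Rightarrow> ('e \<Rightarrow> (real^'n) \<times> (real^'m)) \<Rightarrow> ('b \<Rightarrow> real^'n) \<Rightarrow> bool"
where
  "adapted_chart E M \<pi> U \<psi> \<kappa> \<longleftrightarrow>
     local_diffeo E euclidean_atlas U \<psi> \<and> local_diffeo M euclidean_atlas (\<pi> ` U) \<kappa> \<and>
     (\<forall>e\<in>U. fst (\<psi> e) = \<kappa> (\<pi> e))"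

definition local_section ::
  "('e, (real^'n) \<times> (real^'m)) atlas \<Rightarrow> ('b, real^'n) atlas \<Rightarrow> ('e \<Rightarrow> 'b) \<Rightarrow> 'b \<Rightarrow> ('b \<Rightarrow> 'e) \<Rightarrow> bool"
where
  "local_section E M \<pi> x s \<longleftrightarrow>
     (\<exists>V. mopen M V \<and> x \<in> V \<and> smooth_map M E V s \<and> (\<forall>y\<in>V. \<pi> (s y) = y))"

definition jet_space ::
  "('e, (real^'n) \<times> (real^'m)) atlas \<Rightarrow> ('b, real^'n) atlas \<Rightarrow> ('e \<Rightarrow> 'b) \<Rightarrow> nat \<Rightarrow> ('b, 'e) jet set"
where
  "jet_space E M \<pi> k = {jet M E k x s | x s. local_section E M \<pi> x s}"

section \<open>Differential equations\<close>

text \<open>An equation is the tower of its sets \<open>Q k\<close> of \<open>k\<close>-jets, compatible with the projections from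
  \<open>(k+1)\<close>-jets to \<open>k\<close>-jets.\<close>

definition differential_equation ::
  "('e, (real^'n) \<times> (real^'m)) atlas \<Rightarrow> ('b, real^'n) atlas \<Rightarrow> ('e \<Rightarrow> 'b) \<Rightarrow>
   (nat \<Rightarrow> ('b, 'e) jet set) \<Rightarrow> bool"
where
  "differential_equation E M \<pi> Q \<longleftrightarrow>
     (\<forall>k. Q k \<subseteq> jet_space E M \<pi> k) \<and>
     (\<forall>k x s. local_section E M \<pi> x s \<and> jet M E (Suc k) x s \<in> Q (Suc k) \<longrightarrow> jet M E k x s \<in> Q k)"

text \<open>Every fiber of \<open>Q k\<close> over a point \<open>a\<close> of the total space is the zero set of a family of
  polynomials in the jet coordinates \<open>u\<^sub>\<sigma>\<close>, where \<open>u = snd \<circ> \<psi>\<close>.\<close>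

definition algebraic_equation ::
  "('e, (real^'n) \<times> (real^'m)) atlas \<Rightarrow> ('b, real^'n) atlas \<Rightarrow> ('e \<Rightarrow> 'b) \<Rightarrow>
   (nat \<Rightarrow> ('b, 'e) jet set) \<Rightarrow> bool"
where
  "algebraic_equation E M \<pi> Q \<longleftrightarrow>
     differential_equation E M \<pi> Q \<and>
     (\<forall>k a U \<psi> \<kappa>. adapted_chart E M \<pi> U \<psi> \<kappa> \<and> a \<in> U \<longrightarrow>
        (\<exists>P. (\<forall>p\<in>P. polynomial_fun (jet_vars k) p) \<and>
             (\<forall>s. local_section E M \<pi> (\<pi> a) s \<and> s (\<pi> a) = a \<longrightarrow>
                (jet M E k (\<pi> a) s \<in> Q k \<longleftrightarrow>
                 (\<forall>p\<in>P. p (jet_coords (\<pi> ` U) \<kappa> (snd \<circ> \<psi>) (\<pi> a) s) = 0)))))"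

section \<open>Point symmetries\<close>

text \<open>The prolongation of a local diffeomorphism \<open>\<phi>\<close> of the total space, as a partial map of
  \<open>k\<close>-jets given by its graph: near \<open>s x\<close>, \<open>\<phi>\<close> carries the graph of \<open>s\<close> into the graph of the
  section \<open>s'\<close>. It is defined only at those jets for which the image of the graph of \<open>s\<close> is again
  transversal to the fibers of \<open>\<pi>\<close>; this transversality is forced by the smoothness of \<open>s'\<close>.\<close>

definition point_prolongation ::
  "('e, (real^'n) \<times> (real^'m)) atlas \<Rightarrow> ('b, real^'n) atlas \<Rightarrow> ('e \<Rightarrow> 'b) \<Rightarrow>
   'e set \<Rightarrow> ('e \<Rightarrow> 'e) \<Rightarrow> nat \<Rightarrow> ('b, 'e) jet \<Rightarrow> ('b, 'e) jet \<Rightarrow> bool"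
where
  "point_prolongation E M \<pi> U \<phi> k \<theta> \<theta>' \<longleftrightarrow>
     (\<exists>x s x' s'.
        local_section E M \<pi> x s \<and> \<theta> = jet M E k x s \<and>
        local_section E M \<pi> x' s' \<and> \<theta>' = jet M E k x' s' \<and>
        x' = \<pi> (\<phi> (s x)) \<and>
        (\<exists>V. mopen M V \<and> x \<in> V \<and> (\<forall>y\<in>V. s y \<in> U \<and> \<phi> (s y) = s' (\<pi> (\<phi> (s y))))))"

definition point_symmetries ::
  "('e, (real^'n) \<times> (real^'m)) atlas \<Rightarrow> ('b, real^'n) atlas \<Rightarrow> ('e \<Rightarrow> 'b) \<Rightarrow>
   (nat \<Rightarrow> ('b, 'e) jet set) \<Rightarrow> ('e set \<times> ('e \<Rightarrow> 'e)) set"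
where
  "point_symmetries E M \<pi> Q =
     {(U, \<phi>). local_diffeo E E U \<phi> \<and>
        (\<forall>k \<theta> \<theta>'. point_prolongation E M \<pi> U \<phi> k \<theta> \<theta>' \<longrightarrow> (\<theta> \<in> Q k \<longleftrightarrow> \<theta>' \<in> Q k))}"

section \<open>Contact symmetries\<close>

text \<open>Coordinates \<open>(x, u, p)\<close> on 1-jets, with \<open>p $ i\<close> the derivative of \<open>u\<close> along the
  \<open>i\<close>-th coordinate of the base.\<close>

definition jet1_chart ::
  "('e \<Rightarrow> 'b) \<Rightarrow> 'e set \<Rightarrow> ('e \<Rightarrow> (real^'n) \<times> (real^'m)) \<Rightarrow> ('b \<Rightarrow> real^'n) \<Rightarrow>
   ('b, 'e) jet \<Rightarrow> (real^'n) \<times> (real^'m) \<times> (real^'m^'n)"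
where
  "jet1_chart \<pi> U \<psi> \<kappa> \<theta> =
     (let x = fst \<theta>; s = (SOME s. s \<in> snd \<theta>) in
      (\<kappa> x, snd (\<psi> (s x)),
       (\<chi> i. frechet_derivative (snd \<circ> \<psi> \<circ> s \<circ> inv_into (\<pi> ` U) \<kappa>) (at (\<kappa> x)) (axis i 1))))"

definition jet1_domain ::
  "('e, (real^'n) \<times> (real^'m)) atlas \<Rightarrow> ('b, real^'n) atlas \<Rightarrow> ('e \<Rightarrow> 'b) \<Rightarrow> 'e set \<Rightarrow>
   ('b, 'e) jet set"
where
  "jet1_domain E M \<pi> U = {\<theta> \<in> jet_space E M \<pi> 1. jet_target \<theta> \<in> U}"

definition jet1_atlas ::
  "('e, (real^'n) \<times> (real^'m)) atlas \<Rightarrow> ('b, real^'n) atlas \<Rightarrow> ('e \<Rightarrow> 'b) \<Rightarrow>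
   (('b, 'e) jet, (real^'n) \<times> (real^'m) \<times> (real^'m^'n)) atlas"
where
  "jet1_atlas E M \<pi> =
     {(jet1_domain E M \<pi> U, jet1_chart \<pi> U \<psi> \<kappa>) | U \<psi> \<kappa>. adapted_chart E M \<pi> U \<psi> \<kappa>}"

text \<open>The contact (Cartan) distribution, the kernel of \<open>du - p dx\<close>, in the coordinates above.\<close>

definition contact_plane ::
  "(real^'n) \<times> (real^'m) \<times> (real^'m^'n) \<Rightarrow> ((real^'n) \<times> (real^'m) \<times> (real^'m^'n)) set"
where
  "contact_plane z = {(dx, du, dp). du = (\<Sum>i\<in>UNIV. (dx $ i) *\<^sub>R (snd (snd z) $ i))}"

definition contact_diffeo ::
  "('e, (real^'n) \<times> (real^'m)) atlas \<Rightarrow> ('b, real^'n) atlas \<Rightarrow> ('e \<Rightarrow> 'b) \<Rightarrow>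
   ('b, 'e) jet set \<Rightarrow> (('b, 'e) jet \<Rightarrow> ('b, 'e) jet) \<Rightarrow> bool"
where
  "contact_diffeo E M \<pi> U \<phi> \<longleftrightarrow>
     local_diffeo (jet1_atlas E M \<pi>) (jet1_atlas E M \<pi>) U \<phi> \<and>
     (\<forall>(V, \<psi>)\<in>jet1_atlas E M \<pi>. \<forall>(W, \<eta>)\<in>jet1_atlas E M \<pi>. \<forall>\<theta>\<in>U.
        \<theta> \<in> V \<and> \<phi> \<theta> \<in> W \<longrightarrow>
        frechet_derivative (\<eta> \<circ> \<phi> \<circ> inv_into V \<psi>) (at (\<psi> \<theta>)) ` contact_plane (\<psi> \<theta>) =
        contact_plane (\<eta> (\<phi> \<theta>)))"

text \<open>As for point transformations: \<open>\<phi>\<close> carries the graph of the 1-jet of \<open>s\<close> into that of \<open>s'\<close>.\<close>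

definition contact_prolongation ::
  "('e, (real^'n) \<times> (real^'m)) atlas \<Rightarrow> ('b, real^'n) atlas \<Rightarrow> ('e \<Rightarrow> 'b) \<Rightarrow>
   ('b, 'e) jet set \<Rightarrow> (('b, 'e) jet \<Rightarrow> ('b, 'e) jet) \<Rightarrow> nat \<Rightarrow> ('b, 'e) jet \<Rightarrow> ('b, 'e) jet \<Rightarrow> bool"
where
  "contact_prolongation E M \<pi> U \<phi> k \<theta> \<theta>' \<longleftrightarrow>
     (\<exists>x s x' s'.
        local_section E M \<pi> x s \<and> \<theta> = jet M E k x s \<and>
        local_section E M \<pi> x' s' \<and> \<theta>' = jet M E k x' s' \<and>
        x' = fst (\<phi> (jet M E 1 x s)) \<and>
        (\<exists>V. mopen M V \<and> x \<in> V \<and>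
           (\<forall>y\<in>V. jet M E 1 y s \<in> U \<and>
              \<phi> (jet M E 1 y s) = jet M E 1 (fst (\<phi> (jet M E 1 y s))) s')))"

text \<open>A contact transformation acts on \<open>k\<close>-jets for \<open>k \<ge> 1\<close> only.\<close>

definition contact_symmetries ::
  "('e, (real^'n) \<times> (real^'m)) atlas \<Rightarrow> ('b, real^'n) atlas \<Rightarrow> ('e \<Rightarrow> 'b) \<Rightarrow>
   (nat \<Rightarrow> ('b, 'e) jet set) \<Rightarrow> (('b, 'e) jet set \<times> (('b, 'e) jet \<Rightarrow> ('b, 'e) jet)) set"
where
  "contact_symmetries E M \<pi> Q =
     {(U, \<phi>). contact_diffeo E M \<pi> U \<phi> \<and>
        (\<forall>k\<ge>1. \<forall>\<theta> \<theta>'. contact_prolongation E M \<pi> U \<phi> k \<theta> \<theta>' \<longrightarrow> (\<theta> \<in> Q k \<longleftrightarrow> \<theta>' \<in> Q k))}"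

section \<open>Algebraic pseudogroups\<close>

definition diffeo_at :: "('p, 'v::euclidean_space) atlas \<Rightarrow> 'p \<Rightarrow> ('p \<Rightarrow> 'p) \<Rightarrow> bool" where
  "diffeo_at A a f \<longleftrightarrow> (\<exists>S. a \<in> S \<and> local_diffeo A A S f)"

text \<open>\<open>L\<close> is a system of differential equations on local diffeomorphisms of the manifold \<open>A\<close>,
  i.e. a tower of sets of jets, which characterizes membership in \<open>G\<close>.\<close>

definition lie_equations ::
  "('p, 'v::euclidean_space) atlas \<Rightarrow> ('p set \<times> ('p \<Rightarrow> 'p)) set \<Rightarrow> (nat \<Rightarrow> ('p, 'p) jet set) \<Rightarrow> bool"
where
  "lie_equations A G L \<longleftrightarrow>
     (\<forall>k. L k \<subseteq> {jet A A k a f | a f. diffeo_at A a f}) \<and>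
     (\<forall>k a f. diffeo_at A a f \<and> jet A A (Suc k) a f \<in> L (Suc k) \<longrightarrow> jet A A k a f \<in> L k) \<and>
     (\<forall>S f. (S, f) \<in> G \<longleftrightarrow>
        local_diffeo A A S f \<and> (\<forall>k. \<forall>a\<in>S. jet A A k a f \<in> L k))"

text \<open>Over fixed source \<open>a\<close> and target \<open>b\<close>, \<open>L k\<close> is given by polynomial relations on the
  derivatives of the components of \<open>f\<close>.\<close>

definition algebraic_lie_equations ::
  "('p, 'v::euclidean_space) atlas \<Rightarrow> (nat \<Rightarrow> ('p, 'p) jet set) \<Rightarrow> bool"
where
  "algebraic_lie_equations A L \<longleftrightarrow>
     (\<forall>k a b. \<forall>(U, \<psi>)\<in>A. \<forall>(V, \<eta>)\<in>A. a \<in> U \<and> b \<in> V \<longrightarrow>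
        (\<exists>P. (\<forall>p\<in>P. polynomial_fun (jet_vars k) p) \<and>
             (\<forall>f. diffeo_at A a f \<and> f a = b \<longrightarrow>
                (jet A A k a f \<in> L k \<longleftrightarrow> (\<forall>p\<in>P. p (jet_coords U \<psi> \<eta> a f) = 0)))))"

definition algebraic_pseudogroup ::
  "('p, 'v::euclidean_space) atlas \<Rightarrow> ('p set \<times> ('p \<Rightarrow> 'p)) set \<Rightarrow> bool"
where
  "algebraic_pseudogroup A G \<longleftrightarrow> (\<exists>L. lie_equations A G L \<and> algebraic_lie_equations A L)"

end

(*
  A k-jet of a section s with graph through a is moved by a transformation f to the k-jet of
  t = f o s o X^-1, where X is the base component of f o s. By the chain rule and Cramer's rule the
  derivatives of t are polynomials in those of f divided by powers of the Jacobian determinant D of X,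
  and D is itself a polynomial in the first derivatives of f. If D vanishes, the graph of f o s is not
  transversal to the fibers and the jet of s imposes no condition; if not, t exists by the inverse
  function theorem. So "f moves the jet of s into the equation" is, for each fixed s, the vanishing of
  the polynomials D * p', where p' runs over the cleared numerators of the polynomials defining the
  equation over f(a). Infinitely many polynomials are allowed, so no elimination of s is needed. The
  same condition on the inverse of f is again polynomial in the derivatives of f. For contact
  transformations s is replaced by its 1-jet; contactness of f is linear in its first derivatives and
  guarantees that t is again the 1-jet of a section.

  Because D involves first derivatives of f, conditions coming from 0-jets are imposed on 1-jets of f.
*)
theory Submission
  imports Defs
begin

section \<open>Iterated derivatives, finite differentiability classes and smooth germs in Euclidean
  spaces\<close>

section \<open>Calculus of smooth germs\<close>

text \<open>Invariance of the equation is an equivalence. It is split into two implications, one for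
  f and one for its inverse, each saying that jets in the equation stay in it. The inverse depends
  on a domain that the jet of f does not record; algebraicity itself shows that the choice is
  immaterial. Point and contact transformations are treated together, as diffeomorphisms of a
  manifold fibred over M with a distinguished set of sections. In the contact case there is an
  obstacle: contactness at a single jet does not make the image t of a prolonged section a
  prolongation again, yet an algebraic condition may look at one jet only. The equation is therefore
  extended, by fixed polynomials, to arbitrary sections of the bundle of 1-jets, and holonomy is
  invoked only for f that is contact on its whole domain. Rational dependence is not followed
  through explicit formulas of Faa di Bruno type. It is a property of families of function germs
  that is closed under the operations used; it records the jet order entering the value at the
  point, and each derivative raises this order by one.\<close>

definition dd :: "'v::euclidean_space \<Rightarrow> ('v \<Rightarrow> 'w::euclidean_space) \<Rightarrow> 'v \<Rightarrow> 'w" where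
  "dd v f x = frechet_derivative f (at x) v"

lemma iter_deriv_Cons: "iter_deriv (v # vs) f = dd v (iter_deriv vs f)"
  by (simp add: dd_def fun_eq_iff)

text \<open>The last entry of the list is differentiated first. Lists can thus be taken apart at
  both ends without symmetry of partial derivatives.\<close>

lemma iter_deriv_snoc: "iter_deriv (vs @ [v]) f = iter_deriv vs (dd v f)"
  by (induction vs) (simp_all add: iter_deriv_Cons dd_def[abs_def, symmetric] del: iter_deriv.simps(2))

lemma dd_eqI: "(f has_derivative f') (at x) \<Longrightarrow> dd v f x = f' v"
  by (metis dd_def frechet_derivative_at)

lemma has_derivative_dd:
  "f differentiable (at x) \<Longrightarrow> (f has_derivative (\<lambda>v. dd v f x)) (at x)"
  by (simp add: dd_def frechet_derivative_works)

lemma dd_linear_combination: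
  fixes f :: "'v::euclidean_space \<Rightarrow> 'w::euclidean_space"
  assumes "f differentiable (at x)"
  shows "dd w f x = (\<Sum>b\<in>Basis. (w \<bullet> b) *\<^sub>R dd b f x)"
proof -
  have l: "linear (\<lambda>v. dd v f x)"
    using has_derivative_dd[OF assms] has_derivative_linear by blast
  have "dd (\<Sum>b\<in>Basis. (w \<bullet> b) *\<^sub>R b) f x = (\<Sum>b\<in>Basis. (w \<bullet> b) *\<^sub>R dd b f x)"
    using linear_sum[OF l, of "\<lambda>b. (w \<bullet> b) *\<^sub>R b" Basis] by (simp add: linear_cmul[OF l])
  then show ?thesis by (simp add: euclidean_representation)
qed

text \<open>No differentiability is involved: \<open>frechet_derivative\<close> is a choice from the
  set of derivatives, and functions that agree near x have the same set.\<close>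

lemma dd_cong_open:
  assumes "open S" "x \<in> S" "\<And>y. y \<in> S \<Longrightarrow> f y = g y"
  shows "dd v f x = dd v g x"
proof -
  have "(f has_derivative f') (at x) \<longleftrightarrow> (g has_derivative f') (at x)" for f'
    using assms has_derivative_transform_within_open[of f f' x UNIV S g]
      has_derivative_transform_within_open[of g f' x UNIV S f] by fastforce
  then show ?thesis by (simp add: dd_def frechet_derivative_def)
qed

lemma iter_deriv_cong_open:
  assumes "open S" "\<And>y. y \<in> S \<Longrightarrow> f y = g y" "x \<in> S"
  shows "iter_deriv vs f x = iter_deriv vs g x"
  using assms(3)
proof (induction vs arbitrary: x)
  case Nil then show ?case using assms by simp
next
  case (Cons v vs)
  then show ?case unfolding iter_deriv_Cons
    using dd_cong_open[OF assms(1)] by blast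
qed

lemma differentiable_cong_open:
  assumes "open S" "x \<in> S" "\<And>y. y \<in> S \<Longrightarrow> f y = g y" "f differentiable (at x)"
  shows "g differentiable (at x)"
  using assms has_derivative_transform_within_open[of f _ x UNIV S g]
  unfolding differentiable_def by fastforce

text \<open>Derivatives along words of length up to n must still be differentiable, so
  \<open>ck 0\<close> is differentiability rather than continuity. The finite level exists for
  induction: calculus rules express a derivative through functions one level lower.\<close>

definition ck :: "nat \<Rightarrow> 'v::euclidean_space set \<Rightarrow> ('v \<Rightarrow> 'w::euclidean_space) \<Rightarrow> bool" where
  "ck n S f \<longleftrightarrow>
     (\<forall>vs. set vs \<subseteq> Basis \<and> length vs \<le> n \<longrightarrow> (\<forall>x\<in>S. iter_deriv vs f differentiable (at x)))"

lemma smooth_on_iff_ck: "smooth_on S f \<longleftrightarrow> (\<forall>n. ck n S f)"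
  unfolding smooth_on_def ck_def by blast

lemma ck_0: "ck 0 S f \<longleftrightarrow> (\<forall>x\<in>S. f differentiable (at x))"
  unfolding ck_def by auto

text \<open>Peels off the derivative that is applied first, by \<open>iter_deriv_snoc\<close>.
  Closure properties then follow by induction on n over all functions at once, since a calculus rule
  gives \<open>dd v f\<close> explicitly.\<close>

lemma ck_Suc:
  "ck (Suc n) S f \<longleftrightarrow> (\<forall>x\<in>S. f differentiable (at x)) \<and> (\<forall>v\<in>Basis. ck n S (dd v f))"
proof (intro iffI conjI ballI)
  fix x assume "ck (Suc n) S f" "x \<in> S"
  then show "f differentiable (at x)"
    unfolding ck_def by (auto dest!: spec[of _ "[]"])
next
  fix v :: 'a assume h: "ck (Suc n) S f" "v \<in> Basis"
  show "ck n S (dd v f)"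
    unfolding ck_def
  proof (intro allI impI ballI)
    fix vs :: "'a list" and x assume vs: "set vs \<subseteq> Basis \<and> length vs \<le> n" and x: "x \<in> S"
    have "iter_deriv (vs @ [v]) f differentiable (at x)"
      using h x vs unfolding ck_def by (auto dest!: spec[of _ "vs @ [v]"])
    then show "iter_deriv vs (dd v f) differentiable (at x)"
      by (simp add: iter_deriv_snoc)
  qed
next
  assume h: "(\<forall>x\<in>S. f differentiable (at x)) \<and> (\<forall>v\<in>Basis. ck n S (dd v f))"
  show "ck (Suc n) S f"
    unfolding ck_def
  proof (intro allI impI ballI)
    fix vs :: "'a list" and x assume vs: "set vs \<subseteq> Basis \<and> length vs \<le> Suc n" and x: "x \<in> S"
    show "iter_deriv vs f differentiable (at x)"
    proof (cases vs rule: rev_cases)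
      case Nil then show ?thesis using h x by simp
    next
      case (snoc ws w)
      then show ?thesis using h x vs by (auto simp: iter_deriv_snoc ck_def)
    qed
  qed
qed

lemma ck_mono: "ck n S f \<Longrightarrow> m \<le> n \<Longrightarrow> T \<subseteq> S \<Longrightarrow> ck m T f"
  unfolding ck_def by (meson order_trans subsetD)

lemma ck_subset: "ck n S f \<Longrightarrow> T \<subseteq> S \<Longrightarrow> ck n T f"
  by (rule ck_mono) auto

lemma ck_differentiable: "ck n S f \<Longrightarrow> x \<in> S \<Longrightarrow> f differentiable (at x)"
  using ck_0 ck_mono[of n S f 0 S] by auto

lemma ck_cong:
  assumes "open S" "\<And>y. y \<in> S \<Longrightarrow> f y = g y" "ck n S f"
  shows "ck n S g"
  unfolding ck_def
proof (intro allI impI ballI)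
  fix vs :: "'a list" and x assume "set vs \<subseteq> Basis \<and> length vs \<le> n" "x \<in> S"
  then show "iter_deriv vs g differentiable (at x)"
    using differentiable_cong_open[OF assms(1), of x "iter_deriv vs f" "iter_deriv vs g"]
      iter_deriv_cong_open[OF assms(1), of f g] assms(2,3) unfolding ck_def by blast
qed

lemma ck_const: "ck n S (\<lambda>x. c)"
proof (induction n arbitrary: c)
  case 0 then show ?case by (simp add: ck_0)
next
  case (Suc n)
  have "dd v (\<lambda>x. c) = (\<lambda>x. 0)" for v :: 'a
    by (rule ext, rule dd_eqI) simp
  then show ?case using Suc by (simp add: ck_Suc)
qed

lemma ck_linear:
  assumes "bounded_linear L"
  shows "ck n S L"
proof -
  have d: "(L has_derivative L) (at x)" for x
    using assms by (rule bounded_linear_imp_has_derivative)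
  have "dd v L = (\<lambda>x. L v)" for v
    by (rule ext, rule dd_eqI) (rule d)
  then show ?thesis
    using d by (cases n) (auto simp: ck_0 ck_Suc ck_const differentiable_def)
qed

lemma ck_add:
  assumes "open S" "ck n S f" "ck n S g"
  shows "ck n S (\<lambda>x. f x + g x)"
  using assms(2,3)
proof (induction n arbitrary: f g)
  case 0 then show ?case by (simp add: ck_0)
next
  case (Suc n)
  have "ck n S (dd v (\<lambda>x. f x + g x))" if v: "v \<in> Basis" for v
  proof (rule ck_cong[OF assms(1)])
    show "ck n S (\<lambda>x. dd v f x + dd v g x)"
      using Suc v by (auto simp: ck_Suc)
    fix x assume "x \<in> S"
    then have "((\<lambda>x. f x + g x) has_derivative (\<lambda>v. dd v f x + dd v g x)) (at x)"
      using Suc.prems by (intro has_derivative_add has_derivative_dd) (auto simp: ck_Suc)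
    then show "dd v f x + dd v g x = dd v (\<lambda>x. f x + g x) x"
      by (simp add: dd_eqI)
  qed
  then show ?case using Suc.prems by (auto simp: ck_Suc)
qed

lemma ck_scaleR:
  assumes "open S" "ck n S f" "ck n S g"
  shows "ck n S (\<lambda>x. f x *\<^sub>R g x)"
  using assms(2,3)
proof (induction n arbitrary: f g)
  case 0 then show ?case by (simp add: ck_0)
next
  case (Suc n)
  have d: "((\<lambda>x. f x *\<^sub>R g x) has_derivative (\<lambda>v. f x *\<^sub>R dd v g x + dd v f x *\<^sub>R g x)) (at x)"
    if "x \<in> S" for x
    using that Suc.prems by (intro has_derivative_scaleR has_derivative_dd) (auto simp: ck_Suc)
  have "ck n S (dd v (\<lambda>x. f x *\<^sub>R g x))" if v: "v \<in> Basis" for v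
  proof (rule ck_cong[OF assms(1)])
    show "ck n S (\<lambda>x. f x *\<^sub>R dd v g x + dd v f x *\<^sub>R g x)"
      using Suc v ck_mono[OF Suc.prems(1), of n S] ck_mono[OF Suc.prems(2), of n S]
      by (intro ck_add[OF assms(1)] Suc.IH) (auto simp: ck_Suc)
    fix x assume "x \<in> S"
    then show "f x *\<^sub>R dd v g x + dd v f x *\<^sub>R g x = dd v (\<lambda>x. f x *\<^sub>R g x) x"
      using dd_eqI[OF d] by simp
  qed
  then show ?case using Suc.prems d by (auto simp: ck_Suc differentiable_def)
qed

lemma ck_mult:
  fixes f g :: "'v::euclidean_space \<Rightarrow> real"
  shows "open S \<Longrightarrow> ck n S f \<Longrightarrow> ck n S g \<Longrightarrow> ck n S (\<lambda>x. f x * g x)"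
  using ck_scaleR[of S n f g] by simp

lemma ck_sum:
  assumes "open S" "\<And>i. i \<in> I \<Longrightarrow> ck n S (f i)"
  shows "ck n S (\<lambda>x. \<Sum>i\<in>I. f i x)"
  using assms(2)
proof (induction I rule: infinite_finite_induct)
  case (insert i I)
  then show ?case using ck_add[OF assms(1), of n "f i" "\<lambda>x. \<Sum>i\<in>I. f i x"] by simp
qed (simp_all add: ck_const)

lemma dd_compose:
  assumes "f differentiable (at x)" "g differentiable (at (f x))"
  shows "dd v (\<lambda>x. g (f x)) x = dd (dd v f x) g (f x)"
  by (rule dd_eqI[where f' = "\<lambda>v. dd (dd v f x) g (f x)"])
    (rule has_derivative_compose[OF has_derivative_dd[OF assms(1)] has_derivative_dd[OF assms(2)]])

text \<open>By the chain rule the derivative is a sum of components of \<open>dd v f\<close> times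
  \<open>dd b g\<close> after f. The former have level n; the latter are covered by the induction
  hypothesis, which is general in g and uses f at the lower level.\<close>

lemma ck_compose:
  fixes f :: "'u::euclidean_space \<Rightarrow> 'v::euclidean_space" and g :: "'v \<Rightarrow> 'w::euclidean_space"
  assumes "open S" "open T" "f ` S \<subseteq> T" "ck n S f" "ck n T g"
  shows "ck n S (\<lambda>x. g (f x))"
  using assms(4,5)
proof (induction n arbitrary: g)
  case 0 then show ?case
    using assms(3) differentiable_compose[of g f] by (auto simp: ck_0 image_subset_iff)
next
  case (Suc n)
  have df: "f differentiable (at x)" "g differentiable (at (f x))" if "x \<in> S" for x
    using that Suc.prems assms(3) by (auto simp: ck_Suc)
  have "ck n S (dd v (\<lambda>x. g (f x)))" if v: "v \<in> Basis" for v
  proof (rule ck_cong[OF assms(1)])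
    show "ck n S (\<lambda>x. \<Sum>b\<in>Basis. (dd v f x \<bullet> b) *\<^sub>R dd b g (f x))"
    proof (intro ck_sum ck_scaleR assms(1))
      fix b :: 'v assume b: "b \<in> Basis"
      show "ck n S (\<lambda>x. dd b g (f x))"
        using Suc b ck_mono[OF Suc.prems(1), of n S] by (intro Suc.IH) (auto simp: ck_Suc)
      have dvf: "ck n S (dd v f)" using Suc.prems v by (simp add: ck_Suc)
      \<comment> \<open>This component rule is a case of \<open>ck_linear_compose\<close>, which is
        itself a consequence of the present lemma; hence a separate induction.\<close>
      show "ck n S (\<lambda>x. dd v f x \<bullet> b)"
        using dvf
      proof (induction n arbitrary: v f)
        case 0 then show ?case by (simp add: ck_0)
      next
        case (Suc m)
        let ?h = "dd v f"
        have e: "dd w (\<lambda>x. ?h x \<bullet> b) x = dd w ?h x \<bullet> b" if "x \<in> S" for x w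
          using that Suc.prems
          by (intro dd_eqI[where f' = "\<lambda>w. dd w ?h x \<bullet> b"] has_derivative_inner_left
              has_derivative_dd) (auto simp: ck_Suc)
        have "ck m S (dd w (\<lambda>x. ?h x \<bullet> b))" if w: "w \<in> Basis" for w
        proof (rule ck_cong[OF assms(1) e[symmetric]])
          show "ck m S (\<lambda>x. dd w ?h x \<bullet> b)"
            using Suc w by (auto simp: ck_Suc)
        qed
        then show ?case using Suc.prems by (auto simp: ck_Suc)
      qed
    qed
    fix x assume x: "x \<in> S"
    show "(\<Sum>b\<in>Basis. (dd v f x \<bullet> b) *\<^sub>R dd b g (f x)) = dd v (\<lambda>x. g (f x)) x"
      using df[OF x] by (simp add: dd_compose dd_linear_combination[of g])
  qed
  moreover have "(\<lambda>x. g (f x)) differentiable (at x)" if "x \<in> S" for x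
    using df[OF that] differentiable_compose[of g f x] by auto
  ultimately show ?case by (auto simp: ck_Suc)
qed

lemma ck_linear_compose:
  "open S \<Longrightarrow> bounded_linear L \<Longrightarrow> ck n S f \<Longrightarrow> ck n S (\<lambda>x. L (f x))"
  by (rule ck_compose[where T = UNIV]) (auto simp: ck_linear)

text \<open>The inverse reappears in its own derivative, where it is only needed at the level
  supplied by the induction hypothesis.\<close>

lemma ck_inverse:
  fixes f :: "'v::euclidean_space \<Rightarrow> real"
  assumes "open S" "ck n S f" "\<And>x. x \<in> S \<Longrightarrow> f x \<noteq> 0"
  shows "ck n S (\<lambda>x. inverse (f x))"
  using assms(2)
proof (induction n)
  case 0 then show ?case using assms(3) by (auto simp: ck_0 intro!: differentiable_inverse)
next
  case (Suc n)
  have d: "((\<lambda>x. inverse (f x)) has_derivative (\<lambda>v. - (inverse (f x) * dd v f x * inverse (f x)))) (at x)"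
    if "x \<in> S" for x
    using that Suc.prems assms(3)
    by (intro Deriv.has_derivative_inverse has_derivative_dd) (auto simp: ck_Suc)
  have i: "ck n S (\<lambda>x. inverse (f x))" using Suc.IH[OF ck_mono[OF Suc.prems, of n S]] by simp
  have "ck n S (dd v (\<lambda>x. inverse (f x)))" if v: "v \<in> Basis" for v
  proof (rule ck_cong[OF assms(1)])
    show "ck n S (\<lambda>x. (-1) * (inverse (f x) * dd v f x * inverse (f x)))"
      using Suc.prems v by (intro ck_mult assms(1) ck_const i) (auto simp: ck_Suc)
    fix x assume "x \<in> S"
    then show "(-1) * (inverse (f x) * dd v f x * inverse (f x)) = dd v (\<lambda>x. inverse (f x)) x"
      using dd_eqI[OF d] by simp
  qed
  then show ?case using d by (auto simp: ck_Suc differentiable_def)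
qed

section \<open>Smooth germs at a point and their closure properties\<close>

definition smooth_near :: "'v::euclidean_space \<Rightarrow> ('v \<Rightarrow> 'w::euclidean_space) \<Rightarrow> bool" where
  "smooth_near x f \<longleftrightarrow> (\<exists>S. open S \<and> x \<in> S \<and> smooth_on S f)"

lemma smooth_nearI: "open S \<Longrightarrow> x \<in> S \<Longrightarrow> (\<And>n. ck n S f) \<Longrightarrow> smooth_near x f"
  unfolding smooth_near_def smooth_on_iff_ck by blast

lemma smooth_nearE:
  assumes "smooth_near x f"
  obtains S where "open S" "x \<in> S" "\<And>n. ck n S f"
  using assms unfolding smooth_near_def smooth_on_iff_ck by blast

lemma smooth_nearD: "smooth_near x f \<Longrightarrow> \<exists>S. open S \<and> x \<in> S \<and> (\<forall>n. ck n S f)"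
  unfolding smooth_near_def smooth_on_iff_ck by blast

lemma smooth_near2E:
  assumes "smooth_near x f" "smooth_near x g"
  obtains S where "open S" "x \<in> S" "\<And>n. ck n S f" "\<And>n. ck n S g"
proof -
  obtain S where S: "open S" "x \<in> S" "\<And>n. ck n S f" using smooth_nearD[OF assms(1)] by auto
  obtain T where T: "open T" "x \<in> T" "\<And>n. ck n T g" using smooth_nearD[OF assms(2)] by auto
  show ?thesis
  proof (rule that[OF open_Int[OF S(1) T(1)]])
    show "x \<in> S \<inter> T" using S(2) T(2) by simp
    show "ck n (S \<inter> T) f" "ck n (S \<inter> T) g" for n
      using ck_subset[OF S(3)] ck_subset[OF T(3)] by simp_all
  qed
qed

lemma smooth_on_iff_near: "open S \<Longrightarrow> smooth_on S f \<longleftrightarrow> (\<forall>x\<in>S. smooth_near x f)"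
  unfolding smooth_near_def by (auto simp: smooth_on_def)

lemma smooth_near_const [simp]: "smooth_near x (\<lambda>y. c)"
  by (rule smooth_nearI[of UNIV]) (auto simp: ck_const)

lemma smooth_near_linear: "bounded_linear L \<Longrightarrow> smooth_near x L"
  by (rule smooth_nearI[of UNIV]) (auto simp: ck_linear)

lemma smooth_near_differentiable: "smooth_near x f \<Longrightarrow> f differentiable (at x)"
  by (erule smooth_nearE) (rule ck_differentiable)

lemma smooth_near_isCont: "smooth_near x f \<Longrightarrow> isCont f x"
  by (simp add: smooth_near_differentiable differentiable_imp_continuous_within)

lemma smooth_near_filterlim: "smooth_near x f \<Longrightarrow> filterlim f (nhds (f x)) (nhds x)"
  using smooth_near_isCont isCont_def tendsto_at_iff_tendsto_nhds by metis

lemma smooth_near_add: "smooth_near x f \<Longrightarrow> smooth_near x g \<Longrightarrow> smooth_near x (\<lambda>y. f y + g y)"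
  by (erule smooth_near2E, assumption) (rule smooth_nearI, auto intro: ck_add)

lemma smooth_near_scaleR:
  "smooth_near x f \<Longrightarrow> smooth_near x g \<Longrightarrow> smooth_near x (\<lambda>y. f y *\<^sub>R g y)"
  by (erule smooth_near2E, assumption) (rule smooth_nearI, auto intro: ck_scaleR)

lemma smooth_near_mult:
  fixes f g :: "'v::euclidean_space \<Rightarrow> real"
  shows "smooth_near x f \<Longrightarrow> smooth_near x g \<Longrightarrow> smooth_near x (\<lambda>y. f y * g y)"
  using smooth_near_scaleR[of x f g] by simp

lemma smooth_near_sum:
  "(\<And>i. i \<in> I \<Longrightarrow> smooth_near x (f i)) \<Longrightarrow> smooth_near x (\<lambda>y. \<Sum>i\<in>I. f i y)"
proof (induction I rule: infinite_finite_induct)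
  case (insert i I)
  then show ?case using smooth_near_add[of x "f i" "\<lambda>x. \<Sum>i\<in>I. f i x"] by simp
qed simp_all

lemma smooth_near_prod:
  fixes f :: "'i \<Rightarrow> 'v::euclidean_space \<Rightarrow> real"
  shows "(\<And>i. i \<in> I \<Longrightarrow> smooth_near x (f i)) \<Longrightarrow> smooth_near x (\<lambda>y. \<Prod>i\<in>I. f i y)"
proof (induction I rule: infinite_finite_induct)
  case (insert i I)
  then show ?case using smooth_near_mult[of x "f i" "\<lambda>x. \<Prod>i\<in>I. f i x"] by simp
qed simp_all

lemma smooth_near_linear_compose:
  "bounded_linear L \<Longrightarrow> smooth_near x f \<Longrightarrow> smooth_near x (\<lambda>y. L (f y))"
  by (erule smooth_nearE) (rule smooth_nearI, auto intro: ck_linear_compose)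

lemma smooth_near_inner: "smooth_near x f \<Longrightarrow> smooth_near x (\<lambda>y. f y \<bullet> b)"
  by (rule smooth_near_linear_compose[OF bounded_linear_inner_left])

lemma smooth_near_dd: "v \<in> Basis \<Longrightarrow> smooth_near x f \<Longrightarrow> smooth_near x (dd v f)"
  by (erule smooth_nearE) (rule smooth_nearI, auto dest: ck_Suc[THEN iffD1])

lemma smooth_near_iter_deriv: "set vs \<subseteq> Basis \<Longrightarrow> smooth_near x f \<Longrightarrow> smooth_near x (iter_deriv vs f)"
  by (induction vs) (auto simp: iter_deriv_Cons smooth_near_dd simp del: iter_deriv.simps(2))

lemma ck_continuous_on: "ck n S f \<Longrightarrow> continuous_on S f"
  by (simp add: ck_differentiable continuous_at_imp_continuous_on differentiable_imp_continuous_within)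

lemma smooth_near_compose:
  assumes "smooth_near x f" "smooth_near (f x) g"
  shows "smooth_near x (\<lambda>y. g (f y))"
proof -
  obtain S where S: "open S" "x \<in> S" "\<And>n. ck n S f" using smooth_nearD[OF assms(1)] by auto
  obtain T where T: "open T" "f x \<in> T" "\<And>n. ck n T g" using smooth_nearD[OF assms(2)] by auto
  have "open (S \<inter> f -` T)"
    using ck_continuous_on[OF S(3)[of 0]] by (rule continuous_open_preimage[OF _ S(1) T(1)])
  then show ?thesis
  proof (rule smooth_nearI)
    show "x \<in> S \<inter> f -` T" using S(2) T(2) by simp
    show "ck n (S \<inter> f -` T) (\<lambda>y. g (f y))" for n
      by (rule ck_compose[OF \<open>open (S \<inter> f -` T)\<close> T(1) _ ck_subset[OF S(3)] T(3)]) auto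
  qed
qed

lemma smooth_near_inverse:
  fixes f :: "'v::euclidean_space \<Rightarrow> real"
  assumes "smooth_near x f" "f x \<noteq> 0"
  shows "smooth_near x (\<lambda>y. inverse (f y))"
proof -
  obtain S where S: "open S" "x \<in> S" "\<And>n. ck n S f" using smooth_nearD[OF assms(1)] by auto
  have "open (S \<inter> f -` (- {0}))"
    using ck_continuous_on[OF S(3)[of 0]] by (rule continuous_open_preimage[OF _ S(1)]) auto
  then show ?thesis
  proof (rule smooth_nearI)
    show "x \<in> S \<inter> f -` (- {0})" using S(2) assms(2) by simp
    show "ck n (S \<inter> f -` (- {0})) (\<lambda>y. inverse (f y))" for n
      by (rule ck_inverse[OF \<open>open (S \<inter> f -` (- {0}))\<close> ck_subset[OF S(3)]]) auto
  qed
qed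

lemma smooth_near_cong:
  assumes "eventually (\<lambda>y. f y = g y) (nhds x)" "smooth_near x f"
  shows "smooth_near x g"
proof -
  obtain S where S: "open S" "x \<in> S" "\<And>n. ck n S f" using smooth_nearD[OF assms(2)] by auto
  obtain T where T: "open T" "x \<in> T" "\<And>y. y \<in> T \<Longrightarrow> f y = g y"
    using assms(1) unfolding eventually_nhds by blast
  have "ck n (S \<inter> T) f" for n
    by (rule ck_subset[OF S(3)]) auto
  then have "ck n (S \<inter> T) g" for n
    by (rule ck_cong[OF open_Int[OF S(1) T(1)], rotated]) (simp add: T(3))
  then show ?thesis using S(2) T(2) by (intro smooth_nearI[OF open_Int[OF S(1) T(1)]]) simp_all
qed

lemma smooth_near_eventually: "smooth_near x f \<Longrightarrow> eventually (\<lambda>y. smooth_near y f) (nhds x)"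
  unfolding eventually_nhds by (erule smooth_nearE) (meson smooth_nearI)

lemma iter_deriv_cong:
  assumes "eventually (\<lambda>y. f y = g y) (nhds x)"
  shows "iter_deriv vs f x = iter_deriv vs g x"
  using assms unfolding eventually_nhds by (metis iter_deriv_cong_open)

lemma dd_cong:
  assumes "eventually (\<lambda>y. f y = g y) (nhds x)"
  shows "dd v f x = dd v g x"
  using assms unfolding eventually_nhds by (metis dd_cong_open)

lemma dd_cong_eventually:
  assumes "eventually (\<lambda>y. f y = g y) (nhds x)"
  shows "eventually (\<lambda>y. dd v f y = dd v g y) (nhds x)"
  using assms unfolding eventually_nhds by (metis dd_cong_open)

lemma smooth_near_Pair:
  assumes "smooth_near x f" "smooth_near x g"
  shows "smooth_near x (\<lambda>y. (f y, g y))"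
proof -
  have "smooth_near x (\<lambda>y. (f y, 0) + (0, g y))"
    by (intro smooth_near_add smooth_near_linear_compose[of "\<lambda>a. (a, 0)"]
        smooth_near_linear_compose[of "\<lambda>a. (0, a)"] assms bounded_linear_Pair
        bounded_linear_ident bounded_linear_zero)
  then show ?thesis by simp
qed

lemma smooth_near_fst: "smooth_near x f \<Longrightarrow> smooth_near x (\<lambda>y. fst (f y))"
  by (rule smooth_near_linear_compose[OF bounded_linear_fst])

lemma smooth_near_snd: "smooth_near x f \<Longrightarrow> smooth_near x (\<lambda>y. snd (f y))"
  by (rule smooth_near_linear_compose[OF bounded_linear_snd])

lemma smooth_near_id: "smooth_near x (\<lambda>y. y)"
  by (rule smooth_near_linear[OF bounded_linear_ident])

lemma dd_linear_compose:
  assumes "bounded_linear L" "f differentiable (at x)"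
  shows "dd v (\<lambda>y. L (f y)) x = L (dd v f x)"
  by (rule dd_eqI[where f' = "\<lambda>v. L (dd v f x)"])
    (rule bounded_linear.has_derivative[OF assms(1) has_derivative_dd[OF assms(2)]])

lemma iter_deriv_linear_compose:
  assumes "bounded_linear L" "smooth_near x f" "set vs \<subseteq> Basis"
  shows "iter_deriv vs (\<lambda>y. L (f y)) x = L (iter_deriv vs f x)"
  using assms(2,3)
proof (induction vs arbitrary: f rule: rev_induct)
  case Nil then show ?case by simp
next
  case (snoc v vs)
  have "eventually (\<lambda>y. dd v (\<lambda>y. L (f y)) y = L (dd v f y)) (nhds x)"
    using smooth_near_eventually[OF snoc.prems(1)]
    by eventually_elim (simp add: dd_linear_compose[OF assms(1)] smooth_near_differentiable)
  then have "iter_deriv vs (dd v (\<lambda>y. L (f y))) x = iter_deriv vs (\<lambda>y. L (dd v f y)) x"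
    by (rule iter_deriv_cong)
  then show ?case using snoc smooth_near_dd by (auto simp: iter_deriv_snoc)
qed

lemma iter_deriv_inner:
  "smooth_near x f \<Longrightarrow> set vs \<subseteq> Basis \<Longrightarrow> iter_deriv vs (\<lambda>y. f y \<bullet> b) x = iter_deriv vs f x \<bullet> b"
  by (rule iter_deriv_linear_compose[OF bounded_linear_inner_left])

section \<open>Cramer's rule and smoothness of local inverses\<close>

section \<open>Jacobian determinants and inverse maps\<close>

text \<open>A finite index type for the standard basis makes determinants of type \<open>real^'n^'n\<close> available
  for an arbitrary Euclidean space.\<close>

typedef (overloaded) 'v basis_index = "Basis :: 'v::euclidean_space set"
  morphisms basis_vec Abs_basis_index
  using nonempty_Basis by blast

instance basis_index :: (euclidean_space) finite
proof
  have "(UNIV :: 'a basis_index set) = Abs_basis_index ` Basis"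
    using type_definition.Abs_image[OF type_definition_basis_index] by (rule sym)
  then show "finite (UNIV :: 'a basis_index set)"
    by (metis finite_Basis finite_imageI)
qed

lemma basis_vec_in_Basis [simp]: "basis_vec i \<in> Basis"
  by (rule basis_vec)

lemma range_basis_vec: "range basis_vec = Basis"
  by (rule type_definition.Rep_range[OF type_definition_basis_index])

lemma basis_vec_eqI:
  fixes v w :: "'v::euclidean_space"
  assumes "\<And>i. v \<bullet> basis_vec i = w \<bullet> basis_vec i"
  shows "v = w"
  by (rule euclidean_eqI) (metis assms range_basis_vec rangeE)

lemma bij_basis_vec: "bij_betw basis_vec UNIV Basis"
  by (metis basis_vec_inject bij_betw_imageI inj_onI range_basis_vec)

lemma sum_basis_vec: "(\<Sum>b\<in>Basis. f b) = (\<Sum>i\<in>UNIV. f (basis_vec i))"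
  by (rule sum.reindex_bij_betw[OF bij_basis_vec, symmetric])

definition jmat :: "('v::euclidean_space \<Rightarrow> 'v) \<Rightarrow> 'v \<Rightarrow> real^'v basis_index^'v basis_index" where
  "jmat X y = (\<chi> i j. dd (basis_vec j) X y \<bullet> basis_vec i)"

definition jdet :: "('v::euclidean_space \<Rightarrow> 'v) \<Rightarrow> 'v \<Rightarrow> real" where
  "jdet X y = det (jmat X y)"

text \<open>The numerators in Cramer's rule for the solution \<open>w\<close> of \<open>DX w = v\<close>.\<close>

definition jcof :: "('v::euclidean_space \<Rightarrow> 'v) \<Rightarrow> 'v basis_index \<Rightarrow> 'v \<Rightarrow> 'v \<Rightarrow> real" where
  "jcof X i v y =
     det (\<chi> r c. if c = i then v \<bullet> basis_vec r else dd (basis_vec c) X y \<bullet> basis_vec r)"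

text \<open>Here v is a combination of the images of the basis vectors rather than the image of a
  solution vector. Applied to a function h at X y, this turns \<open>dd v h\<close> into a
  combination of derivatives of h composed with X.\<close>

lemma jacobian_cramer:
  assumes "jdet X y \<noteq> 0"
  shows "(\<Sum>i\<in>UNIV. (inverse (jdet X y) * jcof X i v y) *\<^sub>R dd (basis_vec i) X y) = v"
proof (rule basis_vec_eqI)
  fix r
  let ?b = "\<chi> r. v \<bullet> basis_vec r"
  let ?w = "\<chi> i. inverse (jdet X y) * jcof X i v y"
  have "jmat X y *v ?w = ?b"
    using assms unfolding jdet_def
    by (subst cramer) (auto simp: vec_eq_iff jcof_def jdet_def jmat_def divide_inverse
        intro!: arg_cong[of _ _ det] cong: if_cong)
  then have "(jmat X y *v ?w) $ r = v \<bullet> basis_vec r" by simp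
  then show "(\<Sum>i\<in>UNIV. (inverse (jdet X y) * jcof X i v y) *\<^sub>R dd (basis_vec i) X y) \<bullet> basis_vec r
      = v \<bullet> basis_vec r"
    by (simp add: matrix_vector_mult_def jmat_def inner_sum_left mult.commute)
qed

text \<open>Translates between matrices over the index type and linear maps of the space. Trivial
  kernel is the form that the inverse function theorem consumes and that a local left inverse
  provides.\<close>

lemma jdet_nonzero_iff:
  assumes "X differentiable (at y)"
  shows "jdet X y \<noteq> 0 \<longleftrightarrow> (\<forall>w. dd w X y = 0 \<longrightarrow> w = 0)"
proof -
  have l: "linear (\<lambda>v. dd v X y)"
    using has_derivative_dd[OF assms] has_derivative_linear by blast
  have e: "jmat X y *v u = 0 \<longleftrightarrow> dd (\<Sum>i\<in>UNIV. u $ i *\<^sub>R basis_vec i) X y = 0" for u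
  proof -
    have "dd (\<Sum>i\<in>UNIV. u $ i *\<^sub>R basis_vec i) X y \<bullet> basis_vec r = (jmat X y *v u) $ r" for r
      by (simp add: linear_sum[OF l] linear_cmul[OF l] matrix_vector_mult_def jmat_def
          inner_sum_left mult.commute)
    then have "dd (\<Sum>i\<in>UNIV. u $ i *\<^sub>R basis_vec i) X y = 0 \<longleftrightarrow> (\<forall>r. (jmat X y *v u) $ r = 0)"
      by (auto intro: basis_vec_eqI)
    then show ?thesis by (simp add: vec_eq_iff)
  qed
  have coord: "(\<Sum>i\<in>UNIV. u $ i *\<^sub>R basis_vec i) \<bullet> basis_vec r = u $ r"
    for u :: "real^'a basis_index" and r
  proof -
    have "u $ i * (basis_vec i \<bullet> basis_vec r) = (if i = r then u $ i else 0)" for i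
      by (simp add: inner_Basis basis_vec_inject)
    then show ?thesis by (simp add: inner_sum_left)
  qed
  have u: "\<exists>u. w = (\<Sum>i\<in>UNIV. u $ i *\<^sub>R basis_vec i)" for w :: 'a
  proof
    show "w = (\<Sum>i\<in>UNIV. (\<chi> i. w \<bullet> basis_vec i) $ i *\<^sub>R basis_vec i)"
      using euclidean_representation[of w] by (simp add: sum_basis_vec)
  qed
  have z: "(\<Sum>i\<in>UNIV. u $ i *\<^sub>R basis_vec i) = (0::'a) \<longleftrightarrow> u = 0" for u :: "real^'a basis_index"
  proof
    assume "(\<Sum>i\<in>UNIV. u $ i *\<^sub>R basis_vec i) = (0::'a)"
    then have "u $ r = 0" for r using coord[of u r] by simp
    then show "u = 0" by (simp add: vec_eq_iff)
  qed simp
  have "jdet X y \<noteq> 0 \<longleftrightarrow> (\<forall>u. jmat X y *v u = 0 \<longrightarrow> u = 0)"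
    unfolding jdet_def invertible_det_nz[symmetric] invertible_left_inverse
      matrix_left_invertible_ker ..
  also have "\<dots> \<longleftrightarrow> (\<forall>w. dd w X y = 0 \<longrightarrow> w = 0)"
  proof (intro iffI allI impI)
    fix w assume h: "\<forall>u. jmat X y *v u = 0 \<longrightarrow> u = 0" "dd w X y = 0"
    obtain u where w: "w = (\<Sum>i\<in>UNIV. u $ i *\<^sub>R basis_vec i)" using u by blast
    then have "jmat X y *v u = 0" using h(2) e[of u] by simp
    then have "u = 0" using h(1) by blast
    then show "w = 0" using w by simp
  next
    fix u assume h: "\<forall>w. dd w X y = 0 \<longrightarrow> w = 0" "jmat X y *v u = 0"
    then show "u = 0" using e[of u] z[of u] by blast
  qed
  finally show ?thesis .
qed

lemma smooth_near_det:
  fixes f :: "'i::finite \<Rightarrow> 'i \<Rightarrow> 'v::euclidean_space \<Rightarrow> real"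
  assumes "\<And>i j. smooth_near x (f i j)"
  shows "smooth_near x (\<lambda>y. det (\<chi> i j. f i j y))"
  unfolding det_def
  by (intro smooth_near_sum smooth_near_mult smooth_near_const smooth_near_prod) (simp add: assms)

lemma smooth_near_jdet: "smooth_near x X \<Longrightarrow> smooth_near x (jdet X)"
  unfolding jdet_def[abs_def] jmat_def
  by (intro smooth_near_det smooth_near_inner smooth_near_dd) auto

lemma smooth_near_jcof: "smooth_near x X \<Longrightarrow> smooth_near x (jcof X i v)"
  unfolding jcof_def[abs_def]
proof (rule smooth_near_det)
  fix r c
  show "smooth_near x (\<lambda>y. if c = i then v \<bullet> basis_vec r else dd (basis_vec c) X y \<bullet> basis_vec r)"
    if "smooth_near x X"
    using that by (cases "c = i") (simp_all add: smooth_near_inner smooth_near_dd)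
qed

text \<open>The inverse function theorem provides a differentiable local inverse g. By Cramer's rule
  the partial derivatives of g are fixed smooth functions evaluated at g, so if g has level n then
  so do its first derivatives, and g has level n + 1.\<close>

theorem smooth_inverse_function:
  fixes X :: "'v::euclidean_space \<Rightarrow> 'v"
  assumes "smooth_near x X" "jdet X x \<noteq> 0"
  obtains Y where "smooth_near (X x) Y" "Y (X x) = x"
    "eventually (\<lambda>y. Y (X y) = y) (nhds x)" "eventually (\<lambda>z. X (Y z) = z) (nhds (X x))"
proof -
  obtain S0 where S0: "open S0" "x \<in> S0" "\<And>n. ck n S0 X" using smooth_nearD[OF assms(1)] by auto
  \<comment> \<open>Where the Jacobian is nonzero the coefficients \<open>?m\<close> below are
    smooth, and g takes its values in this set.\<close>
  define S where "S = S0 \<inter> jdet X -` (- {0})"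
  have near: "smooth_near y X" if "y \<in> S0" for y by (rule smooth_nearI[OF S0(1) that S0(3)])
  have "continuous_on S0 (jdet X)"
    using smooth_near_jdet[OF near] smooth_near_isCont continuous_at_imp_continuous_on by blast
  then have oS: "open S"
    unfolding S_def by (rule continuous_open_preimage[OF _ S0(1)]) auto
  have xS: "x \<in> S" using S0 assms(2) by (simp add: S_def)
  have diff: "X differentiable (at y)" if "y \<in> S" for y
    using that near smooth_near_differentiable by (auto simp: S_def)
  define f' where "f' y = Blinfun (\<lambda>v. dd v X y)" for y
  have f': "blinfun_apply (f' y) = (\<lambda>v. dd v X y)" if "y \<in> S" for y
    unfolding f'_def using has_derivative_bounded_linear[OF has_derivative_dd[OF diff[OF that]]]
    by (rule bounded_linear_Blinfun_apply)
  have cf: "continuous_on S f'"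
  proof (rule continuous_on_blinfun_componentwise)
    fix i :: 'v assume i: "i \<in> Basis"
    have "continuous_on S (dd i X)"
      using smooth_near_dd[OF i near] smooth_near_isCont continuous_at_imp_continuous_on
      by (metis IntD1 S_def)
    then show "continuous_on S (\<lambda>y. blinfun_apply (f' y) i)"
      by (rule continuous_on_cong[THEN iffD1, rotated 2]) (auto simp: f')
  qed
  have inj: "inj (\<lambda>v. dd v X y)" if "y \<in> S" for y
  proof -
    have "linear (\<lambda>v. dd v X y)"
      using has_derivative_dd[OF diff[OF that]] has_derivative_linear by blast
    then show ?thesis
      using jdet_nonzero_iff[OF diff[OF that]] that by (auto simp: linear_injective_0 S_def)
  qed
  obtain g0 where g0: "linear g0" "g0 \<circ> (\<lambda>v. dd v X x) = id"
    using linear_injective_left_inverse[OF _ inj[OF xS]] has_derivative_dd[OF diff[OF xS]]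
      has_derivative_linear by blast
  have inv: "Blinfun g0 o\<^sub>L f' x = id_blinfun"
    using g0 f'[OF xS] by (intro blinfun_eqI)
      (auto simp: bounded_linear_Blinfun_apply linear_conv_bounded_linear fun_eq_iff)
  have der: "(X has_derivative blinfun_apply (f' y)) (at y)" if "y \<in> S" for y
    using has_derivative_dd[OF diff[OF that]] f'[OF that] by simp
  obtain U' V g g' where UV: "open U'" "U' \<subseteq> S" "x \<in> U'" "open V" "X x \<in> V"
    "homeomorphism U' V X g" "\<And>y. y \<in> V \<Longrightarrow> (g has_derivative (g' y)) (at y)"
    "\<And>y. y \<in> V \<Longrightarrow> g' y = inv (blinfun_apply (f' (g y)))"
    "\<And>y. y \<in> V \<Longrightarrow> bij (blinfun_apply (f' (g y)))"
    by (rule inverse_function_theorem[OF oS _ cf xS inv], erule der) (rule that)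
  have gV: "g ` V = U'" using UV(6) by (simp add: homeomorphism_def)
  let ?m = "\<lambda>i j y. inverse (jdet X y) * jcof X i j y"
  have dg: "dd j g y = (\<Sum>i\<in>UNIV. ?m i j (g y) *\<^sub>R basis_vec i)" if y: "y \<in> V" for y j
  proof -
    have gy: "g y \<in> S" using y gV UV(2) by blast
    have l: "linear (\<lambda>v. dd v X (g y))"
      using has_derivative_dd[OF diff[OF gy]] has_derivative_linear by blast
    have "dd (\<Sum>i\<in>UNIV. ?m i j (g y) *\<^sub>R basis_vec i) X (g y) = j"
      using jacobian_cramer[of X "g y" j] gy
        linear_sum[OF l, of "\<lambda>i. ?m i j (g y) *\<^sub>R basis_vec i" UNIV]
      by (simp add: linear_cmul[OF l] S_def)
    then have "blinfun_apply (f' (g y)) (\<Sum>i\<in>UNIV. ?m i j (g y) *\<^sub>R basis_vec i) = j"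
      using f'[OF gy] by simp
    then have "g' y j = (\<Sum>i\<in>UNIV. ?m i j (g y) *\<^sub>R basis_vec i)"
      using UV(8,9)[OF y] by (metis bij_is_inj inv_f_f)
    then show ?thesis using UV(7)[OF y] by (simp add: dd_eqI)
  qed
  have m: "ck n S (?m i j)" for n i j
  proof -
    have "smooth_near y (?m i j)" if "y \<in> S" for y
      using that near by (intro smooth_near_mult smooth_near_inverse smooth_near_jdet smooth_near_jcof)
        (auto simp: S_def)
    then have "smooth_on S (?m i j)" by (simp add: smooth_on_iff_near[OF oS])
    then show ?thesis by (simp add: smooth_on_iff_ck)
  qed
  have "ck n V g" for n
  proof (induction n)
    case 0 then show ?case using UV(7) by (auto simp: ck_0 differentiable_def)
  next
    case (Suc n)
    have "ck n V (dd j g)" for j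
    proof (rule ck_cong[OF UV(4) dg[symmetric]])
      show "ck n V (\<lambda>y. \<Sum>i\<in>UNIV. ?m i j (g y) *\<^sub>R basis_vec i)"
        using gV UV(2)
        by (intro ck_sum ck_scaleR ck_const UV(4) ck_compose[OF UV(4) oS _ Suc m]) auto
    qed
    then show ?case using UV(7) by (auto simp: ck_Suc differentiable_def)
  qed
  then have "smooth_near (X x) g" by (rule smooth_nearI[OF UV(4,5)])
  moreover have "g (X x) = x" using UV(3,6) by (simp add: homeomorphism_def)
  moreover have "eventually (\<lambda>y. g (X y) = y) (nhds x)"
    using UV(1,3,6) unfolding eventually_nhds homeomorphism_def by blast
  moreover have "eventually (\<lambda>z. X (g z) = z) (nhds (X x))"
    using UV(4,5,6) unfolding eventually_nhds homeomorphism_def by blast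
  ultimately show ?thesis by (rule that)
qed

section \<open>Families of germs depending rationally on jet coordinates\<close>

section \<open>Rational dependence on jets\<close>

lemma dd_add:
  assumes "smooth_near x f" "smooth_near x g"
  shows "dd v (\<lambda>y. f y + g y) x = dd v f x + dd v g x"
  by (rule dd_eqI[where f' = "\<lambda>v. dd v f x + dd v g x"])
    (intro has_derivative_add has_derivative_dd smooth_near_differentiable assms)

lemma dd_mult:
  fixes f g :: "'v::euclidean_space \<Rightarrow> real"
  assumes "smooth_near x f" "smooth_near x g"
  shows "dd v (\<lambda>y. f y * g y) x = f x * dd v g x + dd v f x * g x"
  by (rule dd_eqI[where f' = "\<lambda>v. f x * dd v g x + dd v f x * g x"])
    (intro has_derivative_mult has_derivative_dd smooth_near_differentiable assms)

lemma dd_inverse: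
  fixes f :: "'v::euclidean_space \<Rightarrow> real"
  assumes "smooth_near x f" "f x \<noteq> 0"
  shows "dd v (\<lambda>y. inverse (f y)) x = - (inverse (f x) * dd v f x * inverse (f x))"
  by (rule dd_eqI[where f' = "\<lambda>v. - (inverse (f x) * dd v f x * inverse (f x))"])
    (intro Deriv.has_derivative_inverse has_derivative_dd smooth_near_differentiable assms)

lemma dd_inner: "smooth_near x f \<Longrightarrow> dd v (\<lambda>y. f y \<bullet> b) x = dd v f x \<bullet> b"
  by (rule dd_linear_compose[OF bounded_linear_inner_left smooth_near_differentiable])

lemma polynomial_fun_mono: "polynomial_fun I p \<Longrightarrow> I \<subseteq> J \<Longrightarrow> polynomial_fun J p"
  by (induction rule: polynomial_fun.induct) (auto intro: polynomial_fun.intros)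

lemma polynomial_fun_power: "polynomial_fun I p \<Longrightarrow> polynomial_fun I (\<lambda>w. p w ^ n)"
  by (induction n) (auto intro: polynomial_fun.intros)

locale rational_jets =
  fixes F :: "'f set" and c :: "'f \<Rightarrow> 'i \<Rightarrow> real" and I :: "nat \<Rightarrow> 'i set" and D :: "'f \<Rightarrow> real"
  assumes I_mono: "m \<le> n \<Longrightarrow> I m \<subseteq> I n"
    and D_polynomial: "\<exists>d. polynomial_fun (I 0) d \<and> (\<forall>f\<in>F. D f = d (c f))"
    and D_nonzero: "f \<in> F \<Longrightarrow> D f \<noteq> 0"
begin

text \<open>This is q = p / D^N with the same N and p for all of \<open>F\<close>. Uniformity in f
  is the whole content, since any single value is a constant.\<close>

definition rat :: "nat \<Rightarrow> ('f \<Rightarrow> real) \<Rightarrow> bool" where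
  "rat r q \<longleftrightarrow> (\<exists>N p. polynomial_fun (I r) p \<and> (\<forall>f\<in>F. D f ^ N * q f = p (c f)))"

lemma rat_cong: "(\<And>f. f \<in> F \<Longrightarrow> q f = q' f) \<Longrightarrow> rat r q \<Longrightarrow> rat r q'"
  unfolding rat_def by metis

lemma rat_mono: "rat r q \<Longrightarrow> r \<le> s \<Longrightarrow> rat s q"
  unfolding rat_def using polynomial_fun_mono I_mono by metis

lemma rat_const: "rat r (\<lambda>f. a)"
  unfolding rat_def by (rule exI[of _ 0], rule exI[of _ "\<lambda>w. a"]) (simp add: polynomial_fun.const)

lemma rat_coord: "i \<in> I r \<Longrightarrow> rat r (\<lambda>f. c f i)"
  unfolding rat_def by (rule exI[of _ 0], rule exI[of _ "\<lambda>w. w i"]) (simp add: polynomial_fun.var)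

lemma rat_inverse_D: "rat r (\<lambda>f. inverse (D f))"
  unfolding rat_def
  by (rule exI[of _ 1], rule exI[of _ "\<lambda>w. 1"]) (simp add: polynomial_fun.const D_nonzero)

lemma rat_mult:
  assumes "rat r p" "rat r q"
  shows "rat r (\<lambda>f. p f * q f)"
proof -
  obtain N p' M q' where pq: "polynomial_fun (I r) p'" "\<forall>f\<in>F. D f ^ N * p f = p' (c f)"
    "polynomial_fun (I r) q'" "\<forall>f\<in>F. D f ^ M * q f = q' (c f)"
    using assms unfolding rat_def by blast
  have "polynomial_fun (I r) (\<lambda>w. p' w * q' w)"
    by (intro polynomial_fun.intros pq)
  moreover have "D f ^ (N + M) * (p f * q f) = p' (c f) * q' (c f)" if f: "f \<in> F" for f
  proof -
    have "D f ^ (N + M) * (p f * q f) = (D f ^ N * p f) * (D f ^ M * q f)"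
      by (simp add: power_add)
    then show ?thesis using pq(2,4) f by simp
  qed
  ultimately show ?thesis unfolding rat_def
    by (intro exI[of _ "N + M"] exI[of _ "\<lambda>w. p' w * q' w"]) blast
qed

text \<open>Bringing two fractions to the common exponent N + M multiplies the numerators by powers
  of \<open>D\<close>, which stay polynomial because \<open>D\<close> is.\<close>

lemma rat_add:
  assumes "rat r p" "rat r q"
  shows "rat r (\<lambda>f. p f + q f)"
proof -
  obtain N p' M q' where pq: "polynomial_fun (I r) p'" "\<forall>f\<in>F. D f ^ N * p f = p' (c f)"
    "polynomial_fun (I r) q'" "\<forall>f\<in>F. D f ^ M * q f = q' (c f)"
    using assms unfolding rat_def by blast
  obtain d where d: "polynomial_fun (I r) d" "\<forall>f\<in>F. D f = d (c f)"
    using D_polynomial I_mono[of 0 r] polynomial_fun_mono by blast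
  have "polynomial_fun (I r) (\<lambda>w. d w ^ M * p' w + d w ^ N * q' w)"
    by (intro polynomial_fun.intros polynomial_fun_power d pq)
  moreover have "D f ^ (N + M) * (p f + q f) = d (c f) ^ M * p' (c f) + d (c f) ^ N * q' (c f)"
    if f: "f \<in> F" for f
  proof -
    have "D f ^ (N + M) * (p f + q f) = D f ^ M * (D f ^ N * p f) + D f ^ N * (D f ^ M * q f)"
      by (simp add: power_add algebra_simps)
    then show ?thesis using pq(2,4) d(2) f by simp
  qed
  ultimately show ?thesis unfolding rat_def
    by (intro exI[of _ "N + M"] exI[of _ "\<lambda>w. d w ^ M * p' w + d w ^ N * q' w"]) blast
qed

lemma rat_polynomial:
  assumes "polynomial_fun J p" "\<And>j. j \<in> J \<Longrightarrow> rat r (\<lambda>f. q f j)"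
  shows "rat r (\<lambda>f. p (q f))"
  using assms by (induction rule: polynomial_fun.induct) (auto intro: rat_const rat_add rat_mult)

text \<open>A field is a family of germs of functions at \<open>x\<close> whose derivatives of every order at \<open>x\<close>
  depend rationally on \<open>c\<close>, \<open>r\<close> being the jet order involved in its value at \<open>x\<close>.\<close>

primrec field_upto :: "nat \<Rightarrow> nat \<Rightarrow> 'x::euclidean_space \<Rightarrow> ('f \<Rightarrow> 'x \<Rightarrow> real) \<Rightarrow> bool" where
  "field_upto 0 r x Q \<longleftrightarrow> rat r (\<lambda>f. Q f x)"
| "field_upto (Suc n) r x Q \<longleftrightarrow>
     rat r (\<lambda>f. Q f x) \<and> (\<forall>v\<in>Basis. field_upto n (Suc r) x (\<lambda>f. dd v (Q f)))"

definition smooth_germs :: "'x::euclidean_space \<Rightarrow> ('f \<Rightarrow> 'x \<Rightarrow> 'y::euclidean_space) \<Rightarrow> bool" where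
  "smooth_germs x Q \<longleftrightarrow> (\<forall>f\<in>F. smooth_near x (Q f))"

definition germ_field :: "nat \<Rightarrow> 'x::euclidean_space \<Rightarrow> ('f \<Rightarrow> 'x \<Rightarrow> real) \<Rightarrow> bool" where
  "germ_field r x Q \<longleftrightarrow> smooth_germs x Q \<and> (\<forall>n. field_upto n r x Q)"

lemma field_upto_rat: "field_upto n r x Q \<Longrightarrow> rat r (\<lambda>f. Q f x)"
  by (cases n) auto

lemma field_upto_cong:
  assumes "\<And>f. f \<in> F \<Longrightarrow> eventually (\<lambda>y. Q f y = Q' f y) (nhds x)" "field_upto n r x Q"
  shows "field_upto n r x Q'"
  using assms
proof (induction n arbitrary: r Q Q')
  case 0
  show ?case
    using rat_cong[of "\<lambda>f. Q f x" "\<lambda>f. Q' f x" r] 0(1)[THEN eventually_nhds_x_imp_x] 0(2) by simp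
next
  case (Suc n)
  have "rat r (\<lambda>f. Q' f x)"
    using rat_cong[of "\<lambda>f. Q f x" "\<lambda>f. Q' f x" r] Suc.prems(1)[THEN eventually_nhds_x_imp_x] Suc.prems(2)
    by simp
  moreover have "field_upto n (Suc r) x (\<lambda>f. dd v (Q' f))" if "v \<in> Basis" for v
  proof (rule Suc.IH)
    show "field_upto n (Suc r) x (\<lambda>f. dd v (Q f))" using Suc.prems(2) that by simp
    show "eventually (\<lambda>y. dd v (Q f) y = dd v (Q' f) y) (nhds x)" if "f \<in> F" for f
      using Suc.prems(1)[OF that] by (rule dd_cong_eventually)
  qed
  ultimately show ?case by simp
qed

lemma field_upto_Suc: "field_upto (Suc n) r x Q \<Longrightarrow> field_upto n r x Q"
  by (induction n arbitrary: r Q) auto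

lemma field_upto_mono: "field_upto n r x Q \<Longrightarrow> r \<le> s \<Longrightarrow> field_upto n s x Q"
proof (induction n arbitrary: r s Q)
  case (Suc n)
  have "rat s (\<lambda>f. Q f x)" using rat_mono[OF field_upto_rat[OF Suc.prems(1)] Suc.prems(2)] .
  moreover have "field_upto n (Suc s) x (\<lambda>f. dd v (Q f))" if "v \<in> Basis" for v
    using Suc.prems that by (intro Suc.IH[of "Suc r" _ "Suc s"]) simp_all
  ultimately show ?case by simp
qed (simp, rule rat_mono)

lemma smooth_germs_dd: "smooth_germs x Q \<Longrightarrow> v \<in> Basis \<Longrightarrow> smooth_germs x (\<lambda>f. dd v (Q f))"
  by (simp add: smooth_germs_def smooth_near_dd)

lemma smooth_germs_mult:
  "smooth_germs x P \<Longrightarrow> smooth_germs x Q \<Longrightarrow> smooth_germs x (\<lambda>f y. P f y * Q f y :: real)"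
  by (simp add: smooth_germs_def smooth_near_mult)

lemma field_upto_add:
  assumes "field_upto n r x P" "field_upto n r x Q" "smooth_germs x P" "smooth_germs x Q"
  shows "field_upto n r x (\<lambda>f y. P f y + Q f y)"
  using assms
proof (induction n arbitrary: r P Q)
  case 0 then show ?case by (simp add: rat_add)
next
  case (Suc n)
  have "field_upto n (Suc r) x (\<lambda>f. dd v (\<lambda>y. P f y + Q f y))" if v: "v \<in> Basis" for v
  proof (rule field_upto_cong)
    show "field_upto n (Suc r) x (\<lambda>f y. dd v (P f) y + dd v (Q f) y)"
      using Suc.prems v by (intro Suc.IH smooth_germs_dd) auto
    fix f assume "f \<in> F"
    then have "eventually (\<lambda>y. smooth_near y (P f)) (nhds x)" "eventually (\<lambda>y. smooth_near y (Q f)) (nhds x)"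
      using Suc.prems by (auto simp: smooth_germs_def smooth_near_eventually)
    then show "eventually (\<lambda>y. dd v (P f) y + dd v (Q f) y = dd v (\<lambda>y. P f y + Q f y) y) (nhds x)"
      by eventually_elim (simp add: dd_add)
  qed
  then show ?case using Suc.prems by (auto intro: rat_add)
qed

lemma field_upto_mult:
  assumes "field_upto n r x P" "field_upto n r x Q" "smooth_germs x P" "smooth_germs x Q"
  shows "field_upto n r x (\<lambda>f y. P f y * Q f y)"
  using assms
proof (induction n arbitrary: r P Q)
  case 0 then show ?case by (simp add: rat_mult)
next
  case (Suc n)
  \<comment> \<open>The undifferentiated factors of the Leibniz rule are moved up to the order
    \<open>Suc r\<close> of the differentiated ones.\<close>
  have sm: "field_upto n (Suc r) x P" "field_upto n (Suc r) x Q"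
    using Suc.prems(1,2)[THEN field_upto_Suc] by (auto intro: field_upto_mono)
  have "field_upto n (Suc r) x (\<lambda>f. dd v (\<lambda>y. P f y * Q f y))" if v: "v \<in> Basis" for v
  proof (rule field_upto_cong)
    have s: "smooth_germs x (\<lambda>f y. P f y * dd v (Q f) y)" "smooth_germs x (\<lambda>f y. dd v (P f) y * Q f y)"
      using Suc.prems v by (auto simp: smooth_germs_def intro!: smooth_near_mult smooth_near_dd)
    have d: "field_upto n (Suc r) x (\<lambda>f. dd v (P f))" "field_upto n (Suc r) x (\<lambda>f. dd v (Q f))"
      using Suc.prems(1,2) v by auto
    show "field_upto n (Suc r) x (\<lambda>f y. P f y * dd v (Q f) y + dd v (P f) y * Q f y)"
      using Suc.prems(3,4) smooth_germs_dd[OF _ v]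
      by (intro field_upto_add[OF Suc.IH[OF sm(1) d(2)] Suc.IH[OF d(1) sm(2)] s]) blast+
    fix f assume "f \<in> F"
    then have "eventually (\<lambda>y. smooth_near y (P f)) (nhds x)" "eventually (\<lambda>y. smooth_near y (Q f)) (nhds x)"
      using Suc.prems by (auto simp: smooth_germs_def smooth_near_eventually)
    then show "eventually (\<lambda>y. P f y * dd v (Q f) y + dd v (P f) y * Q f y = dd v (\<lambda>y. P f y * Q f y) y) (nhds x)"
      by eventually_elim (simp add: dd_mult)
  qed
  then show ?case using Suc.prems by (auto intro: rat_mult)
qed

lemma germ_fieldD: "germ_field r x Q \<Longrightarrow> smooth_germs x Q" "germ_field r x Q \<Longrightarrow> field_upto n r x Q"
  by (auto simp: germ_field_def)

lemma germ_field_rat: "germ_field r x Q \<Longrightarrow> rat r (\<lambda>f. Q f x)"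
  by (rule field_upto_rat[of 0]) (rule germ_fieldD)

lemma germ_field_dd: "germ_field r x Q \<Longrightarrow> v \<in> Basis \<Longrightarrow> germ_field (Suc r) x (\<lambda>f. dd v (Q f))"
  unfolding germ_field_def using smooth_germs_dd field_upto.simps(2) by metis

lemma germ_field_mono: "germ_field r x Q \<Longrightarrow> r \<le> s \<Longrightarrow> germ_field s x Q"
  unfolding germ_field_def using field_upto_mono by blast

lemma germ_field_cong:
  assumes "\<And>f. f \<in> F \<Longrightarrow> eventually (\<lambda>y. Q f y = Q' f y) (nhds x)" "germ_field r x Q"
  shows "germ_field r x Q'"
  using assms field_upto_cong[of Q Q' x] smooth_near_cong unfolding germ_field_def smooth_germs_def
  by blast

lemma germ_field_add:
  "germ_field r x P \<Longrightarrow> germ_field r x Q \<Longrightarrow> germ_field r x (\<lambda>f y. P f y + Q f y)"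
  unfolding germ_field_def by (auto simp: field_upto_add) (simp add: smooth_germs_def smooth_near_add)

lemma germ_field_mult:
  "germ_field r x P \<Longrightarrow> germ_field r x Q \<Longrightarrow> germ_field r x (\<lambda>f y. P f y * Q f y)"
  unfolding germ_field_def by (auto simp: field_upto_mult) (simp add: smooth_germs_def smooth_near_mult)

lemma germ_field_fixed:
  assumes "smooth_near x g"
  shows "germ_field r x (\<lambda>f. g)"
proof -
  have "field_upto n r x (\<lambda>f. g)" for n
    by (induction n arbitrary: r g) (simp_all add: rat_const)
  then show ?thesis using assms by (simp add: germ_field_def smooth_germs_def)
qed

lemma germ_field_sum:
  "(\<And>i. i \<in> A \<Longrightarrow> germ_field r x (P i)) \<Longrightarrow> germ_field r x (\<lambda>f y. \<Sum>i\<in>A. P i f y)"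
proof (induction A rule: infinite_finite_induct)
  case (insert i A)
  then show ?case using germ_field_add[of r x "P i" "\<lambda>f y. \<Sum>i\<in>A. P i f y"] by simp
qed (simp_all add: germ_field_fixed)

lemma germ_field_prod:
  "(\<And>i. i \<in> A \<Longrightarrow> germ_field r x (P i)) \<Longrightarrow> germ_field r x (\<lambda>f y. \<Prod>i\<in>A. P i f y)"
proof (induction A rule: infinite_finite_induct)
  case (insert i A)
  then show ?case using germ_field_mult[of r x "P i" "\<lambda>f y. \<Prod>i\<in>A. P i f y"] by simp
qed (simp_all add: germ_field_fixed)

text \<open>The value at x is the inverse of \<open>D\<close>, rational at every order, and
  differentiation reproduces the inverse together with a derivative of \<delta>. The induction runs
  over all orders from r upwards, because that derivative raises the order.\<close>

lemma germ_field_inverse: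
  assumes "germ_field r x \<delta>" "\<And>f. f \<in> F \<Longrightarrow> \<delta> f x = D f"
  shows "germ_field r x (\<lambda>f y. inverse (\<delta> f y))"
proof -
  let ?i = "\<lambda>f y. inverse (\<delta> f y)"
  have s: "smooth_germs x ?i"
    using assms D_nonzero by (auto simp: smooth_germs_def germ_field_def intro!: smooth_near_inverse)
  have "field_upto n s x ?i" if "r \<le> s" for n s
    using that
  proof (induction n arbitrary: s)
    case 0
    show ?case using assms(2) by (auto intro: rat_cong[OF _ rat_inverse_D])
  next
    case (Suc n)
    have "rat s (\<lambda>f. ?i f x)"
      using assms(2) by (auto intro: rat_cong[OF _ rat_inverse_D])
    moreover have "field_upto n (Suc s) x (\<lambda>f. dd v (?i f))" if v: "v \<in> Basis" for v
    proof (rule field_upto_cong)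
      have d: "germ_field (Suc s) x (\<lambda>f. dd v (\<delta> f))"
        using germ_field_mono[OF germ_field_dd[OF assms(1) v]] Suc.prems by simp
      have d1: "smooth_germs x (\<lambda>f. dd v (\<delta> f))"
        by (rule germ_fieldD[OF d])
      have d2: "smooth_germs x (\<lambda>f y. ?i f y * dd v (\<delta> f) y)"
        by (rule smooth_germs_mult[OF s d1])
      have d3: "smooth_germs x (\<lambda>f y. ?i f y * dd v (\<delta> f) y * ?i f y)"
        by (rule smooth_germs_mult[OF d2 s])
      have m: "germ_field (Suc s) x (\<lambda>f y. - 1)" by (rule germ_field_fixed) simp
      have i: "field_upto n (Suc s) x ?i" using Suc by simp
      show "field_upto n (Suc s) x (\<lambda>f y. - 1 * (?i f y * dd v (\<delta> f) y * ?i f y))"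
        by (rule field_upto_mult[OF germ_fieldD(2)[OF m]
              field_upto_mult[OF field_upto_mult[OF i germ_fieldD(2)[OF d] s d1] i d2 s]
              germ_fieldD(1)[OF m] d3])
      fix f assume f: "f \<in> F"
      then have sm: "smooth_near x (\<delta> f)"
        using assms by (auto simp: smooth_germs_def germ_field_def)
      have "\<delta> f x \<noteq> 0" using f assms(2) D_nonzero by simp
      then have "eventually (\<lambda>y. \<delta> f y \<noteq> 0) (nhds x)"
        using smooth_near_filterlim[OF sm] by (metis tendsto_imp_eventually_ne)
      then show "eventually (\<lambda>y. - 1 * (?i f y * dd v (\<delta> f) y * ?i f y) = dd v (?i f) y) (nhds x)"
        using smooth_near_eventually[OF sm] by eventually_elim (simp add: dd_inverse)
    qed
    ultimately show ?case by simp
  qed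
  then show ?thesis using s by (simp add: germ_field_def)
qed

text \<open>The inner map s is fixed and the derivatives of \<open>G f\<close> at a are rational of
  order equal to their number. One derivative of the composite gives fixed coefficients times
  \<open>iter_deriv (e # \<tau>) (G f)\<close> along s, so the order and the length of \<tau> rise
  together.\<close>

lemma germ_field_jet_compose:
  fixes G :: "'f \<Rightarrow> 'v::euclidean_space \<Rightarrow> 'w::euclidean_space" and s :: "'x::euclidean_space \<Rightarrow> 'v"
  assumes "smooth_near x s" "s x = a" "smooth_germs a G"
    and jets: "\<And>\<tau> b. set \<tau> \<subseteq> Basis \<Longrightarrow> b \<in> Basis \<Longrightarrow> rat (length \<tau>) (\<lambda>f. iter_deriv \<tau> (G f) a \<bullet> b)"
    and "set \<tau> \<subseteq> Basis" "b \<in> Basis"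
  shows "germ_field (length \<tau>) x (\<lambda>f y. iter_deriv \<tau> (G f) (s y) \<bullet> b)"
proof -
  have sm: "smooth_germs x (\<lambda>f y. iter_deriv \<tau> (G f) (s y) \<bullet> b)"
    if "set \<tau> \<subseteq> Basis" for \<tau> b
    unfolding smooth_germs_def
  proof
    fix f assume "f \<in> F"
    then have "smooth_near (s x) (iter_deriv \<tau> (G f))"
      using assms(2,3) that by (simp add: smooth_germs_def smooth_near_iter_deriv)
    then show "smooth_near x (\<lambda>y. iter_deriv \<tau> (G f) (s y) \<bullet> b)"
      by (intro smooth_near_inner) (rule smooth_near_compose[OF assms(1)])
  qed
  have "field_upto n (length \<tau>) x (\<lambda>f y. iter_deriv \<tau> (G f) (s y) \<bullet> b)"
    if "set \<tau> \<subseteq> Basis" "b \<in> Basis" for n \<tau> b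
    using that
  proof (induction n arbitrary: \<tau>)
    case 0 then show ?case using jets assms(2) by simp
  next
    case (Suc n)
    have "field_upto n (Suc (length \<tau>)) x (\<lambda>f. dd v (\<lambda>y. iter_deriv \<tau> (G f) (s y) \<bullet> b))"
      if v: "v \<in> Basis" for v
    proof (rule field_upto_cong)
      let ?h = "\<lambda>e f y. (dd v s y \<bullet> e) * (iter_deriv (e # \<tau>) (G f) (s y) \<bullet> b)"
      have fx: "germ_field (Suc (length \<tau>)) x (\<lambda>f y. dd v s y \<bullet> e)" for e
        by (intro germ_field_fixed smooth_near_inner smooth_near_dd v assms(1))
      have h: "field_upto n (Suc (length \<tau>)) x (?h e)" "smooth_germs x (?h e)" if e: "e \<in> Basis" for e
      proof -
        have u: "field_upto n (Suc (length \<tau>)) x (\<lambda>f y. iter_deriv (e # \<tau>) (G f) (s y) \<bullet> b)"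
          using Suc.IH[of "e # \<tau>"] Suc.prems e by (simp del: iter_deriv.simps)
        have w: "smooth_germs x (\<lambda>f y. iter_deriv (e # \<tau>) (G f) (s y) \<bullet> b)"
          using sm[of "e # \<tau>"] Suc.prems e by (simp del: iter_deriv.simps)
        show "field_upto n (Suc (length \<tau>)) x (?h e)"
          by (rule field_upto_mult[OF germ_fieldD(2)[OF fx] u germ_fieldD(1)[OF fx] w])
        show "smooth_germs x (?h e)"
          by (rule smooth_germs_mult[OF germ_fieldD(1)[OF fx] w])
      qed
      \<comment> \<open>\<open>germ_field_sum\<close> asks for all levels of differentiation, while
        \<open>h\<close> supplies level n only. The sum is therefore formed at this level, with
        smoothness carried along for \<open>field_upto_add\<close>.\<close>
      have "field_upto n (Suc (length \<tau>)) x (\<lambda>f y. \<Sum>e\<in>A. ?h e f y) \<and> smooth_germs x (\<lambda>f y. \<Sum>e\<in>A. ?h e f y)"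
        if "finite A" "A \<subseteq> Basis" for A
        using that
      proof (induction A rule: finite_induct)
        case empty
        then show ?case using germ_field_fixed[of x "\<lambda>y. 0"] by (simp add: germ_field_def)
      next
        case (insert e A)
        then show ?case
          using h[of e] field_upto_add[of n "Suc (length \<tau>)" x "?h e" "\<lambda>f y. \<Sum>e\<in>A. ?h e f y"]
          by (simp add: smooth_germs_def smooth_near_add del: iter_deriv.simps)
      qed
      from this[OF finite_Basis order_refl] show "field_upto n (Suc (length \<tau>)) x (\<lambda>f y. \<Sum>e\<in>Basis. ?h e f y)" by (rule conjunct1)
      fix f assume f: "f \<in> F"
      have g: "smooth_near a (iter_deriv \<tau> (G f))"
        using f assms(3) Suc.prems by (auto simp: smooth_germs_def intro: smooth_near_iter_deriv)
      have "eventually (\<lambda>y. smooth_near (s y) (iter_deriv \<tau> (G f))) (nhds x)"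
        using smooth_near_filterlim[OF assms(1)] smooth_near_eventually[OF g] assms(2)
        by (auto simp: filterlim_iff)
      then show "eventually (\<lambda>y. (\<Sum>e\<in>Basis. ?h e f y) = dd v (\<lambda>y. iter_deriv \<tau> (G f) (s y) \<bullet> b) y) (nhds x)"
        using smooth_near_eventually[OF assms(1)]
      proof eventually_elim
        case (elim y)
        show ?case
          by (simp add: dd_inner[OF smooth_near_compose[OF elim(2,1)]]
              dd_compose[OF elim(2,1)[THEN smooth_near_differentiable]]
              dd_linear_combination[OF elim(1)[THEN smooth_near_differentiable], of "dd v s y"]
              inner_sum_left iter_deriv_Cons del: iter_deriv.simps)
      qed
    qed
    then show ?case using Suc.prems jets assms(2) by simp
  qed
  then show ?thesis using sm[OF assms(5)] assms(5,6) by (simp add: germ_field_def)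
qed

text \<open>Now the outer map is fixed and the inner maps vary, but all of them pass through b at x.
  The derivatives of g are therefore constants at x, and composing with g does not raise the order
  r.\<close>

lemma germ_field_outer:
  fixes H :: "'f \<Rightarrow> 'x::euclidean_space \<Rightarrow> 'w::euclidean_space" and g :: "'w \<Rightarrow> 'z::euclidean_space"
  assumes "smooth_germs x H" "\<And>f. f \<in> F \<Longrightarrow> H f x = b" "smooth_near b g"
    and H: "\<And>e. e \<in> Basis \<Longrightarrow> germ_field r x (\<lambda>f y. H f y \<bullet> e)"
  shows "germ_field r x (\<lambda>f y. g (H f y) \<bullet> e)"
proof -
  have sm: "smooth_germs x (\<lambda>f y. g (H f y) \<bullet> e)" if "smooth_near b g" for g :: "'w \<Rightarrow> 'z"
    unfolding smooth_germs_def
  proof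
    fix f assume "f \<in> F"
    then have "smooth_near x (H f)" "smooth_near (H f x) g"
      using assms(1,2) that by (simp_all add: smooth_germs_def)
    then show "smooth_near x (\<lambda>y. g (H f y) \<bullet> e)"
      by (intro smooth_near_inner) (rule smooth_near_compose)
  qed
  have "field_upto n s x (\<lambda>f y. g (H f y) \<bullet> e)" if "smooth_near b g" "r \<le> s" for g :: "'w \<Rightarrow> 'z" and n s
    using that
  proof (induction n arbitrary: g s)
    case 0
    show ?case using assms(2) by (auto intro: rat_cong[OF _ rat_const[of _ "g b \<bullet> e"]])
  next
    case (Suc n)
    have c: "rat s (\<lambda>f. g (H f x) \<bullet> e)"
      using assms(2) by (auto intro: rat_cong[OF _ rat_const[of _ "g b \<bullet> e"]])
    have "field_upto n (Suc s) x (\<lambda>f. dd v (\<lambda>y. g (H f y) \<bullet> e))" if v: "v \<in> Basis" for v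
    proof (rule field_upto_cong)
      let ?h = "\<lambda>u f y. dd v (\<lambda>y. H f y \<bullet> u) y * (dd u g (H f y) \<bullet> e)"
      have h: "field_upto n (Suc s) x (?h u)" "smooth_germs x (?h u)" if u: "u \<in> Basis" for u
      proof -
        have su: "smooth_near b (dd u g)" using Suc.prems u by (simp add: smooth_near_dd)
        have "germ_field (Suc r) x (\<lambda>f. dd v (\<lambda>y. H f y \<bullet> u))"
          by (rule germ_field_dd[OF H[OF u] v])
        then have p: "germ_field (Suc s) x (\<lambda>f. dd v (\<lambda>y. H f y \<bullet> u))"
          by (rule germ_field_mono) (simp add: Suc.prems)
        have q: "field_upto n (Suc s) x (\<lambda>f y. dd u g (H f y) \<bullet> e)"
          by (rule Suc.IH[OF su]) (simp add: Suc.prems le_SucI)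
        show "field_upto n (Suc s) x (?h u)"
          by (rule field_upto_mult[OF germ_fieldD(2)[OF p] q germ_fieldD(1)[OF p] sm[OF su]])
        show "smooth_germs x (?h u)"
          by (rule smooth_germs_mult[OF germ_fieldD(1)[OF p] sm[OF su]])
      qed
      have "field_upto n (Suc s) x (\<lambda>f y. \<Sum>u\<in>A. ?h u f y) \<and> smooth_germs x (\<lambda>f y. \<Sum>u\<in>A. ?h u f y)"
        if "finite A" "A \<subseteq> Basis" for A
        using that
      proof (induction A rule: finite_induct)
        case empty
        then show ?case using germ_field_fixed[of x "\<lambda>y. 0"] by (simp add: germ_field_def)
      next
        case (insert u A)
        then show ?case
          using h[of u] field_upto_add[of n "Suc s" x "?h u" "\<lambda>f y. \<Sum>u\<in>A. ?h u f y"]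
          by (simp add: smooth_germs_def smooth_near_add)
      qed
      from this[OF finite_Basis order_refl] show "field_upto n (Suc s) x (\<lambda>f y. \<Sum>u\<in>Basis. ?h u f y)" by (rule conjunct1)
      fix f assume f: "f \<in> F"
      have sH: "smooth_near x (H f)" using f assms(1) by (simp add: smooth_germs_def)
      have "eventually (\<lambda>y. smooth_near (H f y) g) (nhds x)"
        using smooth_near_filterlim[OF sH] smooth_near_eventually[OF Suc.prems(1)] assms(2)[OF f]
        by (auto simp: filterlim_iff)
      then show "eventually (\<lambda>y. (\<Sum>u\<in>Basis. ?h u f y) = dd v (\<lambda>y. g (H f y) \<bullet> e) y) (nhds x)"
        using smooth_near_eventually[OF sH]
      proof eventually_elim
        case (elim y)
        show ?case
          by (simp add: dd_inner[OF smooth_near_compose[OF elim(2,1)]] dd_inner[OF elim(2)]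
              dd_compose[OF elim(2,1)[THEN smooth_near_differentiable]]
              dd_linear_combination[OF elim(1)[THEN smooth_near_differentiable], of "dd v (H f) y"]
              inner_sum_left)
      qed
    qed
    then show ?case using c by simp
  qed
  then show ?thesis using sm[OF assms(3)] assms(3) by (simp add: germ_field_def)
qed

lemma germ_field_det:
  assumes "\<And>i j. germ_field r x (P i j)"
  shows "germ_field r x (\<lambda>f y. det (\<chi> i j. P i j f y))"
  unfolding det_def
  by (intro germ_field_sum germ_field_mult germ_field_fixed germ_field_prod) (auto simp: assms)

lemma germ_field_jacobian:
  fixes X :: "'f \<Rightarrow> 'x::euclidean_space \<Rightarrow> 'x"
  assumes "smooth_germs x X" "\<And>b. b \<in> Basis \<Longrightarrow> germ_field 0 x (\<lambda>f y. X f y \<bullet> b)"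
  shows "germ_field 1 x (\<lambda>f. jdet (X f))" "germ_field 1 x (\<lambda>f. jcof (X f) i v)"
proof -
  have e: "germ_field 1 x (\<lambda>f y. dd (basis_vec k) (X f) y \<bullet> basis_vec j)" for j k
  proof (rule germ_field_cong)
    show "germ_field 1 x (\<lambda>f. dd (basis_vec k) (\<lambda>y. X f y \<bullet> basis_vec j))"
      using germ_field_dd[OF assms(2)[of "basis_vec j"], of "basis_vec k"] by simp
    fix f assume "f \<in> F"
    then have "eventually (\<lambda>y. smooth_near y (X f)) (nhds x)"
      using assms(1) by (simp add: smooth_germs_def smooth_near_eventually)
    then show "eventually (\<lambda>y. dd (basis_vec k) (\<lambda>y. X f y \<bullet> basis_vec j) y =
        dd (basis_vec k) (X f) y \<bullet> basis_vec j) (nhds x)"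
      by eventually_elim (simp add: dd_inner)
  qed
  show "germ_field 1 x (\<lambda>f. jdet (X f))"
    unfolding jdet_def[abs_def] jmat_def by (rule germ_field_det) (rule e)
  show "germ_field 1 x (\<lambda>f. jcof (X f) i v)"
    unfolding jcof_def[abs_def]
  proof (rule germ_field_det)
    fix r k
    show "germ_field 1 x (\<lambda>f y. if k = i then v \<bullet> basis_vec r else dd (basis_vec k) (X f) y \<bullet> basis_vec r)"
      using e by (cases "k = i") (auto simp: germ_field_fixed)
  qed
qed

text \<open>\<open>h f\<close> is known only along \<open>X f\<close>, through \<open>hX\<close>. As
  \<open>X f\<close> has Jacobian \<open>D f\<close> at x, Cramer's rule writes a derivative of
  \<open>h f\<close> along \<open>X f\<close> as inverse Jacobian times cofactors times derivatives
  of the composite. Iterating this stays among fields, and evaluation at x comes only at the end. It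
  serves both for inverse transformations and for image sections.\<close>

theorem rat_jets_inverse:
  fixes X :: "'f \<Rightarrow> 'x::euclidean_space \<Rightarrow> 'x" and h :: "'f \<Rightarrow> 'x \<Rightarrow> real"
  assumes X: "smooth_germs x X" "\<And>b. b \<in> Basis \<Longrightarrow> germ_field 0 x (\<lambda>f y. X f y \<bullet> b)"
    and D: "\<And>f. f \<in> F \<Longrightarrow> D f = jdet (X f) x"
    and h: "\<And>f. f \<in> F \<Longrightarrow> smooth_near (X f x) (h f)"
    and hX: "germ_field 0 x (\<lambda>f y. h f (X f y))"
    and "set \<sigma> \<subseteq> Basis"
  shows "rat (length \<sigma>) (\<lambda>f. iter_deriv \<sigma> (h f) (X f x))"
proof -
  have "germ_field (length \<sigma>) x (\<lambda>f y. iter_deriv \<sigma> (h f) (X f y))"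
    using assms(6)
  proof (induction \<sigma>)
    case Nil then show ?case using hX by simp
  next
    case (Cons v \<sigma>)
    let ?k = "\<lambda>f. iter_deriv \<sigma> (h f)"
    have k: "germ_field (length \<sigma>) x (\<lambda>f y. ?k f (X f y))" using Cons by simp
    have i: "germ_field 1 x (\<lambda>f y. inverse (jdet (X f) y))"
      using germ_field_jacobian(1)[OF X] D by (intro germ_field_inverse) auto
    show ?case
    proof (rule germ_field_cong)
      show "germ_field (length (v # \<sigma>)) x (\<lambda>f y. \<Sum>i\<in>UNIV.
          inverse (jdet (X f) y) * jcof (X f) i v y * dd (basis_vec i) (\<lambda>y. ?k f (X f y)) y)"
        using k by (intro germ_field_sum germ_field_mult germ_field_mono[OF i]
            germ_field_mono[OF germ_field_jacobian(2)[OF X]]) (auto dest: germ_field_dd[of _ _ _ "basis_vec _"])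
      fix f assume f: "f \<in> F"
      have sX: "smooth_near x (X f)" using X f by (simp add: smooth_germs_def)
      have sk: "smooth_near (X f x) (?k f)"
        using h[OF f] Cons.prems by (simp add: smooth_near_iter_deriv)
      have 1: "eventually (\<lambda>y. smooth_near (X f y) (?k f)) (nhds x)"
        using smooth_near_filterlim[OF sX] smooth_near_eventually[OF sk] by (auto simp: filterlim_iff)
      have 2: "eventually (\<lambda>y. jdet (X f) y \<noteq> 0) (nhds x)"
        using smooth_near_filterlim[OF smooth_near_jdet[OF sX]] D[OF f] D_nonzero[OF f]
        by (metis tendsto_imp_eventually_ne)
      show "eventually (\<lambda>y. (\<Sum>i\<in>UNIV. inverse (jdet (X f) y) * jcof (X f) i v y *
          dd (basis_vec i) (\<lambda>y. ?k f (X f y)) y) = iter_deriv (v # \<sigma>) (h f) (X f y)) (nhds x)"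
        using 1 2 smooth_near_eventually[OF sX]
      proof eventually_elim
        case (elim y)
        let ?w = "\<lambda>i. inverse (jdet (X f) y) * jcof (X f) i v y"
        have df: "?k f differentiable (at (X f y))"
          using elim(1) by (rule smooth_near_differentiable)
        then have l: "linear (\<lambda>w. dd w (?k f) (X f y))"
          using has_derivative_dd has_derivative_linear by blast
        have "(\<Sum>i\<in>UNIV. ?w i * dd (basis_vec i) (\<lambda>y. ?k f (X f y)) y) =
            (\<Sum>i\<in>UNIV. ?w i * dd (dd (basis_vec i) (X f) y) (?k f) (X f y))"
          using df elim(3) by (simp add: dd_compose smooth_near_differentiable)
        also have "\<dots> = dd (\<Sum>i\<in>UNIV. ?w i *\<^sub>R dd (basis_vec i) (X f) y) (?k f) (X f y)"
          using linear_sum[OF l, of "\<lambda>i. ?w i *\<^sub>R dd (basis_vec i) (X f) y" UNIV]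
          by (simp add: linear_cmul[OF l])
        also have "\<dots> = dd v (?k f) (X f y)"
          using jacobian_cramer[OF elim(2)] by simp
        finally show ?case by (simp add: iter_deriv_Cons del: iter_deriv.simps)
      qed
    qed
  qed
  then show ?thesis by (rule germ_field_rat)
qed

end

section \<open>Smooth maps, germs and compatible charts on a manifold given by an atlas\<close>

section \<open>Germs on manifolds\<close>

text \<open>The conditions on charts on which calculus in local coordinates rests; this is also the
  form in which the atlas of 1-jets is treated.\<close>

definition smooth_atlas :: "('p, 'v::euclidean_space) atlas \<Rightarrow> bool" where
  "smooth_atlas A \<longleftrightarrow>
     (\<forall>(U, \<psi>)\<in>A. inj_on \<psi> U) \<and>
     (\<forall>(U, \<psi>)\<in>A. \<forall>(V, \<eta>)\<in>A.
        open (\<psi> ` (U \<inter> V)) \<and> smooth_on (\<psi> ` (U \<inter> V)) (\<eta> \<circ> inv_into U \<psi>))"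

lemma smooth_manifold_imp_smooth_atlas: "smooth_manifold A \<Longrightarrow> smooth_atlas A"
  unfolding smooth_manifold_def smooth_atlas_def by (elim conjE, intro conjI; assumption)

lemma smooth_atlas_inj: "smooth_atlas A \<Longrightarrow> (U, \<psi>) \<in> A \<Longrightarrow> inj_on \<psi> U"
  unfolding smooth_atlas_def by blast

lemma smooth_atlas_transition:
  assumes "smooth_atlas A" "(U, \<psi>) \<in> A" "(V, \<eta>) \<in> A"
  shows "open (\<psi> ` (U \<inter> V))" "smooth_on (\<psi> ` (U \<inter> V)) (\<eta> \<circ> inv_into U \<psi>)"
  using assms unfolding smooth_atlas_def by blast+

lemma smooth_atlas_euclidean: "smooth_atlas (euclidean_atlas :: ('v, 'v::euclidean_space) atlas)"
proof -
  have "smooth_on UNIV (id \<circ> inv_into UNIV id :: 'v \<Rightarrow> 'v)"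
    by (simp add: smooth_on_iff_near inv_into_def id_def comp_def smooth_near_id)
  then show ?thesis by (simp add: smooth_atlas_def euclidean_atlas_def)
qed

lemma mopen_euclidean: "mopen euclidean_atlas V \<longleftrightarrow> open V"
  by (simp add: mopen_def euclidean_atlas_def carrier_def)

lemma carrier_euclidean [simp]: "carrier euclidean_atlas = UNIV"
  by (simp add: euclidean_atlas_def carrier_def)

lemma mopen_subset: "mopen A V \<Longrightarrow> V \<subseteq> carrier A"
  by (simp add: mopen_def)

lemma mopen_image: "mopen A V \<Longrightarrow> (U, \<psi>) \<in> A \<Longrightarrow> open (\<psi> ` (U \<inter> V))"
  unfolding mopen_def by blast

lemma mopenI:
  "V \<subseteq> carrier A \<Longrightarrow> (\<And>U \<psi>. (U, \<psi>) \<in> A \<Longrightarrow> open (\<psi> ` (U \<inter> V))) \<Longrightarrow> mopen A V"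
  unfolding mopen_def by blast

lemma mopen_Int:
  assumes "smooth_atlas A" "mopen A V" "mopen A W"
  shows "mopen A (V \<inter> W)"
proof (rule mopenI)
  show "V \<inter> W \<subseteq> carrier A" using assms(2) mopen_subset by blast
  fix U \<psi> assume U: "(U, \<psi>) \<in> A"
  have "\<psi> ` (U \<inter> (V \<inter> W)) = \<psi> ` (U \<inter> V) \<inter> \<psi> ` (U \<inter> W)"
    using inj_on_image_Int[OF smooth_atlas_inj[OF assms(1) U], of "U \<inter> V" "U \<inter> W"]
    by (simp add: Int_ac Int_left_absorb)
  then show "open (\<psi> ` (U \<inter> (V \<inter> W)))"
    using mopen_image[OF _ U] assms(2,3) by (simp add: open_Int)
qed

lemma mopen_chart_domain: "smooth_atlas A \<Longrightarrow> (U, \<psi>) \<in> A \<Longrightarrow> mopen A U"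
  by (rule mopenI) (auto simp: carrier_def smooth_atlas_transition(1) image_iff intro: bexI[of _ "(U, \<psi>)"])

lemma smooth_mapI:
  assumes "f ` S \<subseteq> carrier B"
    and "\<And>U \<psi> V \<eta>. (U, \<psi>) \<in> A \<Longrightarrow> (V, \<eta>) \<in> B \<Longrightarrow> open (\<psi> ` (U \<inter> S \<inter> f -` V))"
    and "\<And>U \<psi> V \<eta> p. (U, \<psi>) \<in> A \<Longrightarrow> (V, \<eta>) \<in> B \<Longrightarrow> p \<in> U \<Longrightarrow> p \<in> S \<Longrightarrow> f p \<in> V \<Longrightarrow>
      smooth_near (\<psi> p) (\<eta> \<circ> f \<circ> inv_into U \<psi>)"
  shows "smooth_map A B S f"
  unfolding smooth_map_def using assms by (auto simp: smooth_on_iff_near)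

lemma smooth_map_range: "smooth_map A B S f \<Longrightarrow> f ` S \<subseteq> carrier B"
  unfolding smooth_map_def by blast

lemma smooth_map_preimage:
  "smooth_map A B S f \<Longrightarrow> (U, \<psi>) \<in> A \<Longrightarrow> (V, \<eta>) \<in> B \<Longrightarrow> open (\<psi> ` (U \<inter> S \<inter> f -` V))"
  unfolding smooth_map_def by blast

lemma smooth_map_near:
  assumes "smooth_map A B S f" "(U, \<psi>) \<in> A" "(V, \<eta>) \<in> B" "p \<in> U" "p \<in> S" "f p \<in> V"
  shows "smooth_near (\<psi> p) (\<eta> \<circ> f \<circ> inv_into U \<psi>)"
proof -
  have "smooth_on (\<psi> ` (U \<inter> S \<inter> f -` V)) (\<eta> \<circ> f \<circ> inv_into U \<psi>)"
    using assms(1-3) unfolding smooth_map_def by blast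
  moreover have "open (\<psi> ` (U \<inter> S \<inter> f -` V))" by (rule smooth_map_preimage[OF assms(1-3)])
  ultimately show ?thesis using assms(4-6) by (auto simp: smooth_on_iff_near)
qed

lemma smooth_map_subset:
  assumes "smooth_atlas A" "smooth_map A B S f" "mopen A T" "T \<subseteq> S"
  shows "smooth_map A B T f"
proof (rule smooth_mapI)
  show "f ` T \<subseteq> carrier B" using smooth_map_range[OF assms(2)] assms(4) by blast
  fix U \<psi> V \<eta> assume U: "(U, \<psi>) \<in> A" and V: "(V, \<eta>) \<in> B"
  have "\<psi> ` (U \<inter> T \<inter> f -` V) = \<psi> ` (U \<inter> T) \<inter> \<psi> ` (U \<inter> S \<inter> f -` V)"
    using inj_on_image_Int[OF smooth_atlas_inj[OF assms(1) U], of "U \<inter> T" "U \<inter> S \<inter> f -` V"] assms(4)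
    by (simp add: Int_ac Int_left_absorb inf.absorb2 inf.absorb1 subset_eq)
  then show "open (\<psi> ` (U \<inter> T \<inter> f -` V))"
    using mopen_image[OF assms(3) U] smooth_map_preimage[OF assms(2) U V] by (simp add: open_Int)
  show "smooth_near (\<psi> p) (\<eta> \<circ> f \<circ> inv_into U \<psi>)" if "p \<in> U" "p \<in> T" "f p \<in> V" for p
    using smooth_map_near[OF assms(2) U V] that assms(4) by blast
qed

lemma eventually_inv_chart:
  assumes "inj_on \<psi> U" "open (\<psi> ` W)" "W \<subseteq> U" "p \<in> W"
  shows "eventually (\<lambda>z. inv_into U \<psi> z \<in> W \<and> \<psi> (inv_into U \<psi> z) = z) (nhds (\<psi> p))"
proof -
  have "eventually (\<lambda>z. z \<in> \<psi> ` W) (nhds (\<psi> p))"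
    using assms(2,4) by (simp add: eventually_nhds_in_open)
  then show ?thesis
    by eventually_elim (use assms(1,3) in \<open>auto simp: subset_iff\<close>)
qed

text \<open>Continuity in the topology induced by charts. Openness is checked around each point of
  the image, in a chart of B around the value of f there.\<close>

lemma smooth_map_vimage:
  assumes "smooth_atlas A" "smooth_atlas B" "smooth_map A B S f" "S \<subseteq> carrier A" "mopen B W"
  shows "mopen A (S \<inter> f -` W)"
proof (rule mopenI)
  show "S \<inter> f -` W \<subseteq> carrier A" using assms(4) by blast
  fix U \<psi> assume U: "(U, \<psi>) \<in> A"
  show "open (\<psi> ` (U \<inter> (S \<inter> f -` W)))"
  proof (subst open_subopen, intro ballI)
    fix z assume "z \<in> \<psi> ` (U \<inter> (S \<inter> f -` W))"
    then obtain p where p: "p \<in> U" "p \<in> S" "f p \<in> W" "z = \<psi> p" by blast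
    obtain V \<eta> where V: "(V, \<eta>) \<in> B" "f p \<in> V"
      using mopen_subset[OF assms(5)] p(3) unfolding carrier_def by fastforce
    let ?g = "\<eta> \<circ> f \<circ> inv_into U \<psi>" and ?O = "\<psi> ` (U \<inter> S \<inter> f -` V)"
    have inj: "inj_on \<psi> U" "inj_on \<eta> V" using smooth_atlas_inj assms(1,2) U V by blast+
    have iv: "inv_into U \<psi> (\<psi> q) = q" if "q \<in> U" for q using inj that by simp
    have "continuous_on ?O ?g"
      using smooth_map_near[OF assms(3) U V(1)] smooth_near_isCont
      by (intro continuous_at_imp_continuous_on) blast
    then have "open (?O \<inter> ?g -` (\<eta> ` (V \<inter> W)))"
      by (rule continuous_open_preimage[OF _ smooth_map_preimage[OF assms(3) U V(1)]
            mopen_image[OF assms(5) V(1)]])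
    moreover have "z \<in> ?O \<inter> ?g -` (\<eta> ` (V \<inter> W))"
      using p V iv by auto
    moreover have "?O \<inter> ?g -` (\<eta> ` (V \<inter> W)) \<subseteq> \<psi> ` (U \<inter> (S \<inter> f -` W))"
    proof
      fix y assume y: "y \<in> ?O \<inter> ?g -` (\<eta> ` (V \<inter> W))"
      then obtain q where q: "q \<in> U" "q \<in> S" "f q \<in> V" "y = \<psi> q" by blast
      then obtain w where "w \<in> V \<inter> W" "\<eta> (f q) = \<eta> w" using y iv by auto
      then have "f q \<in> W" using inj(2) q(3) by (metis IntE inj_onD)
      then show "y \<in> \<psi> ` (U \<inter> (S \<inter> f -` W))" using q by blast
    qed
    ultimately show "\<exists>T. open T \<and> z \<in> T \<and> T \<subseteq> \<psi> ` (U \<inter> (S \<inter> f -` W))" by blast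
  qed
qed

lemma smooth_map_compose:
  assumes A: "smooth_atlas A" and B: "smooth_atlas B" and C: "smooth_atlas C"
    and S: "mopen A S" and f: "smooth_map A B S f" and g: "smooth_map B C T g"
    and "mopen B T" "f ` S \<subseteq> T"
  shows "smooth_map A C S (g \<circ> f)"
proof (rule smooth_mapI)
  show "(g \<circ> f) ` S \<subseteq> carrier C" using smooth_map_range[OF g] assms(8) by auto
  fix U \<psi> V \<eta> assume U: "(U, \<psi>) \<in> A" and V: "(V, \<eta>) \<in> C"
  have "mopen B (T \<inter> g -` V)"
    using smooth_map_vimage[OF B C g] mopen_subset[OF assms(7)] mopen_chart_domain[OF C V] by blast
  then have "mopen A (S \<inter> f -` (T \<inter> g -` V))"
    using smooth_map_vimage[OF A B f] mopen_subset[OF S] by blast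
  moreover have "S \<inter> f -` (T \<inter> g -` V) = S \<inter> (g \<circ> f) -` V" using assms(8) by auto
  ultimately show "open (\<psi> ` (U \<inter> S \<inter> (g \<circ> f) -` V))"
    using mopen_image[OF _ U] by (simp add: Int_assoc)
  fix p assume p: "p \<in> U" "p \<in> S" "(g \<circ> f) p \<in> V"
  have fp: "f p \<in> T" using p assms(8) by blast
  obtain W \<zeta> where W: "(W, \<zeta>) \<in> B" "f p \<in> W"
    using mopen_subset[OF assms(7)] fp unfolding carrier_def by fastforce
  have inj: "inj_on \<psi> U" "inj_on \<zeta> W" using smooth_atlas_inj A B U W by blast+
  have n1: "smooth_near (\<psi> p) (\<zeta> \<circ> f \<circ> inv_into U \<psi>)"
    by (rule smooth_map_near[OF f U W(1) p(1,2) W(2)])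
  have n2: "smooth_near ((\<zeta> \<circ> f \<circ> inv_into U \<psi>) (\<psi> p)) (\<eta> \<circ> g \<circ> inv_into W \<zeta>)"
    using smooth_map_near[OF g W(1) V W(2) fp] p inj by simp
  have "eventually (\<lambda>z. inv_into U \<psi> z \<in> U \<inter> S \<inter> f -` W \<and> \<psi> (inv_into U \<psi> z) = z) (nhds (\<psi> p))"
    by (rule eventually_inv_chart[OF inj(1) smooth_map_preimage[OF f U W(1)]]) (use p W in auto)
  then have "eventually (\<lambda>z. (\<eta> \<circ> g \<circ> inv_into W \<zeta>) ((\<zeta> \<circ> f \<circ> inv_into U \<psi>) z) =
      (\<eta> \<circ> (g \<circ> f) \<circ> inv_into U \<psi>) z) (nhds (\<psi> p))"
    by eventually_elim (use inj(2) in simp)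
  then show "smooth_near (\<psi> p) (\<eta> \<circ> (g \<circ> f) \<circ> inv_into U \<psi>)"
    by (rule smooth_near_cong) (rule smooth_near_compose[OF n1 n2])
qed

lemma smooth_map_cong:
  assumes "smooth_atlas A" "mopen A S" "\<And>y. y \<in> S \<Longrightarrow> f y = g y" "smooth_map A B S f"
  shows "smooth_map A B S g"
proof (rule smooth_mapI)
  show "g ` S \<subseteq> carrier B" using smooth_map_range[OF assms(4)] assms(3) by force
  fix U \<psi> V \<eta> assume U: "(U, \<psi>) \<in> A" and V: "(V, \<eta>) \<in> B"
  have "U \<inter> S \<inter> f -` V = U \<inter> S \<inter> g -` V" using assms(3) by auto
  then show "open (\<psi> ` (U \<inter> S \<inter> g -` V))" using smooth_map_preimage[OF assms(4) U V] by simp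
  fix p assume p: "p \<in> U" "p \<in> S" "g p \<in> V"
  have "eventually (\<lambda>z. inv_into U \<psi> z \<in> U \<inter> S \<and> \<psi> (inv_into U \<psi> z) = z) (nhds (\<psi> p))"
    by (rule eventually_inv_chart[OF smooth_atlas_inj[OF assms(1) U] mopen_image[OF assms(2) U]])
      (use p in auto)
  then have "eventually (\<lambda>z. (\<eta> \<circ> f \<circ> inv_into U \<psi>) z = (\<eta> \<circ> g \<circ> inv_into U \<psi>) z) (nhds (\<psi> p))"
    by eventually_elim (use assms(3) in simp)
  then show "smooth_near (\<psi> p) (\<eta> \<circ> g \<circ> inv_into U \<psi>)"
    by (rule smooth_near_cong) (rule smooth_map_near[OF assms(4) U V], use p assms(3) in auto)
qed

lemma smooth_map_euclidean:
  "smooth_map euclidean_atlas euclidean_atlas S f \<longleftrightarrow> open S \<and> (\<forall>x\<in>S. smooth_near x f)"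
proof -
  have "inv_into UNIV id = (id :: 'a \<Rightarrow> 'a)" by (simp add: inv_into_def id_def fun_eq_iff)
  then show ?thesis
    by (auto simp: smooth_map_def euclidean_atlas_def carrier_def smooth_on_iff_near)
qed

text \<open>Stands for \<open>eventually\<close> in the neighbourhood filter of a: the type of
  points carries no topology, so \<open>nhds\<close> is available only after passing to a
  chart.\<close>

definition near :: "('p, 'v::euclidean_space) atlas \<Rightarrow> 'p \<Rightarrow> ('p \<Rightarrow> bool) \<Rightarrow> bool" where
  "near A a P \<longleftrightarrow> (\<exists>V. mopen A V \<and> a \<in> V \<and> (\<forall>y\<in>V. P y))"

lemma near_mono: "near A a P \<Longrightarrow> (\<And>y. P y \<Longrightarrow> Q y) \<Longrightarrow> near A a Q"
  unfolding near_def by blast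

lemma near_point: "near A a P \<Longrightarrow> P a"
  unfolding near_def by blast

lemma near_near: "near A a P \<Longrightarrow> near A a (\<lambda>y. near A y P)"
  unfolding near_def by blast

lemma near_conj: "smooth_atlas A \<Longrightarrow> near A a P \<Longrightarrow> near A a Q \<Longrightarrow> near A a (\<lambda>y. P y \<and> Q y)"
  unfolding near_def by (meson IntD1 IntD2 IntI mopen_Int)

lemma near_mopen: "mopen A V \<Longrightarrow> a \<in> V \<Longrightarrow> near A a (\<lambda>y. y \<in> V)"
  unfolding near_def by blast

lemma smooth_at_compose:
  assumes "smooth_atlas A" "smooth_atlas B" "smooth_atlas C" "smooth_at A B a f" "smooth_at B C (f a) g"
  shows "smooth_at A C a (g \<circ> f)"
proof -
  obtain S T where S: "mopen A S" "a \<in> S" "smooth_map A B S f"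
    and T: "mopen B T" "f a \<in> T" "smooth_map B C T g"
    using assms(4,5) unfolding smooth_at_def by blast
  have O: "mopen A (S \<inter> f -` T)"
    by (rule smooth_map_vimage[OF assms(1,2) S(3) mopen_subset[OF S(1)] T(1)])
  have "smooth_map A C (S \<inter> f -` T) (g \<circ> f)"
    by (rule smooth_map_compose[OF assms(1-3) O smooth_map_subset[OF assms(1) S(3) O] T(3,1)]) auto
  then show ?thesis using O S T unfolding smooth_at_def by blast
qed

lemma smooth_at_vimage:
  assumes "smooth_atlas A" "smooth_atlas B" "smooth_at A B a f" "near B (f a) P"
  shows "near A a (\<lambda>y. P (f y))"
proof -
  obtain S where S: "mopen A S" "a \<in> S" "smooth_map A B S f"
    using assms(3) unfolding smooth_at_def by blast
  obtain V where V: "mopen B V" "f a \<in> V" "\<forall>y\<in>V. P y"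
    using assms(4) unfolding near_def by blast
  have "mopen A (S \<inter> f -` V)"
    by (rule smooth_map_vimage[OF assms(1,2) S(3) mopen_subset[OF S(1)] V(1)])
  then show ?thesis unfolding near_def using S V by blast
qed

lemma smooth_at_cong:
  assumes "smooth_atlas A" "near A a (\<lambda>y. f y = g y)" "smooth_at A B a f"
  shows "smooth_at A B a g"
proof -
  obtain S where S: "mopen A S" "a \<in> S" "smooth_map A B S f"
    using assms(3) unfolding smooth_at_def by blast
  obtain V where V: "mopen A V" "a \<in> V" "\<forall>y\<in>V. f y = g y"
    using assms(2) unfolding near_def by blast
  have O: "mopen A (S \<inter> V)" by (rule mopen_Int[OF assms(1) S(1) V(1)])
  have "smooth_map A B (S \<inter> V) g"
    by (rule smooth_map_cong[OF assms(1) O _ smooth_map_subset[OF assms(1) S(3) O]]) (use V in auto)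
  then show ?thesis unfolding smooth_at_def using O S V by blast
qed

lemma smooth_at_carrier: "smooth_at A B a f \<Longrightarrow> a \<in> carrier A" "smooth_at A B a f \<Longrightarrow> f a \<in> carrier B"
  unfolding smooth_at_def using mopen_subset smooth_map_range by blast+

lemma near_smooth_at: "smooth_at A B a f \<Longrightarrow> near A a (\<lambda>y. smooth_at A B y f)"
  unfolding smooth_at_def near_def by blast

lemma local_diffeo_inv:
  assumes "smooth_atlas A" "local_diffeo A B S f"
  shows "local_diffeo B A (f ` S) (inv_into S f)"
proof -
  have d: "mopen A S" "smooth_map A B S f" "inj_on f S" "mopen B (f ` S)"
    "smooth_map B A (f ` S) (inv_into S f)"
    using assms unfolding local_diffeo_def by blast+
  have i: "inv_into S f ` f ` S = S" using d(3) by (simp add: image_image)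
  have "inv_into (f ` S) (inv_into S f) y = f y" if "y \<in> S" for y
    using that d(3) inj_on_inv_into[of "f ` S" f S] inv_into_f_f[of "inv_into S f" "f ` S" "f y"]
    by simp
  then have "smooth_map A B S (inv_into (f ` S) (inv_into S f))"
    by (intro smooth_map_cong[OF assms(1) d(1) _ d(2)]) simp
  then show ?thesis unfolding local_diffeo_def i using d by (simp add: inj_on_inv_into)
qed

lemma local_diffeo_subset:
  assumes "smooth_atlas A" "smooth_atlas B" "local_diffeo A B S f" "mopen A T" "T \<subseteq> S"
  shows "local_diffeo A B T f"
proof -
  have d: "mopen A S" "smooth_map A B S f" "inj_on f S" "mopen B (f ` S)"
    "smooth_map B A (f ` S) (inv_into S f)"
    using assms unfolding local_diffeo_def by blast+
  have "f ` T = f ` S \<inter> inv_into S f -` T" using d(3) assms(5) by auto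
  then have o: "mopen B (f ` T)"
    using smooth_map_vimage[OF assms(2,1) d(5) mopen_subset[OF d(4)] assms(4)] by simp
  have i: "inj_on f T" using d(3) assms(5) inj_on_subset by blast
  have "inv_into S f z = inv_into T f z" if "z \<in> f ` T" for z
    using that i d(3) assms(5) by (auto simp: subset_iff)
  then have "smooth_map B A (f ` T) (inv_into T f)"
    by (rule smooth_map_cong[OF assms(2) o _ smooth_map_subset[OF assms(2) d(5) o image_mono[OF assms(5)]]])
  then show ?thesis
    unfolding local_diffeo_def using assms(4) smooth_map_subset[OF assms(1) d(2) assms(4,5)] i o by blast
qed

lemma local_diffeo_germs:
  assumes "local_diffeo A B S f" "a \<in> S"
  shows "smooth_at A B a f" "smooth_at B A (f a) (inv_into S f)"
    "near A a (\<lambda>y. inv_into S f (f y) = y)" "near B (f a) (\<lambda>z. f (inv_into S f z) = z)"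
    "inv_into S f (f a) = a"
  using assms unfolding local_diffeo_def smooth_at_def near_def
  by (blast, blast, metis inv_into_f_f, metis f_inv_into_f imageI, simp)

text \<open>Coordinates compatible with the smooth structure, not necessarily members of the atlas.\<close>

abbreviation chart :: "('p, 'v::euclidean_space) atlas \<Rightarrow> 'p set \<Rightarrow> ('p \<Rightarrow> 'v) \<Rightarrow> bool" where
  "chart A U \<psi> \<equiv> local_diffeo A euclidean_atlas U \<psi>"

lemma chartD:
  assumes "chart A U \<psi>"
  shows "mopen A U" "inj_on \<psi> U" "open (\<psi> ` U)" "smooth_map A euclidean_atlas U \<psi>"
    "smooth_map euclidean_atlas A (\<psi> ` U) (inv_into U \<psi>)"
  using assms unfolding local_diffeo_def by (auto simp: mopen_euclidean)

lemma atlas_chart: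
  assumes "smooth_atlas A" "(U, \<psi>) \<in> A"
  shows "chart A U \<psi>"
proof -
  have inj: "inj_on \<psi> U" using smooth_atlas_inj assms by blast
  have UA: "U \<subseteq> carrier A" using assms(2) unfolding carrier_def by force
  have id: "inv_into UNIV id = (id :: 'b \<Rightarrow> 'b)" by (simp add: inv_into_def id_def fun_eq_iff)
  have "open (\<psi> ` U)" using smooth_atlas_transition(1)[OF assms assms(2)] by simp
  moreover have "smooth_map A euclidean_atlas U \<psi>"
    using smooth_atlas_transition[OF assms(1) _ assms(2)]
    by (auto simp: smooth_map_def euclidean_atlas_def carrier_def)
  moreover have "smooth_map euclidean_atlas A (\<psi> ` U) (inv_into U \<psi>)"
  proof -
    have "\<psi> ` U \<inter> inv_into U \<psi> -` V = \<psi> ` (U \<inter> V)" for V using inj by auto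
    moreover have "inv_into U \<psi> ` \<psi> ` U \<subseteq> carrier A" using inj UA by (auto simp: image_image)
    ultimately show ?thesis
      using smooth_atlas_transition[OF assms]
      by (auto simp: smooth_map_def euclidean_atlas_def id)
  qed
  ultimately show ?thesis
    unfolding local_diffeo_def using mopen_chart_domain[OF assms] inj by (simp add: mopen_euclidean)
qed

lemma carrier_chart:
  assumes "smooth_atlas A" "a \<in> carrier A"
  obtains U \<psi> where "(U, \<psi>) \<in> A" "chart A U \<psi>" "a \<in> U"
  using assms atlas_chart[OF assms(1)] unfolding carrier_def by fastforce

lemma chart_smooth_at:
  assumes "chart A U \<psi>" "a \<in> U"
  shows "smooth_at A euclidean_atlas a \<psi>" "smooth_at euclidean_atlas A (\<psi> a) (inv_into U \<psi>)"
  using local_diffeo_germs[OF assms] by blast+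

lemma near_euclidean: "near euclidean_atlas z P \<longleftrightarrow> eventually P (nhds z)"
  unfolding near_def mopen_euclidean eventually_nhds by blast

lemma smooth_at_euclidean: "smooth_at euclidean_atlas euclidean_atlas z f \<longleftrightarrow> smooth_near z f"
  unfolding smooth_at_def mopen_euclidean smooth_map_euclidean
  by (meson eventually_nhds smooth_near_def smooth_on_iff_near)

text \<open>Passage from neighbourhoods on the manifold to filters in a chart, where several local
  identities are combined by \<open>eventually_elim\<close>.\<close>

lemma near_chart:
  assumes "smooth_atlas A" "chart A U \<psi>" "a \<in> U"
  shows "near A a P \<longleftrightarrow> eventually (\<lambda>z. P (inv_into U \<psi> z)) (nhds (\<psi> a))"
proof
  have ia: "inv_into U \<psi> (\<psi> a) = a" using chartD(2)[OF assms(2)] assms(3) by simp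
  show "eventually (\<lambda>z. P (inv_into U \<psi> z)) (nhds (\<psi> a))" if "near A a P"
    using smooth_at_vimage[OF smooth_atlas_euclidean assms(1) chart_smooth_at(2)[OF assms(2,3)]] that ia
    by (simp add: near_euclidean)
  assume "eventually (\<lambda>z. P (inv_into U \<psi> z)) (nhds (\<psi> a))"
  then have "near A a (\<lambda>y. P (inv_into U \<psi> (\<psi> y)))"
    using smooth_at_vimage[OF assms(1) smooth_atlas_euclidean chart_smooth_at(1)[OF assms(2,3)]]
    by (simp add: near_euclidean)
  from near_conj[OF assms(1) this local_diffeo_germs(3)[OF assms(2,3)]]
  show "near A a P" by (rule near_mono) metis
qed

lemma eventually_chart:
  assumes "chart A U \<psi>" "a \<in> U"
  shows "eventually (\<lambda>z. inv_into U \<psi> z \<in> U \<and> \<psi> (inv_into U \<psi> z) = z) (nhds (\<psi> a))"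
  using eventually_inv_chart[of \<psi> U U a] chartD[OF assms(1)] assms(2) by simp

lemma smooth_at_local:
  assumes "smooth_atlas A" "smooth_atlas B" "chart A U \<psi>" "chart B V \<eta>" "p \<in> U" "f p \<in> V"
    "smooth_at A B p f"
  shows "smooth_near (\<psi> p) (\<eta> \<circ> f \<circ> inv_into U \<psi>)"
proof -
  have ip: "inv_into U \<psi> (\<psi> p) = p" using chartD(2)[OF assms(3)] assms(5) by simp
  have "smooth_at euclidean_atlas B (\<psi> p) (f \<circ> inv_into U \<psi>)"
    using smooth_at_compose[OF smooth_atlas_euclidean assms(1,2) chart_smooth_at(2)[OF assms(3,5)]]
      assms(7) ip by simp
  then have "smooth_at euclidean_atlas euclidean_atlas (\<psi> p) (\<eta> \<circ> (f \<circ> inv_into U \<psi>))"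
    using smooth_at_compose[OF smooth_atlas_euclidean assms(2) smooth_atlas_euclidean,
        of "\<psi> p" "f \<circ> inv_into U \<psi>" \<eta>] chart_smooth_at(1)[OF assms(4,6)] ip by simp
  then show ?thesis by (simp add: smooth_at_euclidean comp_assoc)
qed

lemma smooth_at_chartI:
  assumes "smooth_atlas A" "smooth_atlas B" "chart A U \<psi>" "chart B V \<eta>" "p \<in> U"
    "near A p (\<lambda>y. f y \<in> V)" "smooth_near (\<psi> p) (\<eta> \<circ> f \<circ> inv_into U \<psi>)"
  shows "smooth_at A B p f"
proof -
  let ?g = "\<eta> \<circ> f \<circ> inv_into U \<psi>"
  have ip: "inv_into U \<psi> (\<psi> p) = p" using chartD(2)[OF assms(3)] assms(5) by simp
  have fp: "f p \<in> V" using near_point[OF assms(6)] .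
  have 1: "smooth_at A euclidean_atlas p (?g \<circ> \<psi>)"
    using smooth_at_compose[OF assms(1) smooth_atlas_euclidean smooth_atlas_euclidean
        chart_smooth_at(1)[OF assms(3,5)]] assms(7) by (simp add: smooth_at_euclidean)
  have 2: "smooth_at A B p (inv_into V \<eta> \<circ> (?g \<circ> \<psi>))"
    using smooth_at_compose[OF assms(1) smooth_atlas_euclidean assms(2) 1, of "inv_into V \<eta>"]
      chart_smooth_at(2)[OF assms(4) fp] ip by simp
  have "near A p (\<lambda>y. (inv_into V \<eta> \<circ> (?g \<circ> \<psi>)) y = f y)"
    using near_conj[OF assms(1) assms(6) local_diffeo_germs(3)[OF assms(3,5)]]
    by (rule near_mono) (use chartD(2)[OF assms(4)] in simp)
  then show ?thesis using smooth_at_cong[OF assms(1) _ 2] by blast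
qed

lemma smooth_transition:
  assumes "smooth_atlas A" "chart A U \<psi>" "chart A V \<eta>" "p \<in> U" "p \<in> V"
  shows "smooth_near (\<psi> p) (\<eta> \<circ> inv_into U \<psi>)"
proof -
  have ip: "inv_into U \<psi> (\<psi> p) = p" using chartD(2)[OF assms(2)] assms(4) by simp
  show ?thesis
    using smooth_at_compose[OF smooth_atlas_euclidean assms(1) smooth_atlas_euclidean
        chart_smooth_at(2)[OF assms(2,4)], of \<eta>] chart_smooth_at(1)[OF assms(3,5)] ip
    by (simp add: smooth_at_euclidean)
qed

section \<open>Polynomial conditions on jets of diffeomorphisms, and the Lie equations they
  define\<close>

section \<open>Algebraic conditions on germs of diffeomorphisms\<close>

lemma jet_vars_mono: "k \<le> l \<Longrightarrow> jet_vars k \<subseteq> jet_vars l"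
  unfolding jet_vars_def by auto

lemma polynomial_fun_cong:
  "polynomial_fun J p \<Longrightarrow> (\<And>j. j \<in> J \<Longrightarrow> w j = w' j) \<Longrightarrow> p w = p w'"
  by (induction rule: polynomial_fun.induct) auto

lemma polynomial_fun_compose:
  "polynomial_fun J p \<Longrightarrow> (\<And>j. j \<in> J \<Longrightarrow> polynomial_fun I (q j)) \<Longrightarrow>
    polynomial_fun I (\<lambda>w. p (\<lambda>j. q j w))"
  by (induction rule: polynomial_fun.induct) (auto intro: polynomial_fun.intros)

context rational_jets
begin

lemma germ_field_iter:
  "germ_field r x Q \<Longrightarrow> set \<sigma> \<subseteq> Basis \<Longrightarrow> germ_field (r + length \<sigma>) x (\<lambda>f. iter_deriv \<sigma> (Q f))"
proof (induction \<sigma>)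
  case (Cons v \<sigma>)
  then show ?case using germ_field_dd[of "r + length \<sigma>" x "\<lambda>f. iter_deriv \<sigma> (Q f)" v]
    by (simp add: iter_deriv_Cons del: iter_deriv.simps(2))
qed simp

lemma rat_polynomial_zeros:
  assumes "polynomial_fun J p" "\<And>j. j \<in> J \<Longrightarrow> rat r (\<lambda>f. q f j)"
  shows "\<exists>p'. polynomial_fun (I r) p' \<and> (\<forall>f\<in>F. p (q f) = 0 \<longleftrightarrow> p' (c f) = 0)"
proof -
  obtain N p' where p': "polynomial_fun (I r) p'" "\<forall>f\<in>F. D f ^ N * p (q f) = p' (c f)"
    using rat_polynomial[where q = q, OF assms] unfolding rat_def by blast
  have "p (q f) = 0 \<longleftrightarrow> p' (c f) = 0" if "f \<in> F" for f
    using p'(2)[rule_format, OF that] D_nonzero[OF that] by (metis mult_eq_0_iff power_not_zero)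
  then show ?thesis using p'(1) by blast
qed

end

text \<open>The trivial denominator, under which \<open>rat\<close> asserts polynomial
  dependence.\<close>

lemma rational_jets_1:
  assumes "\<And>m n. m \<le> n \<Longrightarrow> I m \<subseteq> I n"
  shows "rational_jets F c I (\<lambda>f. 1)"
proof
  show "\<exists>d. polynomial_fun (I 0) d \<and> (\<forall>f\<in>F. (1::real) = d (c f))"
    by (rule exI[of _ "\<lambda>w. 1"]) (simp add: polynomial_fun.const)
qed (use assms in auto)

lemma smooth_at_local_value:
  assumes "chart A U \<psi>" "p \<in> U"
  shows "(\<eta> \<circ> f \<circ> inv_into U \<psi>) (\<psi> p) = \<eta> (f p)"
  using chartD(2)[OF assms(1)] assms(2) by simp

text \<open>The new local expression is the old one between two fixed transition maps. The inner one
  has constant derivatives at p, and the outer one is evaluated at the coordinates of the fixed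
  target b, so it contributes constants too. As the denominator is 1, the outcome is
  polynomial.\<close>

lemma chart_change_polynomial:
  fixes A :: "('p, 'v::euclidean_space) atlas" and B :: "('q, 'w::euclidean_space) atlas"
  assumes A: "smooth_atlas A" and B: "smooth_atlas B"
    and U: "chart A U \<psi>" "p \<in> U" and U': "chart A U' \<psi>'" "p \<in> U'"
    and V: "chart B V \<eta>" "b \<in> V" and V': "chart B V' \<eta>'" "b \<in> V'"
    and \<sigma>: "set \<sigma> \<subseteq> Basis"
  shows "\<exists>q. polynomial_fun (jet_vars (length \<sigma>)) q \<and>
    (\<forall>f. smooth_at A B p f \<and> f p = b \<longrightarrow>
      iter_deriv \<sigma> (\<eta>' \<circ> f \<circ> inv_into U' \<psi>') (\<psi>' p) \<bullet> e = q (jet_coords U \<psi> \<eta> p f))"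
proof -
  define F where "F = {f. smooth_at A B p f \<and> f p = b}"
  interpret rational_jets F "jet_coords U \<psi> \<eta> p" jet_vars "\<lambda>f. 1"
    by (rule rational_jets_1) (rule jet_vars_mono)
  define G where "G f = \<eta> \<circ> f \<circ> inv_into U \<psi>" for f
  define s where "s = \<psi> \<circ> inv_into U' \<psi>'"
  define x where "x = \<psi>' p"
  have s: "smooth_near x s" "s x = \<psi> p"
    using smooth_transition[OF A U'(1) U(1) U'(2) U(2)] chartD(2)[OF U'(1)] U'(2)
    by (simp_all add: s_def x_def)
  have Gp: "G f (\<psi> p) = \<eta> b" if "f \<in> F" for f
    using smooth_at_local_value[OF U, of \<eta> f] that by (simp add: G_def F_def)
  have G: "smooth_germs (\<psi> p) G"
    unfolding smooth_germs_def using smooth_at_local[OF A B U(1) V(1) U(2)] V(2)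
    by (auto simp: F_def G_def)
  have jets: "rat (length \<tau>) (\<lambda>f. iter_deriv \<tau> (G f) (\<psi> p) \<bullet> u)"
    if \<tau>: "set \<tau> \<subseteq> Basis" and u: "u \<in> Basis" for \<tau> u
  proof (cases "\<tau> = []")
    case True
    then show ?thesis using Gp by (auto intro: rat_cong[OF _ rat_const[of _ "\<eta> b \<bullet> u"]])
  next
    case False
    have "(\<tau>, u) \<in> jet_vars (length \<tau>)" using \<tau> u False by (simp add: jet_vars_def)
    then have "rat (length \<tau>) (\<lambda>f. jet_coords U \<psi> \<eta> p f (\<tau>, u))" by (rule rat_coord)
    then show ?thesis by (simp add: jet_coords_def G_def)
  qed
  have sGs: "smooth_germs x (\<lambda>f. G f \<circ> s)"
    unfolding smooth_germs_def comp_def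
  proof
    fix f assume "f \<in> F"
    then have "smooth_near (s x) (G f)" using G s(2) by (simp add: smooth_germs_def)
    then show "smooth_near x (\<lambda>y. G f (s y))" by (rule smooth_near_compose[OF s(1)])
  qed
  have fGs: "germ_field 0 x (\<lambda>f y. (G f \<circ> s) y \<bullet> u)" if "u \<in> Basis" for u
    using germ_field_jet_compose[OF s G jets, of "[]" u] that by simp
  define g where "g = \<eta>' \<circ> inv_into V \<eta>"
  have g: "smooth_near (\<eta> b) g"
    unfolding g_def by (rule smooth_transition[OF B V(1) V'(1) V(2) V'(2)])
  have "germ_field 0 x (\<lambda>f y. g ((G f \<circ> s) y) \<bullet> e)"
    by (rule germ_field_outer[OF sGs _ g fGs]) (use Gp s(2) in auto)
  then have Q: "germ_field 0 x (\<lambda>f y. (\<eta>' \<circ> f \<circ> inv_into U' \<psi>') y \<bullet> e)"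
  proof (rule germ_field_cong[rotated])
    fix f assume f: "f \<in> F"
    have "near A p (\<lambda>y. y \<in> U)" using chartD(1)[OF U(1)] U(2) by (rule near_mopen)
    moreover have "near A p (\<lambda>y. f y \<in> V)"
      using smooth_at_vimage[OF A B, of p f "\<lambda>y. y \<in> V"] f near_mopen[OF chartD(1)[OF V(1)] V(2)]
      by (simp add: F_def)
    ultimately have "near A p (\<lambda>y. y \<in> U \<and> f y \<in> V)" by (rule near_conj[OF A])
    then have "eventually (\<lambda>z. inv_into U' \<psi>' z \<in> U \<and> f (inv_into U' \<psi>' z) \<in> V) (nhds x)"
      unfolding x_def near_chart[OF A U'] .
    then show "eventually (\<lambda>y. g ((G f \<circ> s) y) \<bullet> e = (\<eta>' \<circ> f \<circ> inv_into U' \<psi>') y \<bullet> e) (nhds x)"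
      by eventually_elim (use chartD(2)[OF U(1)] chartD(2)[OF V(1)] in \<open>simp add: g_def G_def s_def\<close>)
  qed
  have "rat (length \<sigma>) (\<lambda>f. iter_deriv \<sigma> (\<lambda>y. (\<eta>' \<circ> f \<circ> inv_into U' \<psi>') y \<bullet> e) x)"
    using germ_field_rat[OF germ_field_iter[OF Q \<sigma>]] by simp
  then obtain N q where q: "polynomial_fun (jet_vars (length \<sigma>)) q"
    "\<forall>f\<in>F. 1 ^ N * iter_deriv \<sigma> (\<lambda>y. (\<eta>' \<circ> f \<circ> inv_into U' \<psi>') y \<bullet> e) x = q (jet_coords U \<psi> \<eta> p f)"
    unfolding rat_def by blast
  have "iter_deriv \<sigma> (\<eta>' \<circ> f \<circ> inv_into U' \<psi>') (\<psi>' p) \<bullet> e = q (jet_coords U \<psi> \<eta> p f)"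
    if "smooth_at A B p f" "f p = b" for f
  proof -
    have "smooth_near (\<psi>' p) (\<eta>' \<circ> f \<circ> inv_into U' \<psi>')"
      using smooth_at_local[OF A B U'(1) V'(1) U'(2)] V'(2) that by blast
    from iter_deriv_inner[OF this \<sigma>, of e] show ?thesis
      using q(2) that by (simp add: F_def x_def)
  qed
  then show ?thesis using q(1) by blast
qed

lemma same_jet_value: "same_jet A B k p f g \<Longrightarrow> f p = g p"
  by (simp add: same_jet_def)

lemma same_jetD:
  assumes "same_jet A B k p f g" "(U, \<psi>) \<in> A" "(V, \<eta>) \<in> B" "p \<in> U" "f p \<in> V"
    "set \<sigma> \<subseteq> Basis" "length \<sigma> \<le> k"
  shows "iter_deriv \<sigma> (\<eta> \<circ> f \<circ> inv_into U \<psi>) (\<psi> p) = iter_deriv \<sigma> (\<eta> \<circ> g \<circ> inv_into U \<psi>) (\<psi> p)"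
  using conjunct2[OF assms(1)[unfolded same_jet_def], rule_format, OF assms(2), unfolded case_prod_conv,
      rule_format, OF assms(3), unfolded case_prod_conv, rule_format] assms(4-7) by blast

lemma same_jetI:
  assumes "f p = g p"
    "\<And>U \<psi> V \<eta> \<sigma>. (U, \<psi>) \<in> A \<Longrightarrow> (V, \<eta>) \<in> B \<Longrightarrow> p \<in> U \<Longrightarrow> f p \<in> V \<Longrightarrow>
      set \<sigma> \<subseteq> Basis \<Longrightarrow> length \<sigma> \<le> k \<Longrightarrow>
      iter_deriv \<sigma> (\<eta> \<circ> f \<circ> inv_into U \<psi>) (\<psi> p) = iter_deriv \<sigma> (\<eta> \<circ> g \<circ> inv_into U \<psi>) (\<psi> p)"
  shows "same_jet A B k p f g"
  unfolding same_jet_def using assms(1) by (auto intro!: assms(2))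

text \<open>\<open>same_jet\<close> compares derivatives in all pairs of atlas charts; by
  \<open>chart_change_polynomial\<close> the derivatives in any pair are polynomials in those of one
  pair. The pair used here is compatible with the atlas but need not belong to it.\<close>

lemma same_jet_chart_iff:
  fixes A :: "('p, 'v::euclidean_space) atlas" and B :: "('q, 'w::euclidean_space) atlas"
  assumes A: "smooth_atlas A" and B: "smooth_atlas B"
    and U: "chart A U \<psi>" "p \<in> U" and V: "chart B V \<eta>" "f p \<in> V"
    and f: "smooth_at A B p f" and g: "smooth_at A B p g"
  shows "same_jet A B k p f g \<longleftrightarrow> f p = g p \<and>
    (\<forall>\<sigma>. set \<sigma> \<subseteq> Basis \<and> length \<sigma> \<le> k \<longrightarrow>
      iter_deriv \<sigma> (\<eta> \<circ> f \<circ> inv_into U \<psi>) (\<psi> p) = iter_deriv \<sigma> (\<eta> \<circ> g \<circ> inv_into U \<psi>) (\<psi> p))"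
proof -
  have transfer: "iter_deriv \<sigma> (\<eta>' \<circ> f \<circ> inv_into U' \<psi>') (\<psi>' p) = iter_deriv \<sigma> (\<eta>' \<circ> g \<circ> inv_into U' \<psi>') (\<psi>' p)"
    if c: "chart A U1 \<psi>1" "p \<in> U1" "chart B V1 \<eta>1" "f p \<in> V1" "chart A U' \<psi>'" "p \<in> U'" "chart B V' \<eta>'" "f p \<in> V'"
      and fg: "f p = g p" and \<sigma>: "set \<sigma> \<subseteq> Basis" "length \<sigma> \<le> k"
      and e: "\<forall>\<sigma>. set \<sigma> \<subseteq> Basis \<and> length \<sigma> \<le> k \<longrightarrow>
        iter_deriv \<sigma> (\<eta>1 \<circ> f \<circ> inv_into U1 \<psi>1) (\<psi>1 p) = iter_deriv \<sigma> (\<eta>1 \<circ> g \<circ> inv_into U1 \<psi>1) (\<psi>1 p)"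
    for U1 \<psi>1 V1 \<eta>1 U' \<psi>' V' \<eta>' \<sigma>
  proof (rule euclidean_eqI)
    fix u :: 'w assume "u \<in> Basis"
    obtain q where q: "polynomial_fun (jet_vars (length \<sigma>)) q"
      "\<forall>h. smooth_at A B p h \<and> h p = f p \<longrightarrow>
        iter_deriv \<sigma> (\<eta>' \<circ> h \<circ> inv_into U' \<psi>') (\<psi>' p) \<bullet> u = q (jet_coords U1 \<psi>1 \<eta>1 p h)"
      using chart_change_polynomial[OF A B c(1,2,5,6,3,4,7,8) \<sigma>(1)] by blast
    have "q (jet_coords U1 \<psi>1 \<eta>1 p f) = q (jet_coords U1 \<psi>1 \<eta>1 p g)"
    proof (rule polynomial_fun_cong[OF q(1)])
      fix j :: "'v list \<times> 'w" assume "j \<in> jet_vars (length \<sigma>)"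
      then show "jet_coords U1 \<psi>1 \<eta>1 p f j = jet_coords U1 \<psi>1 \<eta>1 p g j"
        using e \<sigma>(2) by (auto simp: jet_vars_def jet_coords_def)
    qed
    then show "iter_deriv \<sigma> (\<eta>' \<circ> f \<circ> inv_into U' \<psi>') (\<psi>' p) \<bullet> u =
        iter_deriv \<sigma> (\<eta>' \<circ> g \<circ> inv_into U' \<psi>') (\<psi>' p) \<bullet> u"
      using q(2) f g fg by simp
  qed
  show ?thesis
  proof
    assume s: "same_jet A B k p f g"
    then have fg: "f p = g p" unfolding same_jet_def by blast
    obtain U1 \<psi>1 where U1: "(U1, \<psi>1) \<in> A" "chart A U1 \<psi>1" "p \<in> U1"
      using carrier_chart[OF A smooth_at_carrier(1)[OF f]] by metis
    obtain V1 \<eta>1 where V1: "(V1, \<eta>1) \<in> B" "chart B V1 \<eta>1" "f p \<in> V1"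
      using carrier_chart[OF B smooth_at_carrier(2)[OF f]] by metis
    have e: "\<forall>\<sigma>. set \<sigma> \<subseteq> Basis \<and> length \<sigma> \<le> k \<longrightarrow>
        iter_deriv \<sigma> (\<eta>1 \<circ> f \<circ> inv_into U1 \<psi>1) (\<psi>1 p) = iter_deriv \<sigma> (\<eta>1 \<circ> g \<circ> inv_into U1 \<psi>1) (\<psi>1 p)"
      using same_jetD[OF s U1(1) V1(1) U1(3) V1(3)] by blast
    show "f p = g p \<and> (\<forall>\<sigma>. set \<sigma> \<subseteq> Basis \<and> length \<sigma> \<le> k \<longrightarrow>
      iter_deriv \<sigma> (\<eta> \<circ> f \<circ> inv_into U \<psi>) (\<psi> p) = iter_deriv \<sigma> (\<eta> \<circ> g \<circ> inv_into U \<psi>) (\<psi> p))"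
      using transfer[OF U1(2,3) V1(2,3) U V fg _ _ e] fg by simp
  next
    assume h: "f p = g p \<and> (\<forall>\<sigma>. set \<sigma> \<subseteq> Basis \<and> length \<sigma> \<le> k \<longrightarrow>
      iter_deriv \<sigma> (\<eta> \<circ> f \<circ> inv_into U \<psi>) (\<psi> p) = iter_deriv \<sigma> (\<eta> \<circ> g \<circ> inv_into U \<psi>) (\<psi> p))"
    show "same_jet A B k p f g"
    proof (rule same_jetI)
      show "f p = g p" using h by simp
      show "iter_deriv \<sigma> (\<eta>' \<circ> f \<circ> inv_into U' \<psi>') (\<psi>' p) = iter_deriv \<sigma> (\<eta>' \<circ> g \<circ> inv_into U' \<psi>') (\<psi>' p)"
        if "(U', \<psi>') \<in> A" "(V', \<eta>') \<in> B" "p \<in> U'" "f p \<in> V'" "set \<sigma> \<subseteq> Basis" "length \<sigma> \<le> k"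
        for U' \<psi>' V' \<eta>' \<sigma>
        by (rule transfer[OF U V atlas_chart[OF A that(1)] that(3) atlas_chart[OF B that(2)] that(4)
              conjunct1[OF h] that(5,6) conjunct2[OF h]])
    qed
  qed
qed

lemma same_jet_refl: "same_jet A B k p f f"
  by (simp add: same_jet_def)

lemma jet_eq_imp_same_jet:
  assumes "jet A B k p f = jet A B k q g" "smooth_at A B p f"
  shows "p = q" "same_jet A B k p g f"
proof -
  show "p = q" using assms(1) by (simp add: jet_def)
  have "f \<in> snd (jet A B k p f)" using assms(2) same_jet_refl by (simp add: jet_def)
  then have "f \<in> snd (jet A B k q g)" using assms(1) by simp
  then show "same_jet A B k p g f" using \<open>p = q\<close> by (simp add: jet_def)
qed

lemma same_jet_mono: "same_jet A B k p f g \<Longrightarrow> l \<le> k \<Longrightarrow> same_jet A B l p f g"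
  by (rule same_jetI) (auto dest: same_jetD same_jet_value)

definition algebraic_at ::
  "('p, 'v::euclidean_space) atlas \<Rightarrow> nat \<Rightarrow> 'p \<Rightarrow> 'p \<Rightarrow> (('p \<Rightarrow> 'p) \<Rightarrow> bool) \<Rightarrow> bool" where
  "algebraic_at A k a b C \<longleftrightarrow>
     (\<forall>U \<psi> V \<eta>. chart A U \<psi> \<and> a \<in> U \<and> chart A V \<eta> \<and> b \<in> V \<longrightarrow>
       (\<exists>P. (\<forall>p\<in>P. polynomial_fun (jet_vars k) p) \<and>
         (\<forall>f. diffeo_at A a f \<and> f a = b \<longrightarrow> (C f \<longleftrightarrow> (\<forall>p\<in>P. p (jet_coords U \<psi> \<eta> a f) = 0)))))"

lemma algebraic_atE:
  assumes "algebraic_at A k a b C" "chart A U \<psi>" "a \<in> U" "chart A V \<eta>" "b \<in> V"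
  obtains P where "\<And>p. p \<in> P \<Longrightarrow> polynomial_fun (jet_vars k) p"
    "\<And>f. diffeo_at A a f \<Longrightarrow> f a = b \<Longrightarrow> C f \<longleftrightarrow> (\<forall>p\<in>P. p (jet_coords U \<psi> \<eta> a f) = 0)"
proof -
  obtain P where "(\<forall>p\<in>P. polynomial_fun (jet_vars k) p) \<and>
      (\<forall>f. diffeo_at A a f \<and> f a = b \<longrightarrow> (C f \<longleftrightarrow> (\<forall>p\<in>P. p (jet_coords U \<psi> \<eta> a f) = 0)))"
    using assms(1)[unfolded algebraic_at_def, rule_format, of U \<psi> V \<eta>] assms(2-5) by blast
  then show ?thesis by (intro that[of P]) simp_all
qed

lemma diffeo_at_smooth: "diffeo_at A a f \<Longrightarrow> smooth_at A A a f"
  unfolding diffeo_at_def by (elim exE conjE) (rule local_diffeo_germs(1))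

text \<open>Each jet coordinate in the given charts is a polynomial in the coordinates of any other
  charts, so the equations carry over by substitution.\<close>

lemma algebraic_atI:
  fixes A :: "('p, 'v::euclidean_space) atlas"
  assumes A: "smooth_atlas A" and U: "chart A U \<psi>" "a \<in> U" and V: "chart A V \<eta>" "b \<in> V"
    and P: "\<And>p. p \<in> P \<Longrightarrow> polynomial_fun (jet_vars k) p"
      "\<And>f. diffeo_at A a f \<Longrightarrow> f a = b \<Longrightarrow> C f \<longleftrightarrow> (\<forall>p\<in>P. p (jet_coords U \<psi> \<eta> a f) = 0)"
  shows "algebraic_at A k a b C"
  unfolding algebraic_at_def
proof (intro allI impI)
  fix U' \<psi>' V' \<eta>' assume c: "chart A U' \<psi>' \<and> a \<in> U' \<and> chart A V' \<eta>' \<and> b \<in> V'"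
  have "\<forall>j. \<exists>q. j \<in> jet_vars k \<longrightarrow> polynomial_fun (jet_vars k) q \<and>
    (\<forall>f. smooth_at A A a f \<and> f a = b \<longrightarrow> jet_coords U \<psi> \<eta> a f j = q (jet_coords U' \<psi>' \<eta>' a f))"
  proof
    fix j :: "'v list \<times> 'v"
    obtain \<sigma> e where j: "j = (\<sigma>, e)" by fastforce
    show "\<exists>q. j \<in> jet_vars k \<longrightarrow> polynomial_fun (jet_vars k) q \<and>
      (\<forall>f. smooth_at A A a f \<and> f a = b \<longrightarrow> jet_coords U \<psi> \<eta> a f j = q (jet_coords U' \<psi>' \<eta>' a f))"
    proof (cases "j \<in> jet_vars k")
      case True
      then have \<sigma>: "set \<sigma> \<subseteq> Basis" "length \<sigma> \<le> k" by (auto simp: j jet_vars_def)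
      obtain q where q: "polynomial_fun (jet_vars (length \<sigma>)) q"
        "\<forall>f. smooth_at A A a f \<and> f a = b \<longrightarrow>
          iter_deriv \<sigma> (\<eta> \<circ> f \<circ> inv_into U \<psi>) (\<psi> a) \<bullet> e = q (jet_coords U' \<psi>' \<eta>' a f)"
        using chart_change_polynomial[OF A A _ _ U _ _ V \<sigma>(1), of U' \<psi>' V' \<eta>' e] c by blast
      have "polynomial_fun (jet_vars k) q"
        using polynomial_fun_mono[OF q(1) jet_vars_mono[OF \<sigma>(2)]] .
      then show ?thesis using q(2) by (auto simp: j jet_coords_def)
    qed blast
  qed
  from choice[OF this] obtain q where q: "\<And>j. j \<in> jet_vars k \<Longrightarrow> polynomial_fun (jet_vars k) (q j)"
    "\<And>j f. j \<in> jet_vars k \<Longrightarrow> smooth_at A A a f \<Longrightarrow> f a = b \<Longrightarrow>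
      jet_coords U \<psi> \<eta> a f j = q j (jet_coords U' \<psi>' \<eta>' a f)"
    by blast
  let ?P = "(\<lambda>p w. p (\<lambda>j. q j w)) ` P"
  have "\<forall>p\<in>?P. polynomial_fun (jet_vars k) p"
  proof -
    have "polynomial_fun (jet_vars k) (\<lambda>w. p (\<lambda>j. q j w))" if "p \<in> P" for p
      by (rule polynomial_fun_compose[OF P(1)[OF that] q(1)])
    then show ?thesis by simp
  qed
  moreover have P': "C f \<longleftrightarrow> (\<forall>p\<in>?P. p (jet_coords U' \<psi>' \<eta>' a f) = 0)" if f: "diffeo_at A a f" "f a = b" for f
  proof -
    have "p (jet_coords U \<psi> \<eta> a f) = p (\<lambda>j. q j (jet_coords U' \<psi>' \<eta>' a f))" if "p \<in> P" for p
      by (rule polynomial_fun_cong[OF P(1)[OF that]]) (rule q(2)[OF _ diffeo_at_smooth[OF f(1)] f(2)])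
    then show ?thesis unfolding P(2)[OF f] ball_simps by metis
  qed
  ultimately show "\<exists>P. (\<forall>p\<in>P. polynomial_fun (jet_vars k) p) \<and>
      (\<forall>f. diffeo_at A a f \<and> f a = b \<longrightarrow> (C f \<longleftrightarrow> (\<forall>p\<in>P. p (jet_coords U' \<psi>' \<eta>' a f) = 0)))"
    by (intro exI[of _ ?P] conjI allI impI) (assumption, elim conjE, rule P')
qed

lemma algebraic_at_mono:
  assumes C: "algebraic_at A k a b C" and kl: "k \<le> l"
  shows "algebraic_at A l a b C"
  unfolding algebraic_at_def
proof (intro allI impI, elim conjE)
  fix U \<psi> V \<eta> assume c: "chart A U \<psi>" "a \<in> U" "chart A V \<eta>" "b \<in> V"
  obtain P where P: "\<And>p. p \<in> P \<Longrightarrow> polynomial_fun (jet_vars k) p"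
    "\<And>f. diffeo_at A a f \<Longrightarrow> f a = b \<Longrightarrow> C f \<longleftrightarrow> (\<forall>p\<in>P. p (jet_coords U \<psi> \<eta> a f) = 0)"
    by (rule algebraic_atE[OF C c]) (rule that)
  show "\<exists>P. (\<forall>p\<in>P. polynomial_fun (jet_vars l) p) \<and>
      (\<forall>f. diffeo_at A a f \<and> f a = b \<longrightarrow> (C f \<longleftrightarrow> (\<forall>p\<in>P. p (jet_coords U \<psi> \<eta> a f) = 0)))"
  proof (intro exI[of _ P] conjI ballI allI impI)
    show "polynomial_fun (jet_vars l) p" if "p \<in> P" for p
      by (rule polynomial_fun_mono[OF P(1)[OF that] jet_vars_mono[OF kl]])
    show "C f \<longleftrightarrow> (\<forall>p\<in>P. p (jet_coords U \<psi> \<eta> a f) = 0)" if "diffeo_at A a f \<and> f a = b" for f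
      using that by (intro P(2)) blast+
  qed
qed

lemma algebraic_at_cong:
  "(\<And>f. diffeo_at A a f \<Longrightarrow> f a = b \<Longrightarrow> C f \<longleftrightarrow> C' f) \<Longrightarrow> algebraic_at A k a b C \<Longrightarrow> algebraic_at A k a b C'"
  unfolding algebraic_at_def by simp

text \<open>The families of polynomials are united. The index set is arbitrary, which permits one
  condition for every section.\<close>

lemma algebraic_at_Ball:
  assumes "\<And>i. i \<in> I \<Longrightarrow> algebraic_at A k a b (C i)"
  shows "algebraic_at A k a b (\<lambda>f. \<forall>i\<in>I. C i f)"
  unfolding algebraic_at_def
proof (intro allI impI)
  fix U \<psi> V \<eta> assume c: "chart A U \<psi> \<and> a \<in> U \<and> chart A V \<eta> \<and> b \<in> V"
  have "\<forall>i. \<exists>P. i \<in> I \<longrightarrow> (\<forall>p\<in>P. polynomial_fun (jet_vars k) p) \<and>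
      (\<forall>f. diffeo_at A a f \<and> f a = b \<longrightarrow> (C i f \<longleftrightarrow> (\<forall>p\<in>P. p (jet_coords U \<psi> \<eta> a f) = 0)))"
    using assms[unfolded algebraic_at_def, rule_format, OF _ c] by blast
  from choice[OF this] obtain P where P: "\<And>i. i \<in> I \<Longrightarrow> (\<forall>p\<in>P i. polynomial_fun (jet_vars k) p) \<and>
      (\<forall>f. diffeo_at A a f \<and> f a = b \<longrightarrow> (C i f \<longleftrightarrow> (\<forall>p\<in>P i. p (jet_coords U \<psi> \<eta> a f) = 0)))"
    by blast
  show "\<exists>P. (\<forall>p\<in>P. polynomial_fun (jet_vars k) p) \<and>
      (\<forall>f. diffeo_at A a f \<and> f a = b \<longrightarrow> ((\<forall>i\<in>I. C i f) \<longleftrightarrow> (\<forall>p\<in>P. p (jet_coords U \<psi> \<eta> a f) = 0)))"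
    by (rule exI[of _ "\<Union>i\<in>I. P i"]) (use P in auto)
qed

lemma algebraic_at_conj:
  assumes "algebraic_at A k a b C" "algebraic_at A k a b C'"
  shows "algebraic_at A k a b (\<lambda>f. C f \<and> C' f)"
proof -
  have "algebraic_at A k a b (if i then C else C')" for i using assms by simp
  then have "algebraic_at A k a b (\<lambda>f. \<forall>i\<in>UNIV. (if i then C else C') f)"
    by (rule algebraic_at_Ball)
  then show ?thesis by (rule algebraic_at_cong[rotated]) (auto split: if_splits)
qed

text \<open>Differentiating h (X y) = y shows that the derivative of X at x has trivial
  kernel.\<close>

lemma jdet_nonzeroI:
  assumes "smooth_near x X" "smooth_near (X x) h" "eventually (\<lambda>y. h (X y) = y) (nhds x)"
  shows "jdet X x \<noteq> 0"
proof -
  have "w = 0" if "dd w X x = 0" for w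
  proof -
    have "w = dd w (\<lambda>y. y) x" by (rule dd_eqI[symmetric, where f' = "\<lambda>v. v"]) simp
    also have "\<dots> = dd w (\<lambda>y. h (X y)) x" using assms(3) by (intro dd_cong) (simp add: eq_commute)
    also have "\<dots> = dd (dd w X x) h (X x)"
      using assms by (intro dd_compose smooth_near_differentiable)
    also have "\<dots> = 0"
      using dd_linear_combination[of h "X x" 0] assms(2) that by (simp add: smooth_near_differentiable)
    finally show ?thesis .
  qed
  then show ?thesis using jdet_nonzero_iff assms(1) smooth_near_differentiable by blast
qed

text \<open>In coordinates f is a map X with local inverse h, and h along X is the identity, a fixed
  field. Hence \<open>rat_jets_inverse\<close> makes the jet of the inverse rational in that of f,
  with the Jacobian of X as denominator. The Jacobian has order 1, whence the bound on k.\<close>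

lemma algebraic_at_inverse:
  fixes A :: "('p, 'v::euclidean_space) atlas"
  assumes A: "smooth_atlas A" and C: "algebraic_at A k b a C" and k: "1 \<le> k"
    and U: "chart A U \<psi>" "a \<in> U" and V: "chart A V \<eta>" "b \<in> V"
  shows "\<exists>P. (\<forall>p\<in>P. polynomial_fun (jet_vars k) p) \<and>
    (\<forall>S f. local_diffeo A A S f \<and> a \<in> S \<and> f a = b \<longrightarrow>
      (C (inv_into S f) \<longleftrightarrow> (\<forall>p\<in>P. p (jet_coords U \<psi> \<eta> a f) = 0)))"
proof -
  obtain P where P: "\<And>p. p \<in> P \<Longrightarrow> polynomial_fun (jet_vars k) p"
    "\<And>f. diffeo_at A b f \<Longrightarrow> f b = a \<Longrightarrow> C f \<longleftrightarrow> (\<forall>p\<in>P. p (jet_coords V \<eta> \<psi> b f) = 0)"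
    by (rule algebraic_atE[OF C V U]) (rule that)
  \<comment> \<open>The domain S belongs to the index because \<open>inv_into S f\<close> depends on
    it; the coordinates \<open>c\<close> ignore it.\<close>
  define F where "F = {(S, f). local_diffeo A A S f \<and> a \<in> S \<and> f a = b}"
  define I :: "nat \<Rightarrow> ('v list \<times> 'v) set" where "I r = jet_vars (max 1 r)" for r
  define c where "c = (\<lambda>(S :: 'p set, f). jet_coords U \<psi> \<eta> a f)"
  define X where "X = (\<lambda>(S :: 'p set, f). \<eta> \<circ> f \<circ> inv_into U \<psi>)"
  define h where "h = (\<lambda>(S :: 'p set, f). \<psi> \<circ> inv_into S f \<circ> inv_into V \<eta>)"
  define x where "x = \<psi> a"
  define D where "D i = jdet (X i) x" for i
  have I_mono: "I m \<subseteq> I n" if "m \<le> n" for m n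
    unfolding I_def using that by (intro jet_vars_mono) auto
  \<comment> \<open>The Jacobian must be known to be polynomial before it can serve as denominator,
    which this interpretation with denominator 1 provides. For the same reason \<open>jets\<close>
    and \<open>comp\<close> below are stated for any \<open>D'\<close>.\<close>
  interpret one: rational_jets F c I "\<lambda>f. 1" by (rule rational_jets_1) (rule I_mono)
  have Xx: "X i x = \<eta> b" if "i \<in> F" for i
    using that smooth_at_local_value[OF U, of \<eta> "snd i"] by (auto simp: X_def x_def F_def)
  have X: "smooth_near x (X i)" if "i \<in> F" for i
    using that smooth_at_local[OF A A U(1) V(1) U(2)] V(2) local_diffeo_germs(1)[of A A]
    by (auto simp: F_def X_def x_def)
  have h: "smooth_near (\<eta> b) (h i)" if "i \<in> F" for i
    using that smooth_at_local[OF A A V(1) U(1) V(2)] U(2) local_diffeo_germs(2)[of A A]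
      local_diffeo_germs(5)[of A A]
    by (auto simp: F_def h_def)
  have hX: "eventually (\<lambda>y. h i (X i y) = y) (nhds x)" if i: "i \<in> F" for i
  proof -
    obtain S f where Sf: "i = (S, f)" "local_diffeo A A S f" "a \<in> S" "f a = b"
      using i by (auto simp: F_def)
    have "near A a (\<lambda>y. inv_into S f (f y) = y)" by (rule local_diffeo_germs(3)[OF Sf(2,3)])
    moreover have "near A a (\<lambda>y. f y \<in> V)"
      using smooth_at_vimage[OF A A local_diffeo_germs(1)[OF Sf(2,3)], of "\<lambda>y. y \<in> V"]
        near_mopen[OF chartD(1)[OF V(1)] V(2)] Sf(4) by simp
    ultimately have "near A a (\<lambda>y. inv_into S f (f y) = y \<and> f y \<in> V)" by (rule near_conj[OF A])
    from this[unfolded near_chart[OF A U]] eventually_chart[OF U]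
    show ?thesis unfolding x_def
      by eventually_elim (use chartD(2)[OF V(1)] in \<open>simp add: h_def X_def Sf(1)\<close>)
  qed
  have jets: "rational_jets.rat F c I D' (length \<tau>) (\<lambda>i. iter_deriv \<tau> (X i) x \<bullet> u)"
    if R: "rational_jets F c I D'" and \<tau>: "set \<tau> \<subseteq> Basis" and u: "u \<in> Basis" for \<tau> u D'
  proof (cases "\<tau> = []")
    case True
    then show ?thesis using Xx
      by (auto intro: rational_jets.rat_cong[OF R _ rational_jets.rat_const[OF R, of _ "\<eta> b \<bullet> u"]])
  next
    case False
    have "(\<tau>, u) \<in> I (length \<tau>)" using \<tau> u False by (simp add: I_def jet_vars_def)
    then have "rational_jets.rat F c I D' (length \<tau>) (\<lambda>i. c i (\<tau>, u))"
      by (rule rational_jets.rat_coord[OF R])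
    then show ?thesis by (simp add: jet_coords_def c_def X_def x_def case_prod_unfold)
  qed
  have sX: "rational_jets.smooth_germs F x X"
    using X by (simp add: one.smooth_germs_def)
  have comp: "rational_jets.germ_field F c I D' 0 x (\<lambda>i y. X i y \<bullet> u)"
    if R: "rational_jets F c I D'" and u: "u \<in> Basis" for u D'
    using rational_jets.germ_field_jet_compose[OF R smooth_near_id refl sX jets[OF R], of "[]" u] u
    by simp
  have "one.germ_field 1 x (\<lambda>i. jdet (X i))"
    by (rule one.germ_field_jacobian(1)[OF sX comp[OF one.rational_jets_axioms]])
  then obtain N d where d: "polynomial_fun (I 1) d" "\<forall>i\<in>F. 1 ^ N * jdet (X i) x = d (c i)"
    using one.germ_field_rat unfolding one.rat_def by blast
  interpret rational_jets F c I D
  proof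
    show "\<exists>d. polynomial_fun (I 0) d \<and> (\<forall>f\<in>F. D f = d (c f))"
      using d by (auto simp: I_def D_def)
    show "D i \<noteq> 0" if "i \<in> F" for i
      unfolding D_def using that X[OF that] h[OF that] hX[OF that] Xx[OF that]
      by (intro jdet_nonzeroI[where h = "h i"]) simp_all
  qed (rule I_mono)
  have q: "rat k (\<lambda>i. jet_coords V \<eta> \<psi> b (case i of (S, f) \<Rightarrow> inv_into S f) j)" if j: "j \<in> jet_vars k" for j
  proof -
    obtain \<tau> e where \<tau>: "j = (\<tau>, e)" "set \<tau> \<subseteq> Basis" "length \<tau> \<le> k" using j by (auto simp: jet_vars_def)
    have "rat (length \<tau>) (\<lambda>i. iter_deriv \<tau> (\<lambda>z. h i z \<bullet> e) (X i x))"
    proof (rule rat_jets_inverse[OF sX comp[OF rational_jets_axioms] _ _ _ \<tau>(2)])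
      show "D i = jdet (X i) x" for i by (simp add: D_def)
      show "smooth_near (X i x) (\<lambda>z. h i z \<bullet> e)" if "i \<in> F" for i
        using h[OF that] Xx[OF that] by (simp add: smooth_near_inner)
      show "germ_field 0 x (\<lambda>i y. h i (X i y) \<bullet> e)"
      proof (rule germ_field_cong)
        show "germ_field 0 x (\<lambda>i y. y \<bullet> e)"
          by (rule germ_field_fixed) (rule smooth_near_inner[OF smooth_near_id])
        show "eventually (\<lambda>y. y \<bullet> e = h i (X i y) \<bullet> e) (nhds x)" if "i \<in> F" for i
          using hX[OF that] by eventually_elim simp
      qed
    qed
    then have "rat (length \<tau>) (\<lambda>i. jet_coords V \<eta> \<psi> b (case i of (S, f) \<Rightarrow> inv_into S f) j)"
    proof (rule rat_cong[rotated])
      fix i assume i: "i \<in> F"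
      show "iter_deriv \<tau> (\<lambda>z. h i z \<bullet> e) (X i x) = jet_coords V \<eta> \<psi> b (case i of (S, f) \<Rightarrow> inv_into S f) j"
        using iter_deriv_inner[OF h[OF i] \<tau>(2), of e] Xx[OF i]
        by (simp add: jet_coords_def \<tau>(1) h_def case_prod_unfold)
    qed
    then show ?thesis using \<tau>(3) by (rule rat_mono)
  qed
  have "\<forall>p. \<exists>p'. p \<in> P \<longrightarrow> polynomial_fun (I k) p' \<and>
      (\<forall>i\<in>F. p (jet_coords V \<eta> \<psi> b (case i of (S, f) \<Rightarrow> inv_into S f)) = 0 \<longleftrightarrow> p' (c i) = 0)"
  proof
    fix p
    show "\<exists>p'. p \<in> P \<longrightarrow> polynomial_fun (I k) p' \<and>
      (\<forall>i\<in>F. p (jet_coords V \<eta> \<psi> b (case i of (S, f) \<Rightarrow> inv_into S f)) = 0 \<longleftrightarrow> p' (c i) = 0)"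
    proof (cases "p \<in> P")
      case True
      show ?thesis using rat_polynomial_zeros[OF P(1)[OF True] q] by fast
    qed blast
  qed
  from choice[OF this] obtain p' where p': "\<And>p. p \<in> P \<Longrightarrow> polynomial_fun (I k) (p' p)"
      "\<And>p i. p \<in> P \<Longrightarrow> i \<in> F \<Longrightarrow>
        p (jet_coords V \<eta> \<psi> b (case i of (S, f) \<Rightarrow> inv_into S f)) = 0 \<longleftrightarrow> p' p (c i) = 0"
    by blast
  have fin: "C (inv_into S f) \<longleftrightarrow> (\<forall>p\<in>p' ` P. p (jet_coords U \<psi> \<eta> a f) = 0)"
    if S: "local_diffeo A A S f" "a \<in> S" "f a = b" for S f
  proof -
    have "diffeo_at A b (inv_into S f)"
      unfolding diffeo_at_def using local_diffeo_inv[OF A S(1)] S(2,3) by blast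
    moreover have "inv_into S f b = a" using local_diffeo_germs(5)[OF S(1,2)] S(3) by simp
    ultimately have "C (inv_into S f) \<longleftrightarrow> (\<forall>p\<in>P. p (jet_coords V \<eta> \<psi> b (inv_into S f)) = 0)"
      by (rule P(2))
    also have "\<dots> \<longleftrightarrow> (\<forall>p\<in>P. p' p (jet_coords U \<psi> \<eta> a f) = 0)"
      using p'(2)[of _ "(S, f)"] S by (simp add: F_def c_def)
    finally show ?thesis by simp
  qed
  moreover have "\<forall>p\<in>p' ` P. polynomial_fun (jet_vars k) p"
    using p'(1) k by (simp add: I_def max_def)
  ultimately show ?thesis
    by (intro exI[of _ "p' ` P"] conjI allI impI) (assumption, elim conjE, rule fin)
qed

text \<open>The equations see a germ only through its coordinates of order at most k, and these
  agree.\<close>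

lemma algebraic_at_jet:
  assumes A: "smooth_atlas A" and C: "algebraic_at A k a b C"
    and f: "diffeo_at A a f" "f a = b" and g: "diffeo_at A a g" and j: "same_jet A A k a f g"
  shows "C f \<longleftrightarrow> C g"
proof -
  have ga: "g a = b" using j f unfolding same_jet_def by simp
  obtain U \<psi> where U: "(U, \<psi>) \<in> A" "chart A U \<psi>" "a \<in> U"
    using carrier_chart[OF A smooth_at_carrier(1)[OF diffeo_at_smooth[OF f(1)]]] by metis
  obtain V \<eta> where V: "(V, \<eta>) \<in> A" "chart A V \<eta>" "b \<in> V"
    using carrier_chart[OF A smooth_at_carrier(2)[OF diffeo_at_smooth[OF f(1)]]] f(2) by metis
  obtain P where P: "\<And>p. p \<in> P \<Longrightarrow> polynomial_fun (jet_vars k) p"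
    "\<And>f. diffeo_at A a f \<Longrightarrow> f a = b \<Longrightarrow> C f \<longleftrightarrow> (\<forall>p\<in>P. p (jet_coords U \<psi> \<eta> a f) = 0)"
    by (rule algebraic_atE[OF C U(2,3) V(2,3)]) (rule that)
  have e: "\<forall>\<sigma>. set \<sigma> \<subseteq> Basis \<and> length \<sigma> \<le> k \<longrightarrow>
        iter_deriv \<sigma> (\<eta> \<circ> f \<circ> inv_into U \<psi>) (\<psi> a) = iter_deriv \<sigma> (\<eta> \<circ> g \<circ> inv_into U \<psi>) (\<psi> a)"
    using same_jetD[OF j U(1) V(1) U(3)] V(3) f(2) by blast
  have "p (jet_coords U \<psi> \<eta> a f) = p (jet_coords U \<psi> \<eta> a g)" if "p \<in> P" for p
    by (rule polynomial_fun_cong[OF P(1)[OF that]]) (use e in \<open>auto simp: jet_vars_def jet_coords_def\<close>)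
  then show ?thesis unfolding P(2)[OF f] P(2)[OF g ga] by metis
qed

text \<open>At every order k from 1 on, the Lie equations collect the conditions of index up to k
  for f and for its inverse. The condition of index 0 thus appears at order 1, and the whole tower
  recovers all conditions.\<close>

theorem algebraic_pseudogroupI:
  fixes A :: "('p, 'v::euclidean_space) atlas"
  assumes A: "smooth_atlas A"
    and C: "\<And>k a b. algebraic_at A (max 1 k) a b (C k a)"
    and G: "\<And>S f. (S, f) \<in> G \<longleftrightarrow>
      local_diffeo A A S f \<and> (\<forall>a\<in>S. \<forall>k. C k a f \<and> C k (f a) (inv_into S f))"
  shows "algebraic_pseudogroup A G"
proof -
  \<comment> \<open>A jet of f carries no domain, so K quantifies over all domains of injectivity;
    \<open>indep\<close> shows that one of them is as good as all.\<close>
  define K where "K k a f \<longleftrightarrow> C k a f \<and> (\<forall>S. local_diffeo A A S f \<and> a \<in> S \<longrightarrow> C k (f a) (inv_into S f))"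
    for k a f
  \<comment> \<open>All lower conditions are included so that L is closed under projection to lower
    order. The guard leaves order 0 free.\<close>
  define L where "L k = {jet A A k a f | a f. diffeo_at A a f \<and> (1 \<le> k \<longrightarrow> (\<forall>j\<le>k. K j a f))}" for k
  have inv: "\<exists>P. (\<forall>p\<in>P. polynomial_fun (jet_vars (max 1 k)) p) \<and>
    (\<forall>S f. local_diffeo A A S f \<and> a \<in> S \<and> f a = b \<longrightarrow>
      (C k b (inv_into S f) \<longleftrightarrow> (\<forall>p\<in>P. p (jet_coords U \<psi> \<eta> a f) = 0)))"
    if "chart A U \<psi>" "a \<in> U" "chart A V \<eta>" "b \<in> V" for k a b U \<psi> V \<eta>
    using algebraic_at_inverse[OF A C _ that] by simp
  \<comment> \<open>The polynomial criterion of \<open>inv\<close> mentions f but not its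
    domain.\<close>
  have indep: "C k (f a) (inv_into S f) \<longleftrightarrow> C k (f a) (inv_into S' f)"
    if S: "local_diffeo A A S f" "a \<in> S" and S': "local_diffeo A A S' f" "a \<in> S'" for k f a S S'
  proof -
    obtain U \<psi> where U: "chart A U \<psi>" "a \<in> U"
      using carrier_chart[OF A smooth_at_carrier(1)[OF local_diffeo_germs(1)[OF S]]] by metis
    obtain V \<eta> where V: "chart A V \<eta>" "f a \<in> V"
      using carrier_chart[OF A smooth_at_carrier(2)[OF local_diffeo_germs(1)[OF S]]] by metis
    show ?thesis using inv[OF U V, of k] S S' by blast
  qed
  have K: "algebraic_at A (max 1 k) a b (K k a)" for k a b
  proof -
    have "algebraic_at A (max 1 k) a b (\<lambda>f. \<forall>S. local_diffeo A A S f \<and> a \<in> S \<longrightarrow> C k (f a) (inv_into S f))"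
      unfolding algebraic_at_def
    proof (intro allI impI)
      fix U \<psi> V \<eta> assume c: "chart A U \<psi> \<and> a \<in> U \<and> chart A V \<eta> \<and> b \<in> V"
      then obtain P where P: "\<forall>p\<in>P. polynomial_fun (jet_vars (max 1 k)) p"
        "\<And>S f. local_diffeo A A S f \<Longrightarrow> a \<in> S \<Longrightarrow> f a = b \<Longrightarrow>
          (C k b (inv_into S f) \<longleftrightarrow> (\<forall>p\<in>P. p (jet_coords U \<psi> \<eta> a f) = 0))"
        using inv[of U \<psi> a V \<eta> b k] by metis
      have "(\<forall>S. local_diffeo A A S f \<and> a \<in> S \<longrightarrow> C k (f a) (inv_into S f)) \<longleftrightarrow>
          (\<forall>p\<in>P. p (jet_coords U \<psi> \<eta> a f) = 0)" if fd: "diffeo_at A a f" and that: "f a = b" for f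
      proof -
        obtain S where S: "local_diffeo A A S f" "a \<in> S" using fd unfolding diffeo_at_def by blast
        show ?thesis
        proof
          assume "\<forall>S. local_diffeo A A S f \<and> a \<in> S \<longrightarrow> C k (f a) (inv_into S f)"
          then show "\<forall>p\<in>P. p (jet_coords U \<psi> \<eta> a f) = 0"
            using S P(2)[OF S that] that by simp
        next
          assume "\<forall>p\<in>P. p (jet_coords U \<psi> \<eta> a f) = 0"
          then show "\<forall>S. local_diffeo A A S f \<and> a \<in> S \<longrightarrow> C k (f a) (inv_into S f)"
            using P(2)[of _ f] that by simp
        qed
      qed
      then show "\<exists>P. (\<forall>p\<in>P. polynomial_fun (jet_vars (max 1 k)) p) \<and>
         (\<forall>f. diffeo_at A a f \<and> f a = b \<longrightarrow>
           ((\<forall>S. local_diffeo A A S f \<and> a \<in> S \<longrightarrow> C k (f a) (inv_into S f)) \<longleftrightarrow>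
            (\<forall>p\<in>P. p (jet_coords U \<psi> \<eta> a f) = 0)))"
        by (intro exI[of _ P] conjI P(1) allI impI, elim conjE)
    qed
    then show ?thesis unfolding K_def by (rule algebraic_at_conj[OF C])
  qed
  have mem: "jet A A k a f \<in> L k \<longleftrightarrow> (1 \<le> k \<longrightarrow> (\<forall>j\<le>k. K j a f))" if f: "diffeo_at A a f" for k a f
  proof
    assume "jet A A k a f \<in> L k"
    then obtain a' g where g: "jet A A k a f = jet A A k a' g" "diffeo_at A a' g"
      "1 \<le> k \<longrightarrow> (\<forall>j\<le>k. K j a' g)" unfolding L_def by blast
    note e = jet_eq_imp_same_jet[OF g(1) diffeo_at_smooth[OF f]]
    have ga: "diffeo_at A a g" using g(2) e(1) by simp
    show "1 \<le> k \<longrightarrow> (\<forall>j\<le>k. K j a f)"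
    proof (intro impI allI)
      fix j assume j: "1 \<le> k" "j \<le> k"
      have "same_jet A A (max 1 j) a g f" using same_jet_mono[OF e(2)] j by simp
      then have "K j a g \<longleftrightarrow> K j a f"
        by (rule algebraic_at_jet[OF A K ga refl f])
      then show "K j a f" using g(3) j e(1) by simp
    qed
  next
    assume "1 \<le> k \<longrightarrow> (\<forall>j\<le>k. K j a f)"
    then show "jet A A k a f \<in> L k" unfolding L_def using f by blast
  qed
  have "lie_equations A G L"
    unfolding lie_equations_def
  proof (intro conjI allI impI)
    show "L k \<subseteq> {jet A A k a f |a f. diffeo_at A a f}" for k unfolding L_def by blast
    show "jet A A k a f \<in> L k" if "diffeo_at A a f \<and> jet A A (Suc k) a f \<in> L (Suc k)" for k a f
    proof -
      have "\<forall>j\<le>Suc k. K j a f" using that mem[of a f "Suc k"] by simp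
      then show ?thesis using mem[of a f k] that by simp
    qed
    fix S f
    have d: "diffeo_at A a f" if "local_diffeo A A S f" "a \<in> S" for a
      using that unfolding diffeo_at_def by blast
    show "(S, f) \<in> G \<longleftrightarrow> local_diffeo A A S f \<and> (\<forall>k. \<forall>a\<in>S. jet A A k a f \<in> L k)"
    proof
      assume h: "(S, f) \<in> G"
      then have l: "local_diffeo A A S f" using G by blast
      have "K k a f" if "a \<in> S" for k a
        unfolding K_def using h G that indep[OF l that] by blast
      then show "local_diffeo A A S f \<and> (\<forall>k. \<forall>a\<in>S. jet A A k a f \<in> L k)"
        using l mem[OF d[OF l]] by blast
    next
      assume h: "local_diffeo A A S f \<and> (\<forall>k. \<forall>a\<in>S. jet A A k a f \<in> L k)"
      \<comment> \<open>The order \<open>max 1 k\<close> also covers k = 0, where L itself imposes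
        nothing.\<close>
      have "K k a f" if "a \<in> S" for k a
        using h that mem[OF d[of a], of "max 1 k"] by force
      then show "(S, f) \<in> G" unfolding G K_def using h by blast
    qed
  qed
  moreover have "algebraic_lie_equations A L"
    unfolding algebraic_lie_equations_def
  proof (intro allI ballI, clarify)
    fix k a b U \<psi> V \<eta> assume h: "(U, \<psi>) \<in> A" "(V, \<eta>) \<in> A" "a \<in> U" "b \<in> V"
    have c: "chart A U \<psi>" "chart A V \<eta>" using atlas_chart[OF A] h by blast+
    have "algebraic_at A k a b (\<lambda>f. \<forall>j\<in>(if 1 \<le> k then {..k} else {}). K j a f)"
      by (rule algebraic_at_Ball) (auto intro!: algebraic_at_mono[OF K] split: if_splits)
    then obtain P where P: "\<And>p. p \<in> P \<Longrightarrow> polynomial_fun (jet_vars k) p"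
      "\<And>f. diffeo_at A a f \<Longrightarrow> f a = b \<Longrightarrow> (\<forall>j\<in>(if 1 \<le> k then {..k} else {}). K j a f) \<longleftrightarrow>
        (\<forall>p\<in>P. p (jet_coords U \<psi> \<eta> a f) = 0)"
      by (rule algebraic_atE[OF _ c(1) h(3) c(2) h(4)]) (rule that)
    have "jet A A k a f \<in> L k \<longleftrightarrow> (\<forall>p\<in>P. p (jet_coords U \<psi> \<eta> a f) = 0)"
      if "diffeo_at A a f" "f a = b" for f
      using mem[OF that(1), of k] P(2)[OF that] by (auto split: if_splits)
    then have m: "jet A A k a f \<in> L k \<longleftrightarrow> (\<forall>p\<in>P. p (jet_coords U \<psi> \<eta> a f) = 0)"
      if "diffeo_at A a f \<and> f a = b" for f using that by blast
    have "\<forall>p\<in>P. polynomial_fun (jet_vars k) p" by (rule ballI) (rule P(1))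
    with m show "\<exists>P. (\<forall>p\<in>P. polynomial_fun (jet_vars k) p) \<and>
        (\<forall>f. diffeo_at A a f \<and> f a = b \<longrightarrow>
          (jet A A k a f \<in> L k \<longleftrightarrow> (\<forall>p\<in>P. p (jet_coords U \<psi> \<eta> a f) = 0)))"
      by (intro exI[of _ P]) simp
  qed
  ultimately show ?thesis unfolding algebraic_pseudogroup_def by blast
qed

section \<open>Images of sections under diffeomorphisms of a fibred manifold\<close>

section \<open>Transport of sections\<close>

text \<open>\<open>adapted_chart\<close> for general coordinate spaces of base and fibre, so that it
  also applies to the projection of 1-jets to the base.\<close>

definition adapted ::
  "('p, 'x::euclidean_space \<times> 'z::euclidean_space) atlas \<Rightarrow> ('b, 'x) atlas \<Rightarrow> ('p \<Rightarrow> 'b) \<Rightarrow>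
   'p set \<Rightarrow> ('p \<Rightarrow> 'x \<times> 'z) \<Rightarrow> ('b \<Rightarrow> 'x) \<Rightarrow> bool" where
  "adapted A M pr U \<omega> \<kappa> \<longleftrightarrow> chart A U \<omega> \<and> chart M (pr ` U) \<kappa> \<and> (\<forall>p\<in>U. fst (\<omega> p) = \<kappa> (pr p))"

definition section_at ::
  "('p, 'v::euclidean_space) atlas \<Rightarrow> ('b, 'x::euclidean_space) atlas \<Rightarrow> ('p \<Rightarrow> 'b) \<Rightarrow> 'b \<Rightarrow>
   ('b \<Rightarrow> 'p) \<Rightarrow> bool" where
  "section_at A M pr x t \<longleftrightarrow> smooth_at M A x t \<and> near M x (\<lambda>y. pr (t y) = y)"

text \<open>Near x, f carries the graph of s into that of t. The base point is moved along, so t is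
  evaluated at the projection of the image and not at y.\<close>

definition transports ::
  "('b, 'x::euclidean_space) atlas \<Rightarrow> ('p \<Rightarrow> 'b) \<Rightarrow> 'b \<Rightarrow> ('p \<Rightarrow> 'p) \<Rightarrow> ('b \<Rightarrow> 'p) \<Rightarrow> ('b \<Rightarrow> 'p) \<Rightarrow> bool"
where
  "transports M pr x f s t \<longleftrightarrow> near M x (\<lambda>y. f (s y) = t (pr (f (s y))))"

text \<open>Source, target, a section through the source and coordinates around both points are
  fixed; only the diffeomorphism varies. The map \<open>pr\<close> is the bundle projection for
  point transformations and the projection of 1-jets for contact transformations.\<close>

locale section_transport =
  fixes A :: "('p, 'x::euclidean_space \<times> 'z::euclidean_space) atlas" and M :: "('b, 'x) atlas"
    and pr :: "'p \<Rightarrow> 'b"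
    and U \<omega> \<kappa> a U' \<omega>' \<kappa>' b s
  assumes A: "smooth_atlas A" and M: "smooth_atlas M"
    and adapted: "adapted A M pr U \<omega> \<kappa>" "a \<in> U"
    and adapted': "adapted A M pr U' \<omega>' \<kappa>'" "b \<in> U'"
    and s: "section_at A M pr (pr a) s" "s (pr a) = a"
begin

lemma charts: "chart A U \<omega>" "chart M (pr ` U) \<kappa>" "chart A U' \<omega>'" "chart M (pr ` U') \<kappa>'"
  using adapted adapted' unfolding adapted_def by blast+

lemma fst_chart: "p \<in> U \<Longrightarrow> fst (\<omega> p) = \<kappa> (pr p)" "p \<in> U' \<Longrightarrow> fst (\<omega>' p) = \<kappa>' (pr p)"
  using adapted adapted' unfolding adapted_def by blast+

lemma base_points: "pr a \<in> pr ` U" "pr b \<in> pr ` U'"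
  using adapted(2) adapted'(2) by blast+

abbreviation "inv\<kappa> \<equiv> inv_into (pr ` U) \<kappa>"
abbreviation "inv\<kappa>' \<equiv> inv_into (pr ` U') \<kappa>'"

lemma inv_chart: "m \<in> pr ` U \<Longrightarrow> inv\<kappa> (\<kappa> m) = m" "m \<in> pr ` U' \<Longrightarrow> inv\<kappa>' (\<kappa>' m) = m"
  "p \<in> U \<Longrightarrow> inv_into U \<omega> (\<omega> p) = p" "p \<in> U' \<Longrightarrow> inv_into U' \<omega>' (\<omega>' p) = p"
  using charts[THEN chartD(2)] by simp_all

definition x0 where "x0 = \<kappa> (pr a)"
definition s_loc where "s_loc = \<omega> \<circ> s \<circ> inv\<kappa>"
definition f_loc where "f_loc f = \<omega>' \<circ> f \<circ> inv_into U \<omega>"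
definition X where "X f = (\<lambda>y. fst (f_loc f (s_loc y)))"
definition t_loc where "t_loc t = snd \<circ> \<omega>' \<circ> t \<circ> inv\<kappa>'"
definition germs where "germs = {f. diffeo_at A a f \<and> f a = b}"
definition image_sections where
  "image_sections f = {t. section_at A M pr (pr b) t \<and> t (pr b) = b \<and> transports M pr (pr a) f s t}"

lemma s_smooth: "smooth_at M A (pr a) s" and s_section: "near M (pr a) (\<lambda>y. pr (s y) = y)"
  using s(1) unfolding section_at_def by blast+

lemma s_loc: "smooth_near x0 s_loc" "s_loc x0 = \<omega> a"
  using smooth_at_local[OF M A charts(2,1) base_points(1), of s] s_smooth s(2) adapted(2)
  by (simp_all add: s_loc_def x0_def inv_chart(1)[OF base_points(1)])

lemma germsD: "f \<in> germs \<Longrightarrow> smooth_at A A a f" "f \<in> germs \<Longrightarrow> f a = b"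
  by (simp_all add: germs_def diffeo_at_smooth)

lemma f_loc: "f \<in> germs \<Longrightarrow> smooth_near (\<omega> a) (f_loc f)" "f \<in> germs \<Longrightarrow> f_loc f (\<omega> a) = \<omega>' b"
  using smooth_at_local[OF A A charts(1,3) adapted(2), of f] germsD[of f] adapted(2) adapted'(2)
  by (simp_all add: f_loc_def inv_chart)

lemma f_loc_s_loc: "f \<in> germs \<Longrightarrow> smooth_near x0 (\<lambda>y. f_loc f (s_loc y))"
  using smooth_near_compose[OF s_loc(1), of "f_loc f"] s_loc(2) f_loc(1) by simp

lemma X_smooth: "f \<in> germs \<Longrightarrow> smooth_near x0 (X f)"
  unfolding X_def by (rule smooth_near_fst) (rule f_loc_s_loc)

lemma X_x0: "f \<in> germs \<Longrightarrow> X f x0 = \<kappa>' (pr b)"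
  by (simp add: X_def s_loc(2) f_loc(2) fst_chart(2) adapted'(2))

lemma near_domains:
  assumes f: "f \<in> germs"
  shows "near M (pr a) (\<lambda>m. m \<in> pr ` U \<and> s m \<in> U \<and> f (s m) \<in> U' \<and> pr (s m) = m)"
proof -
  have "near A (s (pr a)) (\<lambda>p. f p \<in> U')"
    using smooth_at_vimage[OF A A germsD(1)[OF f], of "\<lambda>p. p \<in> U'"]
      near_mopen[OF chartD(1)[OF charts(3)] adapted'(2)] germsD(2)[OF f] s(2) by simp
  then have 1: "near M (pr a) (\<lambda>m. f (s m) \<in> U')"
    by (rule smooth_at_vimage[OF M A s_smooth])
  have "near A (s (pr a)) (\<lambda>p. p \<in> U)"
    using near_mopen[OF chartD(1)[OF charts(1)] adapted(2)] s(2) by simp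
  then have 2: "near M (pr a) (\<lambda>m. s m \<in> U)"
    by (rule smooth_at_vimage[OF M A s_smooth])
  have 3: "near M (pr a) (\<lambda>m. m \<in> pr ` U)"
    by (rule near_mopen[OF chartD(1)[OF charts(2)] base_points(1)])
  show ?thesis
    by (intro near_conj[OF M] 1 2 3 s_section)
qed

lemma near_base: "near M (pr a) P \<longleftrightarrow> eventually (\<lambda>y. P (inv\<kappa> y)) (nhds x0)"
  unfolding x0_def by (rule near_chart[OF M charts(2) base_points(1)])

lemma inv_eventually: "eventually (\<lambda>y. \<kappa> (inv\<kappa> y) = y) (nhds x0)"
  using eventually_chart[OF charts(2) base_points(1)] unfolding x0_def
  by eventually_elim simp

lemma X_eq: "m \<in> pr ` U \<Longrightarrow> s m \<in> U \<Longrightarrow> f (s m) \<in> U' \<Longrightarrow> X f (\<kappa> m) = \<kappa>' (pr (f (s m)))"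
  by (simp add: X_def f_loc_def s_loc_def inv_chart fst_chart)

lemma image_sectionsD:
  assumes "t \<in> image_sections f"
  shows "smooth_at M A (pr b) t" "t (pr b) = b" "near M (pr a) (\<lambda>m. f (s m) = t (pr (f (s m))))"
    "near M (pr b) (\<lambda>m. pr (t m) = m)"
  using assms unfolding image_sections_def section_at_def transports_def by blast+

lemma t_loc_smooth:
  assumes "t \<in> image_sections f"
  shows "smooth_near (\<kappa>' (pr b)) (t_loc t)"
proof -
  have "smooth_near (\<kappa>' (pr b)) (\<omega>' \<circ> t \<circ> inv\<kappa>')"
    using smooth_at_local[OF M A charts(4,3) base_points(2), of t] image_sectionsD(1,2)[OF assms]
      adapted'(2) by simp
  from smooth_near_snd[OF this] show ?thesis by (simp add: t_loc_def comp_def)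
qed

text \<open>Describes t along \<open>X f\<close>, the only place where f determines it directly, and
  hence in the form that \<open>rat_jets_inverse\<close> requires.\<close>

lemma t_loc_X:
  assumes f: "f \<in> germs" and t: "t \<in> image_sections f"
  shows "eventually (\<lambda>y. t_loc t (X f y) = snd (f_loc f (s_loc y))) (nhds x0)"
proof -
  have "near M (pr a) (\<lambda>m. (m \<in> pr ` U \<and> s m \<in> U \<and> f (s m) \<in> U' \<and> pr (s m) = m) \<and>
      f (s m) = t (pr (f (s m))))"
    by (rule near_conj[OF M near_domains[OF f] image_sectionsD(3)[OF t]])
  from this[unfolded near_base] inv_eventually show ?thesis
  proof eventually_elim
    case (elim y)
    then have "X f y = \<kappa>' (pr (f (s (inv\<kappa> y))))" using X_eq[of "inv\<kappa> y" f] by simp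
    moreover have "snd (f_loc f (s_loc y)) = snd (\<omega>' (f (s (inv\<kappa> y))))"
      using elim by (simp add: f_loc_def s_loc_def inv_chart)
    moreover have "inv\<kappa>' (\<kappa>' (pr (f (s (inv\<kappa> y))))) = pr (f (s (inv\<kappa> y)))"
      by (rule inv_chart(2)) (use elim in blast)
    ultimately show ?case using elim by (simp add: t_loc_def)
  qed
qed

text \<open>If the image of \<open>s\<close> under \<open>f\<close> is the section \<open>t\<close>, then \<open>X f\<close> is inverted by the base
  component of \<open>f\<inverse> \<circ> t\<close>.\<close>

lemma X_nondegenerate:
  assumes f: "f \<in> germs" and t: "t \<in> image_sections f"
  shows "jdet (X f) x0 \<noteq> 0"
proof -
  obtain S where S: "a \<in> S" "local_diffeo A A S f" using f unfolding germs_def diffeo_at_def by blast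
  let ?g = "inv_into S f"
  note g = local_diffeo_germs[OF S(2,1)]
  have gt: "smooth_at M A (pr b) (?g \<circ> t)"
    using smooth_at_compose[OF M A A image_sectionsD(1)[OF t], of ?g] g(2) germsD(2)[OF f]
      image_sectionsD(2)[OF t] by simp
  have gb: "(?g \<circ> t) (pr b) = a"
    using g(5) germsD(2)[OF f] image_sectionsD(2)[OF t] by simp
  define h where "h = (\<lambda>z. fst ((\<omega> \<circ> (?g \<circ> t) \<circ> inv\<kappa>') z))"
  have h: "smooth_near (\<kappa>' (pr b)) h"
    unfolding h_def
    using smooth_at_local[OF M A charts(4,1) base_points(2) _ gt] gb adapted(2)
    by (intro smooth_near_fst) (simp add: comp_def)
  have "near M (pr a) (\<lambda>m. ?g (f (s m)) = s m)"
    using smooth_at_vimage[OF M A s_smooth, of "\<lambda>p. ?g (f p) = p"] g(3) s(2) by simp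
  then have "near M (pr a) (\<lambda>m. (m \<in> pr ` U \<and> s m \<in> U \<and> f (s m) \<in> U' \<and> pr (s m) = m) \<and>
      f (s m) = t (pr (f (s m))) \<and> ?g (f (s m)) = s m)"
    by (intro near_conj[OF M] near_domains[OF f] image_sectionsD(3)[OF t])
  from this[unfolded near_base] inv_eventually
  have "eventually (\<lambda>y. h (X f y) = y) (nhds x0)"
  proof eventually_elim
    case (elim y)
    then have "X f y = \<kappa>' (pr (f (s (inv\<kappa> y))))" using X_eq[of "inv\<kappa> y" f] by simp
    moreover have "inv\<kappa>' (\<kappa>' (pr (f (s (inv\<kappa> y))))) = pr (f (s (inv\<kappa> y)))"
      by (rule inv_chart(2)) (use elim in blast)
    moreover have "t (pr (f (s (inv\<kappa> y)))) = f (s (inv\<kappa> y))" using elim by metis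
    ultimately have "h (X f y) = fst (\<omega> (s (inv\<kappa> y)))" using elim by (simp add: h_def)
    then show ?case using elim by (simp add: fst_chart)
  qed
  then show ?thesis
    using jdet_nonzeroI[OF X_smooth[OF f], of h] h X_x0[OF f] by simp
qed

text \<open>Converse to \<open>X_nondegenerate\<close>: a nonzero Jacobian is equivalent to the
  existence of an image section.\<close>

lemma image_section_exists:
  assumes f: "f \<in> germs" and d: "jdet (X f) x0 \<noteq> 0"
  shows "\<exists>t. t \<in> image_sections f"
proof -
  obtain Y where Y: "smooth_near (X f x0) Y" "Y (X f x0) = x0"
    "eventually (\<lambda>y. Y (X f y) = y) (nhds x0)" "eventually (\<lambda>z. X f (Y z) = z) (nhds (X f x0))"
    by (rule smooth_inverse_function[OF X_smooth[OF f] d]) (rule that)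
  note x1 = X_x0[OF f]
  define w where "w = Y \<circ> \<kappa>'"
  have w: "smooth_at M euclidean_atlas (pr b) w" "w (pr b) = x0"
    unfolding w_def
    using smooth_at_compose[OF M smooth_atlas_euclidean smooth_atlas_euclidean
        chart_smooth_at(1)[OF charts(4) base_points(2)], of Y] Y(1,2) x1
    by (simp_all add: smooth_at_euclidean)
  have c1: "smooth_at M M (pr b) (inv\<kappa> \<circ> w)"
    using smooth_at_compose[OF M smooth_atlas_euclidean M w(1), of inv\<kappa>]
      chart_smooth_at(2)[OF charts(2) base_points(1)] w(2) by (simp add: x0_def)
  have v1: "(inv\<kappa> \<circ> w) (pr b) = pr a" using w(2) inv_chart(1)[OF base_points(1)] by (simp add: x0_def)
  have c2: "smooth_at M A (pr b) (s \<circ> (inv\<kappa> \<circ> w))"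
    using smooth_at_compose[OF M M A c1, of s] s_smooth v1 by simp
  have v2: "(s \<circ> (inv\<kappa> \<circ> w)) (pr b) = a" using v1 s(2) by simp
  \<comment> \<open>\<open>w m\<close> is the coordinate of the base point that f, following s,
    moves to m; so t is f after s at that base point.\<close>
  define t where "t = f \<circ> (s \<circ> (inv\<kappa> \<circ> w))"
  have t1: "smooth_at M A (pr b) t"
    unfolding t_def using smooth_at_compose[OF M A A c2, of f] germsD(1)[OF f] v2 by simp
  have t2: "t (pr b) = b" unfolding t_def using v2 germsD(2)[OF f] by simp
  have E: "eventually (\<lambda>y. (inv\<kappa> y \<in> pr ` U \<and> s (inv\<kappa> y) \<in> U \<and> f (s (inv\<kappa> y)) \<in> U' \<and> pr (s (inv\<kappa> y)) = inv\<kappa> y) \<and>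
      \<kappa> (inv\<kappa> y) = y) (nhds x0)"
    using near_domains[OF f, unfolded near_base] inv_eventually by eventually_elim simp
  have n1: "near M (pr b) (\<lambda>m. (inv\<kappa> (w m) \<in> pr ` U \<and> s (inv\<kappa> (w m)) \<in> U \<and> f (s (inv\<kappa> (w m))) \<in> U' \<and>
      pr (s (inv\<kappa> (w m))) = inv\<kappa> (w m)) \<and> \<kappa> (inv\<kappa> (w m)) = w m)"
    using smooth_at_vimage[OF M smooth_atlas_euclidean w(1)] E w(2) by (simp add: near_euclidean)
  have n2: "near M (pr b) (\<lambda>m. X f (Y (\<kappa>' m)) = \<kappa>' m)"
    using smooth_at_vimage[OF M smooth_atlas_euclidean chart_smooth_at(1)[OF charts(4) base_points(2)]]
      Y(4) x1 by (simp add: near_euclidean)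
  have n3: "near M (pr b) (\<lambda>m. m \<in> pr ` U')"
    by (rule near_mopen[OF chartD(1)[OF charts(4)] base_points(2)])
  have "near M (pr b) (\<lambda>m. ((inv\<kappa> (w m) \<in> pr ` U \<and> s (inv\<kappa> (w m)) \<in> U \<and> f (s (inv\<kappa> (w m))) \<in> U' \<and>
      pr (s (inv\<kappa> (w m))) = inv\<kappa> (w m)) \<and> \<kappa> (inv\<kappa> (w m)) = w m) \<and> X f (Y (\<kappa>' m)) = \<kappa>' m \<and> m \<in> pr ` U')"
    by (rule near_conj[OF M n1 near_conj[OF M n2 n3]])
  then have t3: "near M (pr b) (\<lambda>m. pr (t m) = m)"
  proof (rule near_mono)
    fix m assume h: "((inv\<kappa> (w m) \<in> pr ` U \<and> s (inv\<kappa> (w m)) \<in> U \<and> f (s (inv\<kappa> (w m))) \<in> U' \<and>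
      pr (s (inv\<kappa> (w m))) = inv\<kappa> (w m)) \<and> \<kappa> (inv\<kappa> (w m)) = w m) \<and> X f (Y (\<kappa>' m)) = \<kappa>' m \<and> m \<in> pr ` U'"
    then have "X f (w m) = \<kappa>' (pr (t m))" using X_eq[of "inv\<kappa> (w m)" f] by (simp add: t_def)
    then have "\<kappa>' (pr (t m)) = \<kappa>' m" using h by (simp add: w_def)
    moreover have "pr (t m) \<in> pr ` U'" using h by (simp add: t_def)
    ultimately show "pr (t m) = m" using chartD(2)[OF charts(4)] h by (metis inj_onD)
  qed
  have "near M (pr a) (\<lambda>m. f (s m) = t (pr (f (s m))))"
    unfolding near_base using E Y(3)
  proof eventually_elim
    case (elim y)
    then have "X f y = \<kappa>' (pr (f (s (inv\<kappa> y))))" using X_eq[of "inv\<kappa> y" f] by simp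
    then show ?case using elim by (simp add: t_def w_def)
  qed
  then show ?thesis
    using t1 t2 t3 unfolding image_sections_def section_at_def transports_def by blast
qed

text \<open>The second component of an index is left open: it is \<open>unit\<close> while the
  Jacobian is shown to be polynomial, and an image section afterwards. The denominator is open for
  the same reason.\<close>

lemma rational_fields:
  fixes F :: "(('p \<Rightarrow> 'p) \<times> 't) set" and D
  defines "c \<equiv> \<lambda>(f, t :: 't). jet_coords U \<omega> \<omega>' a f" and "I \<equiv> \<lambda>r. jet_vars (max 1 r)"
  assumes R: "rational_jets F c I D" and F': "fst ` F \<subseteq> germs"
  shows "rational_jets.smooth_germs F x0 (\<lambda>i. X (fst i))"
    and "e \<in> Basis \<Longrightarrow> rational_jets.germ_field F c I D 0 x0 (\<lambda>i y. X (fst i) y \<bullet> e)"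
    and "e' \<in> Basis \<Longrightarrow> rational_jets.germ_field F c I D 0 x0 (\<lambda>i y. snd (f_loc (fst i) (s_loc y)) \<bullet> e')"
proof -
  interpret rational_jets F c I D by (rule R)
  have F: "fst i \<in> germs" if "i \<in> F" for i using F' that by blast
  show "smooth_germs x0 (\<lambda>i. X (fst i))"
    unfolding smooth_germs_def using X_smooth F by blast
  have G: "smooth_germs (\<omega> a) (\<lambda>i. f_loc (fst i))"
    unfolding smooth_germs_def using f_loc(1) F by blast
  have jets: "rat (length \<tau>) (\<lambda>i. iter_deriv \<tau> (f_loc (fst i)) (\<omega> a) \<bullet> u)"
    if \<tau>: "set \<tau> \<subseteq> Basis" and u: "u \<in> Basis" for \<tau> u
  proof (cases "\<tau> = []")
    case True
    show ?thesis
      by (rule rat_cong[OF _ rat_const[of _ "\<omega>' b \<bullet> u"]]) (use True f_loc(2) F in simp)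
  next
    case False
    have "(\<tau>, u) \<in> I (length \<tau>)" using \<tau> u False by (simp add: I_def jet_vars_def)
    then have "rat (length \<tau>) (\<lambda>i. c i (\<tau>, u))" by (rule rat_coord)
    then show ?thesis by (simp add: jet_coords_def c_def f_loc_def case_prod_unfold)
  qed
  have comp: "germ_field 0 x0 (\<lambda>i y. f_loc (fst i) (s_loc y) \<bullet> u)" if "u \<in> Basis" for u
    using germ_field_jet_compose[OF s_loc G jets, of "[]" u] that by simp
  show "germ_field 0 x0 (\<lambda>i y. X (fst i) y \<bullet> e)" if "e \<in> Basis"
    using comp[of "(e, 0)"] that by (simp add: X_def inner_prod_def Basis_prod_def)
  show "germ_field 0 x0 (\<lambda>i y. snd (f_loc (fst i) (s_loc y)) \<bullet> e')" if "e' \<in> Basis"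
    using comp[of "(0, e')"] that by (simp add: inner_prod_def Basis_prod_def)
qed

lemma jet_vars_1_mono: "m \<le> n \<Longrightarrow> jet_vars (max 1 m) \<subseteq> jet_vars (max 1 n)"
  by (rule jet_vars_mono) auto

text \<open>Obtained with denominator 1, before the Jacobian itself becomes the denominator.\<close>

lemma jacobian_polynomial:
  "\<exists>d. polynomial_fun (jet_vars 1) d \<and> (\<forall>f\<in>germs. jdet (X f) x0 = d (jet_coords U \<omega> \<omega>' a f))"
proof -
  define F :: "(('p \<Rightarrow> 'p) \<times> unit) set" where "F = germs \<times> UNIV"
  let ?c = "\<lambda>(f, t :: unit). jet_coords U \<omega> \<omega>' a f"
  let ?I = "\<lambda>r. jet_vars (max 1 r) :: (('x \<times> 'z) list \<times> ('x \<times> 'z)) set"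
  interpret rational_jets F ?c ?I "\<lambda>f. 1"
    by (rule rational_jets_1) (rule jet_vars_1_mono)
  have "fst ` F \<subseteq> germs" by (auto simp: F_def)
  note X = rational_fields[OF rational_jets_axioms this]
  have "germ_field 1 x0 (\<lambda>i. jdet (X (fst i)))"
    by (rule germ_field_jacobian(1)[OF X(1,2)])
  then obtain N d where d: "polynomial_fun (?I 1) d" "\<forall>i\<in>F. 1 ^ N * jdet (X (fst i)) x0 = d (?c i)"
    using germ_field_rat unfolding rat_def by blast
  have "jdet (X f) x0 = d (jet_coords U \<omega> \<omega>' a f)" if "f \<in> germs" for f
    using d(2)[rule_format, of "(f, ())"] that by (simp add: F_def)
  then show ?thesis using d(1) by auto
qed

text \<open>Indexing by pairs (f, t) avoids choosing t as a function of f. The resulting p' involves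
  only the jet of f and so answers for every image section alike.\<close>

lemma image_section_polynomial:
  assumes p: "polynomial_fun (jet_vars k) p"
  shows "\<exists>p'. polynomial_fun (jet_vars (max 1 k)) p' \<and>
    (\<forall>f\<in>germs. \<forall>t\<in>image_sections f.
      p (jet_coords (pr ` U') \<kappa>' (snd \<circ> \<omega>') (pr b) t) = 0 \<longleftrightarrow> p' (jet_coords U \<omega> \<omega>' a f) = 0)"
proof -
  define F where "F = {(f, t). f \<in> germs \<and> t \<in> image_sections f}"
  let ?c = "\<lambda>(f, t :: 'b \<Rightarrow> 'p). jet_coords U \<omega> \<omega>' a f"
  let ?I = "\<lambda>r. jet_vars (max 1 r) :: (('x \<times> 'z) list \<times> ('x \<times> 'z)) set"
  let ?D = "\<lambda>(f, t :: 'b \<Rightarrow> 'p). jdet (X f) x0"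
  obtain d where d: "polynomial_fun (jet_vars 1) d" "\<forall>f\<in>germs. jdet (X f) x0 = d (jet_coords U \<omega> \<omega>' a f)"
    using jacobian_polynomial by blast
  interpret rational_jets F ?c ?I ?D
  proof
    show "?I m \<subseteq> ?I n" if "m \<le> n" for m n by (rule jet_vars_1_mono[OF that])
    show "\<exists>d. polynomial_fun (?I 0) d \<and> (\<forall>i\<in>F. ?D i = d (?c i))"
      using d by (intro exI[of _ d]) (auto simp: F_def)
    show "?D i \<noteq> 0" if "i \<in> F" for i using that X_nondegenerate by (auto simp: F_def)
  qed
  have F: "fst i \<in> germs" "snd i \<in> image_sections (fst i)" if "i \<in> F" for i
    using that by (auto simp: F_def)
  then have "fst ` F \<subseteq> germs" by blast
  note X = rational_fields[OF rational_jets_axioms this]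
  have q: "rat k (\<lambda>i. jet_coords (pr ` U') \<kappa>' (snd \<circ> \<omega>') (pr b) (snd i) j)" if j: "j \<in> jet_vars k" for j
  proof -
    obtain \<tau> e where \<tau>: "j = (\<tau>, e)" "set \<tau> \<subseteq> Basis" "length \<tau> \<le> k" "e \<in> Basis"
      using j by (auto simp: jet_vars_def)
    have "rat (length \<tau>) (\<lambda>i. iter_deriv \<tau> (\<lambda>z. t_loc (snd i) z \<bullet> e) (X (fst i) x0))"
    proof (rule rat_jets_inverse[OF X(1,2) _ _ _ \<tau>(2)])
      show "?D i = jdet (X (fst i)) x0" for i by (simp add: case_prod_unfold)
      show "smooth_near (X (fst i) x0) (\<lambda>z. t_loc (snd i) z \<bullet> e)" if "i \<in> F" for i
        using t_loc_smooth[OF F(2)[OF that]] X_x0[OF F(1)[OF that]] by (simp add: smooth_near_inner)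
      show "germ_field 0 x0 (\<lambda>i y. t_loc (snd i) (X (fst i) y) \<bullet> e)"
      proof (rule germ_field_cong[OF _ X(3)[OF \<tau>(4)]])
        show "eventually (\<lambda>y. snd (f_loc (fst i) (s_loc y)) \<bullet> e = t_loc (snd i) (X (fst i) y) \<bullet> e) (nhds x0)"
          if "i \<in> F" for i
          using t_loc_X[OF F[OF that]] by eventually_elim simp
      qed
    qed
    then have "rat (length \<tau>) (\<lambda>i. jet_coords (pr ` U') \<kappa>' (snd \<circ> \<omega>') (pr b) (snd i) j)"
    proof (rule rat_cong[rotated])
      fix i assume i: "i \<in> F"
      show "iter_deriv \<tau> (\<lambda>z. t_loc (snd i) z \<bullet> e) (X (fst i) x0) =
          jet_coords (pr ` U') \<kappa>' (snd \<circ> \<omega>') (pr b) (snd i) j"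
        using iter_deriv_inner[OF t_loc_smooth[OF F(2)[OF i]] \<tau>(2), of e] X_x0[OF F(1)[OF i]]
        by (simp add: jet_coords_def \<tau>(1) t_loc_def)
    qed
    then show ?thesis using \<tau>(3) by (rule rat_mono)
  qed
  obtain p' where p': "polynomial_fun (?I k) p'"
    "\<forall>i\<in>F. p (jet_coords (pr ` U') \<kappa>' (snd \<circ> \<omega>') (pr b) (snd i)) = 0 \<longleftrightarrow> p' (?c i) = 0"
    using rat_polynomial_zeros[where q = "\<lambda>i. jet_coords (pr ` U') \<kappa>' (snd \<circ> \<omega>') (pr b) (snd i)", OF p q]
    by blast
  then show ?thesis by (intro exI[of _ p']) (auto simp: F_def)
qed

lemma algebraic_at_image:
  assumes P: "\<And>p. p \<in> P \<Longrightarrow> polynomial_fun (jet_vars k) p"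
    and R: "\<And>t. section_at A M pr (pr b) t \<Longrightarrow> t (pr b) = b \<Longrightarrow>
      R t \<longleftrightarrow> (\<forall>p\<in>P. p (jet_coords (pr ` U') \<kappa>' (snd \<circ> \<omega>') (pr b) t) = 0)"
  shows "algebraic_at A (max 1 k) a b (\<lambda>f. \<forall>t\<in>image_sections f. R t)"
proof -
  obtain d where d: "polynomial_fun (jet_vars 1) d" "\<And>f. f \<in> germs \<Longrightarrow> jdet (X f) x0 = d (jet_coords U \<omega> \<omega>' a f)"
    using jacobian_polynomial by blast
  have "\<forall>p. \<exists>p'. p \<in> P \<longrightarrow> polynomial_fun (jet_vars (max 1 k)) p' \<and>
    (\<forall>f\<in>germs. \<forall>t\<in>image_sections f.
      p (jet_coords (pr ` U') \<kappa>' (snd \<circ> \<omega>') (pr b) t) = 0 \<longleftrightarrow> p' (jet_coords U \<omega> \<omega>' a f) = 0)"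
    using image_section_polynomial[OF P] by fast
  from choice[OF this] obtain p' where p': "\<And>p. p \<in> P \<Longrightarrow> polynomial_fun (jet_vars (max 1 k)) (p' p)"
    "\<And>p f t. p \<in> P \<Longrightarrow> f \<in> germs \<Longrightarrow> t \<in> image_sections f \<Longrightarrow>
      p (jet_coords (pr ` U') \<kappa>' (snd \<circ> \<omega>') (pr b) t) = 0 \<longleftrightarrow> p' p (jet_coords U \<omega> \<omega>' a f) = 0"
    by fast
  let ?P = "(\<lambda>p w. d w * p' p w) ` P"
  show ?thesis
  proof (rule algebraic_atI[OF A charts(1) adapted(2) charts(3) adapted'(2), where P = ?P])
    fix q assume "q \<in> ?P"
    then obtain p where p: "p \<in> P" "q = (\<lambda>w. d w * p' p w)" by blast
    have "polynomial_fun (jet_vars (max 1 k)) d"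
      by (rule polynomial_fun_mono[OF d(1)]) (rule jet_vars_mono, simp)
    then show "polynomial_fun (jet_vars (max 1 k)) q"
      unfolding p(2) by (rule polynomial_fun.mult[OF _ p'(1)[OF p(1)]])
  next
    fix f assume "diffeo_at A a f" "f a = b"
    then have f: "f \<in> germs" by (simp add: germs_def)
    \<comment> \<open>The right side does not mention t: R holds for all image sections of f or for
      none.\<close>
    have R': "R t \<longleftrightarrow> (\<forall>p\<in>P. p' p (jet_coords U \<omega> \<omega>' a f) = 0)" if "t \<in> image_sections f" for t
      using R[of t] that p'(2)[OF _ f that] by (simp add: image_sections_def)
    have nz: "d (jet_coords U \<omega> \<omega>' a f) \<noteq> 0 \<longleftrightarrow> (\<exists>t. t \<in> image_sections f)"
      using d(2)[OF f] image_section_exists[OF f] X_nondegenerate[OF f] by auto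
    have "(\<forall>t\<in>image_sections f. R t) \<longleftrightarrow>
        (\<forall>p\<in>P. d (jet_coords U \<omega> \<omega>' a f) * p' p (jet_coords U \<omega> \<omega>' a f) = 0)"
    proof (cases "\<exists>t. t \<in> image_sections f")
      case True then show ?thesis using R' nz by auto
    next
      case False then show ?thesis using nz by auto
    qed
    then show "(\<forall>t\<in>image_sections f. R t) \<longleftrightarrow> (\<forall>q\<in>?P. q (jet_coords U \<omega> \<omega>' a f) = 0)"
      by simp
  qed
qed

text \<open>Near pr b every base point is the projection of some f (s m), because \<open>X f\<close>
  is locally invertible by \<open>X_nondegenerate\<close>. The relation between s and t, known only
  along s, therefore holds on a full neighbourhood of pr b.\<close>

lemma transports_inverse:
  assumes S: "local_diffeo A A S f" "a \<in> S" "f a = b" and t: "t \<in> image_sections f"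
  shows "transports M pr (pr b) (inv_into S f) t s"
proof -
  have f: "f \<in> germs" using S unfolding germs_def diffeo_at_def by blast
  let ?g = "inv_into S f"
  obtain Y where Y: "smooth_near (X f x0) Y" "Y (X f x0) = x0"
    "eventually (\<lambda>y. Y (X f y) = y) (nhds x0)" "eventually (\<lambda>z. X f (Y z) = z) (nhds (X f x0))"
    by (rule smooth_inverse_function[OF X_smooth[OF f] X_nondegenerate[OF f t]]) (rule that)
  note x1 = X_x0[OF f]
  have "near M (pr a) (\<lambda>m. ?g (f (s m)) = s m)"
    using smooth_at_vimage[OF M A s_smooth, of "\<lambda>p. ?g (f p) = p"] local_diffeo_germs(3)[OF S(1,2)] s(2) by simp
  then have "near M (pr a) (\<lambda>m. (m \<in> pr ` U \<and> s m \<in> U \<and> f (s m) \<in> U' \<and> pr (s m) = m) \<and>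
      f (s m) = t (pr (f (s m))) \<and> ?g (f (s m)) = s m)"
    by (intro near_conj[OF M] near_domains[OF f] image_sectionsD(3)[OF t])
  from this[unfolded near_base] inv_eventually
  have "eventually (\<lambda>y. X f y = \<kappa>' (pr (f (s (inv\<kappa> y)))) \<and> pr (f (s (inv\<kappa> y))) \<in> pr ` U' \<and>
      ?g (t (pr (f (s (inv\<kappa> y))))) = s (pr (?g (t (pr (f (s (inv\<kappa> y)))))))) (nhds x0)"
  proof eventually_elim
    case (elim y)
    then have "X f y = \<kappa>' (pr (f (s (inv\<kappa> y))))" using X_eq[of "inv\<kappa> y" f] by simp
    moreover have "t (pr (f (s (inv\<kappa> y)))) = f (s (inv\<kappa> y))" using elim by metis
    ultimately show ?case using elim by simp
  qed
  moreover have "filterlim Y (nhds x0) (nhds (X f x0))"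
    using smooth_near_filterlim[OF Y(1)] Y(2) by simp
  ultimately have "eventually (\<lambda>z. X f (Y z) = \<kappa>' (pr (f (s (inv\<kappa> (Y z))))) \<and> pr (f (s (inv\<kappa> (Y z)))) \<in> pr ` U' \<and>
      ?g (t (pr (f (s (inv\<kappa> (Y z)))))) = s (pr (?g (t (pr (f (s (inv\<kappa> (Y z))))))))) (nhds (X f x0))"
    by (rule eventually_compose_filterlim)
  then have "eventually (\<lambda>z. ?g (t (inv\<kappa>' z)) = s (pr (?g (t (inv\<kappa>' z))))) (nhds (X f x0))"
    using Y(4)
  proof eventually_elim
    case (elim z)
    then have "inv\<kappa>' z = pr (f (s (inv\<kappa> (Y z))))"
      using inv_chart(2)[of "pr (f (s (inv\<kappa> (Y z))))"] by simp
    then show ?case using elim by simp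
  qed
  then show ?thesis
    unfolding transports_def near_chart[OF M charts(4) base_points(2)] x1 by simp
qed

end

section \<open>From invariance of distinguished sections to algebraic pseudogroups\<close>

lemma adapted_smooth_projection:
  assumes "smooth_atlas A" "smooth_atlas M" "adapted A M pr U \<omega> \<kappa>" "p \<in> U"
  shows "smooth_at A M p pr"
proof -
  have c: "chart A U \<omega>" "chart M (pr ` U) \<kappa>" using assms(3) unfolding adapted_def by blast+
  have "smooth_at euclidean_atlas euclidean_atlas (\<omega> p) fst"
    by (simp add: smooth_at_euclidean smooth_near_linear bounded_linear_fst)
  from smooth_at_compose[OF assms(1) smooth_atlas_euclidean smooth_atlas_euclidean
      chart_smooth_at(1)[OF c(1) assms(4)] this]
  have "smooth_at A euclidean_atlas p (fst \<circ> \<omega>)" .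
  moreover have v: "(fst \<circ> \<omega>) q = \<kappa> (pr q)" if "q \<in> U" for q using assms(3) that unfolding adapted_def by simp
  ultimately have "smooth_at A M p (inv_into (pr ` U) \<kappa> \<circ> (fst \<circ> \<omega>))"
    using smooth_at_compose[OF assms(1) smooth_atlas_euclidean assms(2), of p "fst \<circ> \<omega>"]
      chart_smooth_at(2)[OF c(2), of "pr p"] assms(4) by simp
  moreover have "near A p (\<lambda>q. (inv_into (pr ` U) \<kappa> \<circ> (fst \<circ> \<omega>)) q = pr q)"
    by (rule near_mono[OF near_mopen[OF chartD(1)[OF c(1)] assms(4)]])
      (use v chartD(2)[OF c(2)] in simp)
  ultimately show ?thesis using smooth_at_cong[OF assms(1)] by blast
qed

lemma iter_deriv_near_cong:
  assumes "smooth_atlas A" "chart A U \<psi>" "p \<in> U" "near A p (\<lambda>y. f y = g y)"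
  shows "iter_deriv \<sigma> (\<eta> \<circ> f \<circ> inv_into U \<psi>) (\<psi> p) = iter_deriv \<sigma> (\<eta> \<circ> g \<circ> inv_into U \<psi>) (\<psi> p)"
  by (rule iter_deriv_cong)
    (use assms(4)[unfolded near_chart[OF assms(1-3)]] in \<open>simp add: eventually_mono\<close>)

lemma same_jet_near:
  assumes "smooth_atlas A" "near A p (\<lambda>y. f y = g y)"
  shows "same_jet A B k p f g"
  by (rule same_jetI)
    (use near_point[OF assms(2)] iter_deriv_near_cong[OF assms(1) atlas_chart[OF assms(1)] _ assms(2)] in blast)+

lemma algebraic_at_True: "algebraic_at A k a b (\<lambda>f. True)"
  using algebraic_at_Ball[of "{}" A k a b "\<lambda>i f. False"] by simp

text \<open>No chart contains such a point, so there is nothing to satisfy.\<close>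

lemma algebraic_at_outside:
  assumes "a \<notin> carrier A \<or> b \<notin> carrier A"
  shows "algebraic_at A k a b C"
proof -
  have "x \<in> carrier A" if "chart A U \<psi>" "x \<in> U" for x U \<psi>
    using mopen_subset[OF chartD(1)[OF that(1)]] that(2) by (rule subsetD)
  then have n: "\<not> (chart A U \<psi> \<and> a \<in> U \<and> chart A V \<eta> \<and> b \<in> V)" for U \<psi> V \<eta>
    using assms by metis
  show ?thesis unfolding algebraic_at_def by (intro allI impI) (rule notE[OF n])
qed

text \<open>Common core of both cases. \<open>Lifts a\<close> holds the admissible sections through
  a (all sections, or the prolonged ones), \<open>B\<close> is a further algebraic condition on f
  (none, or contactness), and \<open>R k\<close> is the equation at order k, given by polynomials on
  all sections. Images of admissible sections are known to be admissible only once B holds on a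
  whole domain, which is the assumption \<open>holonomic\<close>. It replaces the arbitrary image
  section t of a pointwise condition by an admissible one with the same germ.\<close>

theorem algebraic_lifted_symmetries:
  fixes A :: "('p, 'x::euclidean_space \<times> 'z::euclidean_space) atlas" and M :: "('b, 'x) atlas"
    and R :: "nat \<Rightarrow> 'p \<Rightarrow> ('b \<Rightarrow> 'p) \<Rightarrow> bool" and Lifts :: "'p \<Rightarrow> ('b \<Rightarrow> 'p) set"
  assumes A: "smooth_atlas A" and M: "smooth_atlas M"
    and R: "\<And>k b. b \<in> carrier A \<Longrightarrow> \<exists>U \<omega> \<kappa> P. adapted A M pr U \<omega> \<kappa> \<and> b \<in> U \<and>
      (\<forall>p\<in>P. polynomial_fun (jet_vars k) p) \<and>
      (\<forall>t. section_at A M pr (pr b) t \<and> t (pr b) = b \<longrightarrow>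
        (R k b t \<longleftrightarrow> (\<forall>p\<in>P. p (jet_coords (pr ` U) \<kappa> (snd \<circ> \<omega>) (pr b) t) = 0)))"
    and Lifts: "\<And>a s. s \<in> Lifts a \<Longrightarrow> section_at A M pr (pr a) s \<and> s (pr a) = a"
    and B: "\<And>k a b. algebraic_at A (max 1 k) a b (B k a)"
    and holonomic: "\<And>S f a s t. local_diffeo A A S f \<Longrightarrow> \<forall>a\<in>S. \<forall>k. B k a f \<and> B k (f a) (inv_into S f) \<Longrightarrow>
      a \<in> S \<Longrightarrow> s \<in> Lifts a \<Longrightarrow> section_at A M pr (pr (f a)) t \<Longrightarrow> t (pr (f a)) = f a \<Longrightarrow>
      transports M pr (pr a) f s t \<Longrightarrow> \<exists>t'\<in>Lifts (f a). near M (pr (f a)) (\<lambda>y. t' y = t y)"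
    and G: "\<And>S f. (S, f) \<in> G \<longleftrightarrow>
      local_diffeo A A S f \<and> (\<forall>a\<in>S. \<forall>k. B k a f \<and> B k (f a) (inv_into S f)) \<and>
      (\<forall>k\<ge>k0. \<forall>a\<in>S. \<forall>s\<in>Lifts a. \<forall>s'\<in>Lifts (f a).
        transports M pr (pr a) f s s' \<longrightarrow> (R k a s \<longleftrightarrow> R k (f a) s'))"
  shows "algebraic_pseudogroup A G"
proof -
  \<comment> \<open>Only one implication is demanded, and for arbitrary image sections instead of
    admissible ones: in this form the condition is algebraic at a single point. The converse
    implication comes from the inverse of f.\<close>
  define C where "C k a f \<longleftrightarrow> B k a f \<and> (k0 \<le> k \<longrightarrow> (\<forall>s\<in>{s \<in> Lifts a. R k a s}. \<forall>t.
      section_at A M pr (pr (f a)) t \<and> t (pr (f a)) = f a \<and> transports M pr (pr a) f s t \<longrightarrow> R k (f a) t))"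
    for k a f
  have chart_ex: "\<exists>U \<omega> \<kappa>. adapted A M pr U \<omega> \<kappa> \<and> a \<in> U" if "a \<in> carrier A" for a
    using R[OF that, of 0] by blast
  have pr: "smooth_at A M a pr" if "a \<in> carrier A" for a
    using chart_ex[OF that] adapted_smooth_projection[OF A M] by blast
  have C: "algebraic_at A (max 1 k) a b (C k a)" for k a b
  proof (cases "a \<in> carrier A \<and> b \<in> carrier A")
    case False then show ?thesis by (intro algebraic_at_outside) blast
  next
    case True
    obtain U \<omega> \<kappa> where U: "adapted A M pr U \<omega> \<kappa>" "a \<in> U" using chart_ex True by blast
    obtain U' \<omega>' \<kappa>' P where U': "adapted A M pr U' \<omega>' \<kappa>'" "b \<in> U'"
      and P: "\<forall>p\<in>P. polynomial_fun (jet_vars k) p"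
      "\<forall>t. section_at A M pr (pr b) t \<and> t (pr b) = b \<longrightarrow>
        (R k b t \<longleftrightarrow> (\<forall>p\<in>P. p (jet_coords (pr ` U') \<kappa>' (snd \<circ> \<omega>') (pr b) t) = 0))"
      using R[of b k] True by blast
    have "algebraic_at A (max 1 k) a b (\<lambda>f. \<forall>t\<in>section_transport.image_sections A M pr a b s f. R k b t)"
      if s: "s \<in> {s \<in> Lifts a. R k a s}" for s
    proof -
      interpret section_transport A M pr U \<omega> \<kappa> a U' \<omega>' \<kappa>' b s
        by standard (use A M U U' Lifts[of s a] s in simp_all)
      show ?thesis
        by (rule algebraic_at_image[of P k "R k b"]) (use P in simp_all)
    qed
    then have 1: "algebraic_at A (max 1 k) a b (\<lambda>f. \<forall>s\<in>(if k0 \<le> k then {s \<in> Lifts a. R k a s} else {}).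
        \<forall>t\<in>section_transport.image_sections A M pr a b s f. R k b t)"
      by (intro algebraic_at_Ball) (auto split: if_splits)
    have im: "section_transport.image_sections A M pr a b s f =
        {t. section_at A M pr (pr b) t \<and> t (pr b) = b \<and> transports M pr (pr a) f s t}"
      if s: "s \<in> {s \<in> Lifts a. R k a s}" for s f
    proof -
      interpret section_transport A M pr U \<omega> \<kappa> a U' \<omega>' \<kappa>' b s
        by standard (use A M U U' Lifts[of s a] s in simp_all)
      show ?thesis by (rule image_sections_def)
    qed
    show ?thesis
      by (rule algebraic_at_cong[OF _ algebraic_at_conj[OF B 1]]) (auto simp: C_def im)
  qed
  \<comment> \<open>R is a system of polynomials in derivatives of t at one point, hence depends
    only on the germ of t.\<close>
  have R_cong: "R k b t \<longleftrightarrow> R k b t'"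
    if t: "section_at A M pr (pr b) t" "t (pr b) = b" and e: "near M (pr b) (\<lambda>y. t' y = t y)" for k b t t'
  proof -
    have b: "b \<in> carrier A" using t smooth_at_carrier(2) unfolding section_at_def by fastforce
    have "near M (pr b) (\<lambda>y. t y = t' y)" using e by (rule near_mono) simp
    then have t': "section_at A M pr (pr b) t'"
      using t(1) smooth_at_cong[OF M, of "pr b" t t'] near_mono[OF near_conj[OF M e], of "\<lambda>y. pr (t y) = y" "\<lambda>y. pr (t' y) = y"]
      unfolding section_at_def by auto
    have tb': "t' (pr b) = b" using near_point[OF e] t(2) by simp
    obtain U \<omega> \<kappa> P where U: "adapted A M pr U \<omega> \<kappa>" "b \<in> U"
      and "\<forall>p\<in>P. polynomial_fun (jet_vars k) p"
      and P: "\<forall>t. section_at A M pr (pr b) t \<and> t (pr b) = b \<longrightarrow>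
        (R k b t \<longleftrightarrow> (\<forall>p\<in>P. p (jet_coords (pr ` U) \<kappa> (snd \<circ> \<omega>) (pr b) t) = 0))"
      using R[OF b, of k] by (elim exE conjE) (rule that)
    have c: "chart M (pr ` U) \<kappa>" using U(1) unfolding adapted_def by blast
    have "jet_coords (pr ` U) \<kappa> (snd \<circ> \<omega>) (pr b) t' = jet_coords (pr ` U) \<kappa> (snd \<circ> \<omega>) (pr b) t"
      unfolding jet_coords_def using iter_deriv_near_cong[OF M c _ e, of _ "snd \<circ> \<omega>"] U(2) by simp
    then show ?thesis using P t t' tb' by simp
  qed
  have transports_back: "transports M pr (pr (f a)) (inv_into S f) t s"
    if S: "local_diffeo A A S f" "a \<in> S" and s: "section_at A M pr (pr a) s" "s (pr a) = a"
      and t: "section_at A M pr (pr (f a)) t" "t (pr (f a)) = f a" and tr: "transports M pr (pr a) f s t"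
    for S f a s t
  proof -
    have ca: "a \<in> carrier A" "f a \<in> carrier A"
      using smooth_at_carrier[OF local_diffeo_germs(1)[OF S]] by blast+
    obtain U \<omega> \<kappa> where U: "adapted A M pr U \<omega> \<kappa>" "a \<in> U" using chart_ex ca by blast
    obtain U' \<omega>' \<kappa>' where U': "adapted A M pr U' \<omega>' \<kappa>'" "f a \<in> U'" using chart_ex ca by blast
    interpret section_transport A M pr U \<omega> \<kappa> a U' \<omega>' \<kappa>' "f a" s
      by standard (use A M U U' s in simp_all)
    show ?thesis
      using transports_inverse[OF S refl, of t] t tr by (simp add: image_sections_def)
  qed
  show ?thesis
  proof (rule algebraic_pseudogroupI[OF A, of C])
    show "algebraic_at A (max 1 k) a b (C k a)" for k a b by (rule C)
    fix S f
    show "(S, f) \<in> G \<longleftrightarrow> local_diffeo A A S f \<and> (\<forall>a\<in>S. \<forall>k. C k a f \<and> C k (f a) (inv_into S f))"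
    proof
      assume g: "(S, f) \<in> G"
      then have l: "local_diffeo A A S f" and b: "\<forall>a\<in>S. \<forall>k. B k a f \<and> B k (f a) (inv_into S f)"
        and inv: "\<And>k a s s'. k0 \<le> k \<Longrightarrow> a \<in> S \<Longrightarrow> s \<in> Lifts a \<Longrightarrow> s' \<in> Lifts (f a) \<Longrightarrow>
          transports M pr (pr a) f s s' \<Longrightarrow> (R k a s \<longleftrightarrow> R k (f a) s')"
        using G by blast+
      let ?g = "inv_into S f"
      have li: "local_diffeo A A (f ` S) ?g" by (rule local_diffeo_inv[OF A l])
      have inj: "inj_on f S" using l unfolding local_diffeo_def by blast
      have gS: "?g ` f ` S = S" using inj by (simp add: image_image)
      have gg: "inv_into (f ` S) ?g p = f p" if "p \<in> S" for p
        using that inj inj_on_inv_into[of "f ` S" f S] inv_into_f_f[of ?g "f ` S" "f p"] by simp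
      have So: "mopen A S" using l unfolding local_diffeo_def by blast
      \<comment> \<open>Applying \<open>holonomic\<close> to the inverse requires B for the inverse
        of the inverse. That function agrees with f on S but may differ from it elsewhere, so B is
        transferred through equality of jets.\<close>
      have bi: "\<forall>b\<in>f ` S. \<forall>k. B k b ?g \<and> B k (?g b) (inv_into (f ` S) ?g)"
      proof (intro ballI allI conjI)
        fix c k assume "c \<in> f ` S"
        then obtain a where a: "a \<in> S" "c = f a" by blast
        show "B k c ?g" using b a by blast
        have d: "diffeo_at A a f" "diffeo_at A a (inv_into (f ` S) ?g)"
          unfolding diffeo_at_def using l a local_diffeo_inv[OF A li] gS by auto
        have "near A a (\<lambda>p. f p = inv_into (f ` S) ?g p)"
          by (rule near_mono[OF near_mopen[OF So a(1)]]) (simp add: gg)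
        from algebraic_at_jet[OF A B d(1) refl d(2) same_jet_near[OF A this], of k]
        show "B k (?g c) (inv_into (f ` S) ?g)" using b a inj by simp
      qed
      have tr_cong: "transports M pr (pr a) f s t'"
        if "transports M pr (pr a) f s t" "near M (pr c) (\<lambda>y. t' y = t y)" "f a = c"
          "section_at A M pr (pr a) s" "s (pr a) = a" "smooth_at A A a f" for a c f s t t'
      proof -
        have "smooth_at M A (pr a) (f \<circ> s)"
          using smooth_at_compose[OF M A A, of "pr a" s f] that unfolding section_at_def by simp
        then have "smooth_at M M (pr a) (pr \<circ> (f \<circ> s))"
          using smooth_at_compose[OF M A M, of "pr a" "f \<circ> s" pr] pr[of c]
            smooth_at_carrier(2)[OF that(6)] that(3,5) by simp
        then have "near M (pr a) (\<lambda>y. t' ((pr \<circ> (f \<circ> s)) y) = t ((pr \<circ> (f \<circ> s)) y))"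
          using smooth_at_vimage[OF M M, of "pr a" "pr \<circ> (f \<circ> s)"] that(2,3,5) by simp
        from near_conj[OF M this that(1)[unfolded transports_def]]
        show ?thesis unfolding transports_def by (rule near_mono) simp
      qed
      have "C k a f \<and> C k (f a) ?g" if a: "a \<in> S" for a k
      proof
        have ga: "?g (f a) = a" using a inj by simp
        show "C k a f"
          unfolding C_def
        proof (intro conjI impI ballI allI)
          show "B k a f" using b a by blast
          fix s t assume k: "k0 \<le> k" and s: "s \<in> {s \<in> Lifts a. R k a s}"
            and t: "section_at A M pr (pr (f a)) t \<and> t (pr (f a)) = f a \<and> transports M pr (pr a) f s t"
          obtain t' where t': "t' \<in> Lifts (f a)" "near M (pr (f a)) (\<lambda>y. t' y = t y)"
            using holonomic[OF l b a, of s t] s t by blast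
          have "transports M pr (pr a) f s t'"
            using tr_cong[OF _ t'(2) refl _ _ local_diffeo_germs(1)[OF l a]] s t Lifts[of s a] by blast
          then have "R k (f a) t'" using inv[OF k a _ t'(1)] s by blast
          then show "R k (f a) t" using R_cong[OF _ _ t'(2)] t by blast
        qed
        show "C k (f a) ?g"
          unfolding C_def
        proof (intro conjI impI ballI allI)
          show "B k (f a) ?g" using b a by blast
          fix s t assume k: "k0 \<le> k" and s: "s \<in> {s \<in> Lifts (f a). R k (f a) s}"
            and t: "section_at A M pr (pr (?g (f a))) t \<and> t (pr (?g (f a))) = ?g (f a) \<and>
              transports M pr (pr (f a)) ?g s t"
          have fa: "f a \<in> f ` S" using a by blast
          obtain t' where t': "t' \<in> Lifts (?g (f a))" "near M (pr (?g (f a))) (\<lambda>y. t' y = t y)"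
            using holonomic[OF li bi fa, of s t] s t by blast
          have s': "section_at A M pr (pr (f a)) s" "s (pr (f a)) = f a" using Lifts[of s "f a"] s by blast+
          have tr: "transports M pr (pr (f a)) ?g s t'"
            using tr_cong[OF _ t'(2) refl s' local_diffeo_germs(1)[OF li fa]] t by blast
          have tL: "section_at A M pr (pr (?g (f a))) t'" "t' (pr (?g (f a))) = ?g (f a)"
            using Lifts[OF t'(1)] by blast+
          \<comment> \<open>The assumed invariance concerns f, not its inverse. The admissible t' is
            therefore carried back to s by f, and the equivalence is read from right to
            left.\<close>
          have "transports M pr (pr (?g (f a))) (inv_into (f ` S) ?g) t' s"
            by (rule transports_back[OF li fa s' tL tr])
          then have "near M (pr a) (\<lambda>y. inv_into (f ` S) ?g (t' y) = s (pr (inv_into (f ` S) ?g (t' y))))"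
            unfolding transports_def ga .
          moreover have "near M (pr a) (\<lambda>y. t' y \<in> S)"
            using smooth_at_vimage[OF M A, of "pr a" t' "\<lambda>p. p \<in> S"] tL near_mopen[OF So a]
            unfolding ga section_at_def by simp
          ultimately have "near M (pr a) (\<lambda>y. inv_into (f ` S) ?g (t' y) = s (pr (inv_into (f ` S) ?g (t' y))) \<and> t' y \<in> S)"
            by (rule near_conj[OF M])
          then have "transports M pr (pr a) f t' s"
            unfolding transports_def by (rule near_mono) (metis gg)
          then have "R k a t'" using inv[OF k a, of t' s] t'(1) s ga by simp
          then show "R k (?g (f a)) t" using R_cong[OF _ _ t'(2)] t ga by simp
        qed
      qed
      then show "local_diffeo A A S f \<and> (\<forall>a\<in>S. \<forall>k. C k a f \<and> C k (f a) (inv_into S f))"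
        using l by blast
    next
      assume h: "local_diffeo A A S f \<and> (\<forall>a\<in>S. \<forall>k. C k a f \<and> C k (f a) (inv_into S f))"
      then have l: "local_diffeo A A S f" and c: "\<And>a k. a \<in> S \<Longrightarrow> C k a f \<and> C k (f a) (inv_into S f)"
        by blast+
      have "R k a s \<longleftrightarrow> R k (f a) s'"
        if k: "k0 \<le> k" and a: "a \<in> S" and s: "s \<in> Lifts a" and s': "s' \<in> Lifts (f a)"
          and tr: "transports M pr (pr a) f s s'" for k a s s'
      proof
        assume "R k a s"
        then show "R k (f a) s'"
          using c[OF a, of k] k s tr Lifts[OF s'] unfolding C_def by blast
      next
        \<comment> \<open>The inverse carries s' back to s, and the half of C that concerns the
          inverse applies.\<close>
        assume "R k (f a) s'"
        moreover have "transports M pr (pr (f a)) (inv_into S f) s' s"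
          using transports_back[OF l a] Lifts[OF s] Lifts[OF s'] tr by blast
        moreover have "inv_into S f (f a) = a" using local_diffeo_germs(5)[OF l a] .
        ultimately show "R k a s"
          using c[OF a, of k] k s' Lifts[OF s] unfolding C_def by auto
      qed
      moreover have "\<forall>a\<in>S. \<forall>k. B k a f \<and> B k (f a) (inv_into S f)" using c unfolding C_def by blast
      ultimately show "(S, f) \<in> G" unfolding G using l by blast
    qed
  qed
qed

section \<open>Bundle coordinates and the case of point transformations\<close>

section \<open>Point symmetries\<close>

lemma local_section_iff:
  assumes M: "smooth_atlas M"
  shows "local_section E M \<pi> x s \<longleftrightarrow> section_at E M \<pi> x s"
proof
  assume "local_section E M \<pi> x s"
  then show "section_at E M \<pi> x s"
    unfolding local_section_def section_at_def smooth_at_def near_def by blast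
next
  assume "section_at E M \<pi> x s"
  then obtain S V where S: "mopen M S" "x \<in> S" "smooth_map M E S s"
    and V: "mopen M V" "x \<in> V" "\<forall>y\<in>V. \<pi> (s y) = y"
    unfolding section_at_def smooth_at_def near_def by blast
  have o: "mopen M (S \<inter> V)" by (rule mopen_Int[OF M S(1) V(1)])
  have "smooth_map M E (S \<inter> V) s" by (rule smooth_map_subset[OF M S(3) o]) blast
  then show "local_section E M \<pi> x s"
    unfolding local_section_def using o S(2) V(2,3) by blast
qed

lemma adapted_chart_iff: "adapted_chart E M \<pi> U \<psi> \<kappa> \<longleftrightarrow> adapted E M \<pi> U \<psi> \<kappa>"
  unfolding adapted_chart_def adapted_def ..

text \<open>A local trivialisation followed by a product of charts of base and fibre; the first
  component is then the base chart after the projection.\<close>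

lemma smooth_bundle_adapted_chart:
  fixes E :: "('e, (real^'n) \<times> (real^'m)) atlas" and F :: "('f, real^'m) atlas"
  assumes "smooth_bundle E M F \<pi>" "e \<in> carrier E"
  obtains U \<psi> \<kappa> where "adapted_chart E M \<pi> U \<psi> \<kappa>" "e \<in> U"
proof -
  have E: "smooth_atlas E" and M: "smooth_atlas M" and F: "smooth_atlas F"
    using assms(1) smooth_manifold_imp_smooth_atlas unfolding smooth_bundle_def by blast+
  have x: "\<pi> e \<in> carrier M" using assms unfolding smooth_bundle_def by blast
  have "\<forall>x\<in>carrier M. \<exists>V \<Phi>. mopen M V \<and> x \<in> V \<and>
        local_diffeo E (prod_atlas M F) (carrier E \<inter> \<pi> -` V) (\<lambda>e. (\<pi> e, \<Phi> e)) \<and>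
        (\<lambda>e. (\<pi> e, \<Phi> e)) ` (carrier E \<inter> \<pi> -` V) = V \<times> carrier F"
    using assms(1) unfolding smooth_bundle_def by (elim conjE)
  from bspec[OF this x] obtain V \<Phi> where V: "mopen M V" "\<pi> e \<in> V"
    "local_diffeo E (prod_atlas M F) (carrier E \<inter> \<pi> -` V) (\<lambda>e. (\<pi> e, \<Phi> e))"
    "(\<lambda>e. (\<pi> e, \<Phi> e)) ` (carrier E \<inter> \<pi> -` V) = V \<times> carrier F" by (elim exE conjE)
  define D where "D = carrier E \<inter> \<pi> -` V"
  define h where "h = (\<lambda>e. (\<pi> e, \<Phi> e))"
  have h: "mopen E D" "smooth_map E (prod_atlas M F) D h" "inj_on h D" "mopen (prod_atlas M F) (h ` D)"
    "smooth_map (prod_atlas M F) E (h ` D) (inv_into D h)" "h ` D = V \<times> carrier F"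
    using V(3,4) unfolding local_diffeo_def D_def h_def by blast+
  have eD: "e \<in> D" using assms(2) V(2) by (simp add: D_def)
  have "h e \<in> V \<times> carrier F" using h(6) eD by blast
  then have \<Phi>e: "\<Phi> e \<in> carrier F" by (simp add: h_def)
  obtain V1 \<kappa> where V1: "(V1, \<kappa>) \<in> M" "chart M V1 \<kappa>" "\<pi> e \<in> V1" by (rule carrier_chart[OF M x])
  obtain W1 \<xi> where W1: "(W1, \<xi>) \<in> F" "chart F W1 \<xi>" "\<Phi> e \<in> W1" by (rule carrier_chart[OF F \<Phi>e])
  define T where "T = V1 \<times> W1"
  define mp where "mp = map_prod \<kappa> \<xi>"
  have T: "(T, mp) \<in> prod_atlas M F" unfolding prod_atlas_def T_def mp_def using V1(1) W1(1) by blast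
  have mp: "inj_on mp T" unfolding mp_def T_def
    using chartD(2)[OF V1(2)] chartD(2)[OF W1(2)] by (rule map_prod_inj_on)
  define U where "U = D \<inter> h -` T"
  define \<psi> where "\<psi> = mp \<circ> h"
  have eU: "e \<in> U" using eD V1(3) W1(3) by (simp add: U_def h_def T_def)
  \<comment> \<open>The trivialisation is onto a product, so over each base point of V there is a
    point with fibre component \<Phi> e. Hence the projection of U is the open set on which the base
    chart is restricted.\<close>
  have "\<pi> ` U = V \<inter> V1"
  proof
    show "\<pi> ` U \<subseteq> V \<inter> V1" by (auto simp: U_def D_def h_def T_def)
    show "V \<inter> V1 \<subseteq> \<pi> ` U"
    proof
      fix y assume y: "y \<in> V \<inter> V1"
      then have "(y, \<Phi> e) \<in> h ` D" using h(6) \<Phi>e by simp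
      then obtain d where "d \<in> D" "h d = (y, \<Phi> e)" by (metis imageE)
      then show "y \<in> \<pi> ` U" using y W1(3) by (auto simp: U_def h_def T_def)
    qed
  qed
  then have base: "chart M (\<pi> ` U) \<kappa>"
    using local_diffeo_subset[OF M smooth_atlas_euclidean V1(2), of "V \<inter> V1"]
      mopen_Int[OF M V(1) chartD(1)[OF V1(2)]] by simp
  have mU: "mopen E U"
  proof (rule mopenI)
    show "U \<subseteq> carrier E" by (auto simp: U_def D_def)
    show "open (\<psi>' ` (U' \<inter> U))" if "(U', \<psi>') \<in> E" for U' \<psi>'
      using smooth_map_preimage[OF h(2) that T] by (simp add: U_def Int_assoc)
  qed
  have idi: "inv_into UNIV id = (id :: (real^'n) \<times> (real^'m) \<Rightarrow> _)" by (simp add: inv_into_def id_def fun_eq_iff)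
  have s1: "smooth_map E euclidean_atlas U \<psi>"
  proof (rule smooth_mapI)
    fix U' \<psi>' and V' :: "((real^'n) \<times> (real^'m)) set" and \<eta>
    assume U': "(U', \<psi>') \<in> E" and V': "(V', \<eta>) \<in> euclidean_atlas"
    have V'': "V' = UNIV" "\<eta> = id" using V' by (simp_all add: euclidean_atlas_def)
    show "open (\<psi>' ` (U' \<inter> U \<inter> \<psi> -` V'))" using mopen_image[OF mU U'] by (simp add: V'')
    show "smooth_near (\<psi>' p) (\<eta> \<circ> \<psi> \<circ> inv_into U' \<psi>')" if "p \<in> U'" "p \<in> U" for p
      using smooth_map_near[OF h(2) U' T, of p] that by (simp add: V'' U_def \<psi>_def)
  qed simp
  have im: "\<psi> ` U = mp ` (T \<inter> h ` D)" by (auto simp: \<psi>_def U_def)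
  have o: "open (\<psi> ` U)" unfolding im by (rule mopen_image[OF h(4) T])
  have inj: "inj_on \<psi> U"
    unfolding \<psi>_def using h(3) mp by (auto simp: inj_on_def U_def)
  \<comment> \<open>The inverse of \<psi> is the inverse of the product chart followed by the
    inverse trivialisation; its smoothness is read off in the single product chart
    \<open>(T, mp)\<close>.\<close>
  have inv: "inv_into U \<psi> z = inv_into D h (inv_into T mp z) \<and> inv_into T mp z \<in> T \<inter> h ` D \<and> mp (inv_into T mp z) = z"
    if z: "z \<in> \<psi> ` U" for z
  proof -
    obtain d where d: "d \<in> U" "z = \<psi> d" using z by blast
    then have "d \<in> D" "h d \<in> T" by (simp_all add: U_def)
    moreover have "inv_into T mp z = h d" using d(2) \<open>h d \<in> T\<close> mp by (simp add: \<psi>_def)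
    moreover have "inv_into U \<psi> z = d" using inv_into_f_f[OF inj d(1)] d(2) by simp
    ultimately show ?thesis using d h(3) by (simp add: \<psi>_def)
  qed
  have s2: "smooth_map euclidean_atlas E (\<psi> ` U) (inv_into U \<psi>)"
  proof (rule smooth_mapI)
    show "inv_into U \<psi> ` \<psi> ` U \<subseteq> carrier E" using inj mopen_subset[OF mU] by (auto simp: image_image)
    fix U' and \<psi>' :: "(real^'n) \<times> (real^'m) \<Rightarrow> (real^'n) \<times> (real^'m)" and V' \<eta>
    assume U': "(U', \<psi>') \<in> euclidean_atlas" and V': "(V', \<eta>) \<in> E"
    have U'': "U' = UNIV" "\<psi>' = id" using U' by (simp_all add: euclidean_atlas_def)
    let ?O = "mp ` (T \<inter> h ` D \<inter> inv_into D h -` V')"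
    have O: "open ?O" by (rule smooth_map_preimage[OF h(5) T V'])
    have "\<psi> ` U \<inter> inv_into U \<psi> -` V' = ?O"
    proof
      show "\<psi> ` U \<inter> inv_into U \<psi> -` V' \<subseteq> ?O"
      proof
        fix z assume z: "z \<in> \<psi> ` U \<inter> inv_into U \<psi> -` V'"
        then have "inv_into U \<psi> z \<in> V'" by simp
        then have "inv_into T mp z \<in> T \<inter> h ` D \<inter> inv_into D h -` V'" using inv[of z] z by simp
        moreover have "z = mp (inv_into T mp z)" using inv[of z] z by simp
        ultimately show "z \<in> ?O" by (rule rev_image_eqI)
      qed
      show "?O \<subseteq> \<psi> ` U \<inter> inv_into U \<psi> -` V'"
      proof
        fix z assume "z \<in> ?O"
        then obtain d where d: "d \<in> D" "h d \<in> T" "inv_into D h (h d) \<in> V'" "z = mp (h d)" by blast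
        then have "z \<in> \<psi> ` U" by (auto simp: \<psi>_def U_def)
        moreover have "inv_into U \<psi> z = d"
          using inv_into_f_f[OF inj, of d] d by (simp add: \<psi>_def U_def)
        ultimately show "z \<in> \<psi> ` U \<inter> inv_into U \<psi> -` V'" using d h(3) by simp
      qed
    qed
    then show "open (\<psi>' ` (U' \<inter> \<psi> ` U \<inter> inv_into U \<psi> -` V'))" using O by (simp add: U'')
    fix z assume z: "z \<in> \<psi> ` U" "inv_into U \<psi> z \<in> V'"
    have n: "smooth_near (mp (inv_into T mp z)) (\<eta> \<circ> inv_into D h \<circ> inv_into T mp)"
      using inv[OF z(1)] z(2) by (intro smooth_map_near[OF h(5) T V']) auto
    have "smooth_near z (\<eta> \<circ> inv_into U \<psi>)"
    proof (rule smooth_near_cong)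
      show "smooth_near z (\<eta> \<circ> inv_into D h \<circ> inv_into T mp)" using n inv[OF z(1)] by simp
      show "eventually (\<lambda>y. (\<eta> \<circ> inv_into D h \<circ> inv_into T mp) y = (\<eta> \<circ> inv_into U \<psi>) y) (nhds z)"
        using eventually_nhds_in_open[OF o z(1)] by eventually_elim (simp add: inv)
    qed
    then show "smooth_near (\<psi>' z) (\<eta> \<circ> inv_into U \<psi> \<circ> inv_into U' \<psi>')" by (simp add: U'' idi)
  qed
  have "chart E U \<psi>"
    unfolding local_diffeo_def using mU s1 inj o s2 by (simp add: mopen_euclidean)
  moreover have "\<forall>e\<in>U. fst (\<psi> e) = \<kappa> (\<pi> e)" by (simp add: \<psi>_def mp_def h_def)
  ultimately have "adapted_chart E M \<pi> U \<psi> \<kappa>" unfolding adapted_chart_def using base by blast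
  then show ?thesis using eU by (rule that)
qed

text \<open>The instance in which all sections are admissible, no further condition is imposed and
  the equation is tested from order 0 on. An image section is its own admissible
  representative.\<close>

theorem algebraic_point_symmetries:
  fixes E :: "('e, (real^'n) \<times> (real^'m)) atlas" and F :: "('f, real^'m) atlas"
  assumes E_bundle: "smooth_bundle E M F \<pi>" and eq: "algebraic_equation E M \<pi> Q"
  shows "algebraic_pseudogroup E (point_symmetries E M \<pi> Q)"
proof -
  have E: "smooth_atlas E" and M: "smooth_atlas M"
    using E_bundle smooth_manifold_imp_smooth_atlas unfolding smooth_bundle_def by blast+
  define Lifts where "Lifts a = {s. section_at E M \<pi> (\<pi> a) s \<and> s (\<pi> a) = a}" for a
  show ?thesis
  proof (rule algebraic_lifted_symmetries[OF E M, where R = "\<lambda>k a s. jet M E k (\<pi> a) s \<in> Q k"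
        and Lifts = Lifts and B = "\<lambda>k a f. True" and ?k0.0 = 0])
    fix k b assume "b \<in> carrier E"
    then obtain U \<psi> \<kappa> where U: "adapted_chart E M \<pi> U \<psi> \<kappa>" "b \<in> U"
      by (rule smooth_bundle_adapted_chart[OF E_bundle])
    obtain P where "\<forall>p\<in>P. polynomial_fun (jet_vars k) p"
      "\<forall>s. local_section E M \<pi> (\<pi> b) s \<and> s (\<pi> b) = b \<longrightarrow>
        (jet M E k (\<pi> b) s \<in> Q k \<longleftrightarrow>
          (\<forall>p\<in>P. p (jet_coords (\<pi> ` U) \<kappa> (snd \<circ> \<psi>) (\<pi> b) s) = 0))"
      using eq U unfolding algebraic_equation_def by blast
    then show "\<exists>U \<omega> \<kappa> P. adapted E M \<pi> U \<omega> \<kappa> \<and> b \<in> U \<and> (\<forall>p\<in>P. polynomial_fun (jet_vars k) p) \<and>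
        (\<forall>t. section_at E M \<pi> (\<pi> b) t \<and> t (\<pi> b) = b \<longrightarrow>
          (jet M E k (\<pi> b) t \<in> Q k \<longleftrightarrow>
           (\<forall>p\<in>P. p (jet_coords (\<pi> ` U) \<kappa> (snd \<circ> \<omega>) (\<pi> b) t) = 0)))"
      using U unfolding local_section_iff[OF M] adapted_chart_iff by blast
  next
    fix S f
    show "(S, f) \<in> point_symmetries E M \<pi> Q \<longleftrightarrow> local_diffeo E E S f \<and> (\<forall>a\<in>S. \<forall>k. True \<and> True) \<and>
       (\<forall>k\<ge>0. \<forall>a\<in>S. \<forall>s\<in>Lifts a. \<forall>s'\<in>Lifts (f a). transports M \<pi> (\<pi> a) f s s' \<longrightarrow>
         (jet M E k (\<pi> a) s \<in> Q k \<longleftrightarrow> jet M E k (\<pi> (f a)) s' \<in> Q k))" (is "?l \<longleftrightarrow> ?r")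
    proof
      assume l: ?l
      then have d: "local_diffeo E E S f" and q: "\<And>k \<theta> \<theta>'. point_prolongation E M \<pi> S f k \<theta> \<theta>' \<Longrightarrow> (\<theta> \<in> Q k \<longleftrightarrow> \<theta>' \<in> Q k)"
        unfolding point_symmetries_def by blast+
      have "jet M E k (\<pi> a) s \<in> Q k \<longleftrightarrow> jet M E k (\<pi> (f a)) s' \<in> Q k"
        if a: "a \<in> S" and s: "s \<in> Lifts a" and s': "s' \<in> Lifts (f a)" and t: "transports M \<pi> (\<pi> a) f s s'"
        for k a s s'
      proof (rule q)
        \<comment> \<open>The prolongation relation also asks that the graph of s stay in the domain
          of f, which holds near the base point because S is open.\<close>
        have "near M (\<pi> a) (\<lambda>y. s y \<in> S)"
          using smooth_at_vimage[OF M E, of "\<pi> a" s "\<lambda>p. p \<in> S"] s near_mopen[of E S a] a d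
          unfolding Lifts_def section_at_def local_diffeo_def by simp
        from near_conj[OF M this t[unfolded transports_def]]
        show "point_prolongation E M \<pi> S f k (jet M E k (\<pi> a) s) (jet M E k (\<pi> (f a)) s')"
          unfolding point_prolongation_def local_section_iff[OF M] near_def
          using s s' unfolding Lifts_def by (intro exI[of _ "\<pi> a"] exI[of _ s] exI[of _ "\<pi> (f a)"] exI[of _ s']) auto
      qed
      then show ?r using d by blast
    next
      assume r: ?r
      have "\<theta> \<in> Q k \<longleftrightarrow> \<theta>' \<in> Q k" if prol: "point_prolongation E M \<pi> S f k \<theta> \<theta>'" for k \<theta> \<theta>'
      proof -
        obtain x s x' s' V where h: "section_at E M \<pi> x s" "\<theta> = jet M E k x s" "section_at E M \<pi> x' s'"
          "\<theta>' = jet M E k x' s'" "x' = \<pi> (f (s x))" "mopen M V" "x \<in> V"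
          "\<forall>y\<in>V. s y \<in> S \<and> f (s y) = s' (\<pi> (f (s y)))"
          using prol unfolding point_prolongation_def local_section_iff[OF M] by blast
        have x: "\<pi> (s x) = x" using h(1) near_point unfolding section_at_def by fast
        have "s \<in> Lifts (s x)" "s' \<in> Lifts (f (s x))"
          unfolding Lifts_def using h x by auto
        moreover have "transports M \<pi> (\<pi> (s x)) f s s'"
          unfolding transports_def near_def x using h(6-8) by blast
        moreover have "s x \<in> S" using h(7,8) by blast
        ultimately show ?thesis using r h(2,4,5) x by force
      qed
      then show ?l unfolding point_symmetries_def using r by blast
    qed
  next
    fix S f a s t
    assume t: "section_at E M \<pi> (\<pi> (f a)) t" "t (\<pi> (f a)) = f a"
    then have "near M (\<pi> (f a)) (\<lambda>y. t y = t y)" unfolding section_at_def by (blast intro: near_mono)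
    then show "\<exists>t'\<in>Lifts (f a). near M (\<pi> (f a)) (\<lambda>y. t' y = t y)" using t unfolding Lifts_def by blast
  qed (simp_all add: Lifts_def algebraic_at_True)
qed

section \<open>Coordinates and smooth structure on the space of 1-jets\<close>

section \<open>The manifold of 1-jets\<close>

lemma same_jet_sym:
  assumes "same_jet A B k p f g"
  shows "same_jet A B k p g f"
proof (rule same_jetI)
  show "g p = f p" using same_jet_value[OF assms] by simp
qed (rule same_jetD[OF assms, symmetric], simp_all add: same_jet_value[OF assms])

lemma same_jet_trans:
  assumes "same_jet A B k p f g" "same_jet A B k p g h"
  shows "same_jet A B k p f h"
proof (rule same_jetI)
  show "f p = h p" using same_jet_value[OF assms(1)] same_jet_value[OF assms(2)] by simp
qed (rule trans[OF same_jetD[OF assms(1)] same_jetD[OF assms(2)]], simp_all add: same_jet_value[OF assms(1)])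

lemma jet_eqI:
  assumes "same_jet A B k p f g"
  shows "jet A B k p f = jet A B k p g"
  unfolding jet_def using same_jet_trans[OF assms] same_jet_trans[OF same_jet_sym[OF assms]] by blast

lemma smooth_near_vec_nth: "smooth_near x f \<Longrightarrow> smooth_near x (\<lambda>y. f y $ i)"
  by (rule smooth_near_linear_compose[OF bounded_linear_vec_nth])

lemma smooth_near_vec_lambda:
  fixes f :: "'i::finite \<Rightarrow> 'v::euclidean_space \<Rightarrow> 'w::euclidean_space"
  assumes "\<And>i. smooth_near x (f i)"
  shows "smooth_near x (\<lambda>y. \<chi> i. f i y)"
proof -
  have "linear (\<lambda>w :: 'w. axis i w)" for i :: 'i
    by (rule linearI) (auto simp: axis_def vec_eq_iff)
  then have l: "bounded_linear (\<lambda>w :: 'w. axis i w)" for i :: 'i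
    by (simp add: linear_conv_bounded_linear)
  have e: "(\<chi> i. f i y) = (\<Sum>i\<in>UNIV. axis i (f i y))" for y
    by (simp add: vec_eq_iff axis_def sum.delta)
  show ?thesis
    unfolding e by (rule smooth_near_sum) (rule smooth_near_linear_compose[OF l assms])
qed

lemma axis_1_Basis [simp]: "axis i (1::real) \<in> Basis"
  by (simp add: axis_in_Basis_iff)

lemma Basis_realvecE:
  assumes "(e :: real^'n) \<in> Basis"
  obtains i where "e = axis i 1"
  using assms by (auto simp: Basis_vec_def)

lemma dd_vec:
  fixes f :: "real^'n \<Rightarrow> 'w::euclidean_space"
  assumes "f differentiable (at x)"
  shows "dd v f x = (\<Sum>i\<in>UNIV. (v $ i) *\<^sub>R dd (axis i 1) f x)"
proof -
  have l: "linear (\<lambda>v. dd v f x)"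
    using has_derivative_dd[OF assms] has_derivative_linear by blast
  have "v = (\<Sum>i\<in>UNIV. (v $ i) *\<^sub>R axis i 1)"
    using basis_expansion[of v] by (simp add: scalar_mult_eq_scaleR)
  then have "dd v f x = dd (\<Sum>i\<in>UNIV. (v $ i) *\<^sub>R axis i 1) f x" by simp
  also have "\<dots> = (\<Sum>i\<in>UNIV. (v $ i) *\<^sub>R dd (axis i 1) f x)"
    using linear_sum[OF l, of "\<lambda>i. (v $ i) *\<^sub>R axis i 1" UNIV] by (simp add: linear_cmul[OF l])
  finally show ?thesis .
qed

text \<open>Expanding the direction in the basis leaves smooth coefficients. The directions in
  \<open>prolonged_transition\<close> vary with the point in this way.\<close>

lemma smooth_near_dd_variable:
  assumes "smooth_near x v" "smooth_near x f" "smooth_near (f x) g"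
  shows "smooth_near x (\<lambda>y. dd (v y) g (f y))"
proof (rule smooth_near_cong)
  show "smooth_near x (\<lambda>y. \<Sum>b\<in>Basis. (v y \<bullet> b) *\<^sub>R dd b g (f y))"
    by (rule smooth_near_sum, rule smooth_near_scaleR, rule smooth_near_inner, rule assms(1),
        rule smooth_near_compose[OF assms(2)], rule smooth_near_dd, assumption, rule assms(3))
  have "eventually (\<lambda>y. smooth_near (f y) g) (nhds x)"
    by (rule eventually_compose_filterlim[OF smooth_near_eventually[OF assms(3)] smooth_near_filterlim[OF assms(2)]])
  then show "eventually (\<lambda>y. (\<Sum>b\<in>Basis. (v y \<bullet> b) *\<^sub>R dd b g (f y)) = dd (v y) g (f y)) (nhds x)"
    by eventually_elim (rule dd_linear_combination[symmetric], rule smooth_near_differentiable)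
qed

lemma dd_Pair:
  assumes "smooth_near x f" "smooth_near x g"
  shows "dd v (\<lambda>y. (f y, g y)) x = (dd v f x, dd v g x)"
  by (rule dd_eqI[where f' = "\<lambda>v. (dd v f x, dd v g x)"])
    (intro has_derivative_Pair has_derivative_dd smooth_near_differentiable assms)

lemma dd_fst: "smooth_near x f \<Longrightarrow> dd v (\<lambda>y. fst (f y)) x = fst (dd v f x)"
  by (rule dd_linear_compose[OF bounded_linear_fst smooth_near_differentiable])

lemma dd_snd: "smooth_near x f \<Longrightarrow> dd v (\<lambda>y. snd (f y)) x = snd (dd v f x)"
  by (rule dd_linear_compose[OF bounded_linear_snd smooth_near_differentiable])

lemma dd_ident: "dd v (\<lambda>y. y) x = v"
  by (rule dd_eqI[where f' = "\<lambda>v. v"]) simp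

locale jet_bundle =
  fixes E :: "('e, (real^'n) \<times> (real^'m)) atlas" and M :: "('b, real^'n) atlas"
    and F :: "('f, real^'m) atlas" and \<pi> :: "'e \<Rightarrow> 'b"
  assumes E_bundle: "smooth_bundle E M F \<pi>"
begin

lemma E: "smooth_atlas E" and M: "smooth_atlas M"
  using E_bundle smooth_manifold_imp_smooth_atlas unfolding smooth_bundle_def by blast+

definition "J x s = jet M E 1 x s"
abbreviation "bundle_chart U \<psi> \<kappa> \<equiv> adapted_chart E M \<pi> U \<psi> \<kappa>"
abbreviation "sect x s \<equiv> section_at E M \<pi> x s"
abbreviation "dom1 U \<equiv> jet1_domain E M \<pi> U"
abbreviation "J1 \<equiv> jet1_atlas E M \<pi>"

definition u_loc where "u_loc U \<psi> \<kappa> s = snd \<circ> \<psi> \<circ> s \<circ> inv_into (\<pi> ` U) \<kappa>"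

lemma bundle_chartD:
  assumes "bundle_chart U \<psi> \<kappa>"
  shows "chart E U \<psi>" "chart M (\<pi> ` U) \<kappa>" "e \<in> U \<Longrightarrow> fst (\<psi> e) = \<kappa> (\<pi> e)"
  using assms unfolding adapted_chart_def by blast+

lemma sectD:
  assumes "sect x s"
  shows "smooth_at M E x s" "\<pi> (s x) = x" "near M x (\<lambda>y. \<pi> (s y) = y)" "near M x (\<lambda>y. sect y s)"
proof -
  show s: "smooth_at M E x s" and n: "near M x (\<lambda>y. \<pi> (s y) = y)"
    using assms unfolding section_at_def by blast+
  show "\<pi> (s x) = x" using near_point[OF n] .
  show "near M x (\<lambda>y. sect y s)"
    unfolding section_at_def by (rule near_conj[OF M near_smooth_at[OF s] near_near[OF n]])
qed

lemma sect_base: "sect x s \<Longrightarrow> s x \<in> U \<Longrightarrow> x \<in> \<pi> ` U"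
  using sectD(2)[of x s] by (metis image_eqI)

lemma sect_near_domain:
  assumes "bundle_chart U \<psi> \<kappa>" "sect x s" "s x \<in> U"
  shows "near M x (\<lambda>y. y \<in> \<pi> ` U \<and> sect y s \<and> s y \<in> U)"
proof -
  have "near M x (\<lambda>y. s y \<in> U)"
    using smooth_at_vimage[OF M E sectD(1)[OF assms(2)], of "\<lambda>p. p \<in> U"]
      near_mopen[OF chartD(1)[OF bundle_chartD(1)[OF assms(1)]] assms(3)] by simp
  then show ?thesis
    by (intro near_conj[OF M] near_mopen[OF chartD(1)[OF bundle_chartD(2)[OF assms(1)]]]
        sectD(4)[OF assms(2)] sect_base[OF assms(2,3)])
qed

lemma base_near:
  assumes "bundle_chart U \<psi> \<kappa>" "x \<in> \<pi> ` U"
  shows "near M x P \<longleftrightarrow> eventually (\<lambda>z. P (inv_into (\<pi> ` U) \<kappa> z)) (nhds (\<kappa> x))"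
  by (rule near_chart[OF M bundle_chartD(2)[OF assms(1)] assms(2)])

lemma base_inv:
  assumes "bundle_chart U \<psi> \<kappa>"
  shows "x \<in> \<pi> ` U \<Longrightarrow> inv_into (\<pi> ` U) \<kappa> (\<kappa> x) = x"
    "x \<in> \<pi> ` U \<Longrightarrow> eventually (\<lambda>z. \<kappa> (inv_into (\<pi> ` U) \<kappa> z) = z) (nhds (\<kappa> x))"
proof -
  show "inv_into (\<pi> ` U) \<kappa> (\<kappa> x) = x" if "x \<in> \<pi> ` U"
    using chartD(2)[OF bundle_chartD(2)[OF assms]] that by simp
  show "eventually (\<lambda>z. \<kappa> (inv_into (\<pi> ` U) \<kappa> z) = z) (nhds (\<kappa> x))" if "x \<in> \<pi> ` U"
    using eventually_chart[OF bundle_chartD(2)[OF assms] that] by eventually_elim simp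
qed

lemma loc_smooth:
  assumes "bundle_chart U \<psi> \<kappa>" "smooth_at M E x s" "s x \<in> U" "x \<in> \<pi> ` U"
  shows "smooth_near (\<kappa> x) (\<psi> \<circ> s \<circ> inv_into (\<pi> ` U) \<kappa>)" "smooth_near (\<kappa> x) (u_loc U \<psi> \<kappa> s)"
proof -
  show 1: "smooth_near (\<kappa> x) (\<psi> \<circ> s \<circ> inv_into (\<pi> ` U) \<kappa>)"
    by (rule smooth_at_local[OF M E bundle_chartD(2,1)[OF assms(1)] assms(4,3,2)])
  show "smooth_near (\<kappa> x) (u_loc U \<psi> \<kappa> s)"
    using smooth_near_snd[OF 1] by (simp add: u_loc_def comp_def)
qed

lemma u_loc_value: "bundle_chart U \<psi> \<kappa> \<Longrightarrow> x \<in> \<pi> ` U \<Longrightarrow> u_loc U \<psi> \<kappa> s (\<kappa> x) = snd (\<psi> (s x))"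
  by (simp add: u_loc_def base_inv(1))

lemma dd_u_loc:
  assumes "bundle_chart U \<psi> \<kappa>" "smooth_at M E x s" "s x \<in> U" "x \<in> \<pi> ` U"
  shows "dd e (u_loc U \<psi> \<kappa> s) (\<kappa> x) = snd (dd e (\<psi> \<circ> s \<circ> inv_into (\<pi> ` U) \<kappa>) (\<kappa> x))"
  using dd_snd[OF loc_smooth(1)[OF assms], of e] by (simp add: u_loc_def comp_def)

lemma full_loc:
  assumes "bundle_chart U \<psi> \<kappa>" "sect x s" "s x \<in> U"
  shows "eventually (\<lambda>z. (\<psi> \<circ> s \<circ> inv_into (\<pi> ` U) \<kappa>) z = (z, u_loc U \<psi> \<kappa> s z)) (nhds (\<kappa> x))"
  using sect_near_domain[OF assms, unfolded base_near[OF assms(1) sect_base[OF assms(2,3)]]]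
    base_inv(2)[OF assms(1) sect_base[OF assms(2,3)]]
proof eventually_elim
  case (elim z)
  then show ?case
    using bundle_chartD(3)[OF assms(1), of "s (inv_into (\<pi> ` U) \<kappa> z)"] sectD(2)
    by (simp add: u_loc_def prod_eq_iff)
qed

lemma fst_J [simp]: "fst (J x s) = x"
  by (simp add: J_def jet_def)

text \<open>A jet is a class of smooth maps, so the chosen representative g need not be a section.
  What remains available is its smoothness and its agreement with s to first order at x.\<close>

lemma jet1_rep:
  assumes "sect x s" "g = (SOME g. g \<in> snd (J x s))"
  shows "smooth_at M E x g" "same_jet M E 1 x s g"
proof -
  have "s \<in> snd (J x s)" using sectD(1)[OF assms(1)] same_jet_refl by (simp add: J_def jet_def)
  then have "g \<in> snd (J x s)" unfolding assms(2) by (rule someI[where P = "\<lambda>g. g \<in> snd (J x s)"])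
  then show "smooth_at M E x g" "same_jet M E 1 x s g" by (simp_all add: J_def jet_def)
qed

lemma jet1_target: "sect x s \<Longrightarrow> jet_target (J x s) = s x"
  unfolding jet_target_def fst_J using same_jet_value[OF jet1_rep(2)[OF _ refl]] by simp

lemma jet1_chart_J:
  assumes U: "bundle_chart U \<psi> \<kappa>" and s: "sect x s" "s x \<in> U"
  shows "jet1_chart \<pi> U \<psi> \<kappa> (J x s) =
    (\<kappa> x, u_loc U \<psi> \<kappa> s (\<kappa> x), \<chi> i. dd (axis i 1) (u_loc U \<psi> \<kappa> s) (\<kappa> x))"
proof -
  define g where "g = (SOME g. g \<in> snd (J x s))"
  note g = jet1_rep[OF s(1) g_def]
  note x = sect_base[OF s]
  have gx: "g x = s x" using same_jet_value[OF g(2)] by simp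
  have e: "dd (axis i 1) (\<psi> \<circ> s \<circ> inv_into (\<pi> ` U) \<kappa>) (\<kappa> x) = dd (axis i 1) (\<psi> \<circ> g \<circ> inv_into (\<pi> ` U) \<kappa>) (\<kappa> x)"
    for i
    using g(2)[unfolded same_jet_chart_iff[OF M E bundle_chartD(2)[OF U] x bundle_chartD(1)[OF U] s(2)
          sectD(1)[OF s(1)] g(1)], THEN conjunct2, rule_format, of "[axis i 1]"]
    by (simp add: iter_deriv_Cons del: iter_deriv.simps(2))
  have "dd (axis i 1) (u_loc U \<psi> \<kappa> g) (\<kappa> x) = dd (axis i 1) (u_loc U \<psi> \<kappa> s) (\<kappa> x)" for i
    using dd_u_loc[OF U g(1) _ x] dd_u_loc[OF U sectD(1)[OF s(1)] s(2) x] e gx s(2) by simp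
  then show ?thesis
    unfolding jet1_chart_def Let_def fst_J g_def[symmetric] dd_def[symmetric]
    using gx u_loc_value[OF U x, of s] by (simp add: u_loc_def[symmetric])
qed

text \<open>In bundle coordinates the base component of a section is the identity, so the value and
  first derivatives of u determine the 1-jet of the section as a map into E.\<close>

lemma J_eqI:
  assumes U: "bundle_chart U \<psi> \<kappa>" and s: "sect x s" "s x \<in> U" and s': "sect x' s'" "s' x' \<in> U"
    and e: "jet1_chart \<pi> U \<psi> \<kappa> (J x s) = jet1_chart \<pi> U \<psi> \<kappa> (J x' s')"
  shows "J x s = J x' s'"
proof -
  note x = sect_base[OF s] and x' = sect_base[OF s']
  note e = e[unfolded jet1_chart_J[OF U s] jet1_chart_J[OF U s'], unfolded prod.inject]
  have xx: "x' = x"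
    using e chartD(2)[OF bundle_chartD(2)[OF U]] x x' by (metis inj_onD)
  have d: "dd (axis i 1) (u_loc U \<psi> \<kappa> s) (\<kappa> x) = dd (axis i 1) (u_loc U \<psi> \<kappa> s') (\<kappa> x)" for i
    using e xx by (simp add: vec_eq_iff)
  have "fst (\<psi> (s x)) = fst (\<psi> (s' x))"
    using bundle_chartD(3)[OF U s(2)] bundle_chartD(3)[OF U s'(2)] sectD(2)[OF s(1)] sectD(2)[OF s'(1)] xx by simp
  then have "\<psi> (s x) = \<psi> (s' x)"
    using e u_loc_value[OF U x] xx by (simp add: prod_eq_iff)
  then have sx: "s x = s' x" using chartD(2)[OF bundle_chartD(1)[OF U]] s(2) s'(2) xx by (metis inj_onD)
  have full: "dd v (\<psi> \<circ> r \<circ> inv_into (\<pi> ` U) \<kappa>) (\<kappa> x) = (v, dd v (u_loc U \<psi> \<kappa> r) (\<kappa> x))"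
    if r: "sect x r" "r x \<in> U" for r v
    using dd_cong[OF full_loc[OF U r], of v]
      dd_Pair[OF smooth_near_id loc_smooth(2)[OF U sectD(1)[OF r(1)] r(2) x], of v] by (simp add: dd_ident comp_def)
  have "same_jet M E 1 x s s'"
    unfolding same_jet_chart_iff[OF M E bundle_chartD(2)[OF U] x bundle_chartD(1)[OF U] s(2)
        sectD(1)[OF s(1)] sectD(1)[OF s'(1)[unfolded xx]]]
  proof (intro conjI allI impI)
    show "s x = s' x" by (rule sx)
    fix \<sigma> :: "(real^'n) list" assume \<sigma>: "set \<sigma> \<subseteq> Basis \<and> length \<sigma> \<le> 1"
    show "iter_deriv \<sigma> (\<psi> \<circ> s \<circ> inv_into (\<pi> ` U) \<kappa>) (\<kappa> x) = iter_deriv \<sigma> (\<psi> \<circ> s' \<circ> inv_into (\<pi> ` U) \<kappa>) (\<kappa> x)"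
    proof (cases \<sigma>)
      case Nil then show ?thesis using base_inv(1)[OF U x] sx by simp
    next
      case (Cons v vs)
      then have "vs = []" "v \<in> Basis" using \<sigma> by auto
      then obtain i where "\<sigma> = [axis i 1]" using Cons by (metis Basis_realvecE)
      then show ?thesis
        using full[OF s] full[OF s'[unfolded xx]] d by (simp add: iter_deriv_Cons del: iter_deriv.simps(2))
    qed
  qed
  then show ?thesis unfolding J_def xx by (rule jet_eqI)
qed

text \<open>The graph of u, read through the bundle chart, is a section; by continuity it stays in
  the chart domain near the point.\<close>

lemma section_from_loc:
  assumes U: "bundle_chart U \<psi> \<kappa>" and u: "smooth_near z0 u" "(z0, u z0) \<in> \<psi> ` U"
  obtains x s where "x \<in> \<pi> ` U" "\<kappa> x = z0" "sect x s" "s x \<in> U" "\<psi> (s x) = (z0, u z0)"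
    "eventually (\<lambda>z. u_loc U \<psi> \<kappa> s z = u z) (nhds z0)"
proof -
  obtain e where e: "e \<in> U" "\<psi> e = (z0, u z0)" using u(2) by (metis imageE)
  define x where "x = \<pi> e"
  have x: "x \<in> \<pi> ` U" using e(1) by (simp add: x_def)
  have kx: "\<kappa> x = z0" using bundle_chartD(3)[OF U e(1)] e(2) by (simp add: x_def)
  define g where "g = (\<lambda>z. (z, u z))"
  have g: "smooth_near z0 g" unfolding g_def by (rule smooth_near_Pair[OF smooth_near_id u(1)])
  define s where "s = inv_into U \<psi> \<circ> (g \<circ> \<kappa>)"
  note c = bundle_chartD[OF U]
  have ie: "inv_into U \<psi> (\<psi> e) = e" using chartD(2)[OF c(1)] e(1) by simp
  have sx: "s x = e" using ie e(2) by (simp add: s_def g_def kx)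
  have "smooth_at M euclidean_atlas x (g \<circ> \<kappa>)"
    using smooth_at_compose[OF M smooth_atlas_euclidean smooth_atlas_euclidean chart_smooth_at(1)[OF c(2) x], of g]
      g kx by (simp add: smooth_at_euclidean)
  then have s1: "smooth_at M E x s"
    unfolding s_def using smooth_at_compose[OF M smooth_atlas_euclidean E, of x "g \<circ> \<kappa>" "inv_into U \<psi>"]
      chart_smooth_at(2)[OF c(1) e(1)] e(2) kx by (simp add: g_def)
  have "eventually (\<lambda>z. g z \<in> \<psi> ` U) (nhds z0)"
    by (rule eventually_compose_filterlim[OF _ smooth_near_filterlim[OF g]])
      (use eventually_nhds_in_open[OF chartD(3)[OF c(1)]] u(2) in \<open>simp add: g_def\<close>)
  then have ev: "eventually (\<lambda>z. g z \<in> \<psi> ` U \<and> \<kappa> (inv_into (\<pi> ` U) \<kappa> z) = z \<and> inv_into (\<pi> ` U) \<kappa> z \<in> \<pi> ` U) (nhds z0)"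
    using eventually_chart[OF c(2) x] unfolding kx by eventually_elim simp
  have "near M x (\<lambda>y. \<pi> (s y) = y)"
    unfolding base_near[OF U x] kx using ev
  proof eventually_elim
    case (elim z)
    let ?y = "inv_into (\<pi> ` U) \<kappa> z"
    have "\<psi> (s ?y) = g z" "s ?y \<in> U"
      using elim by (simp_all add: s_def f_inv_into_f inv_into_into)
    then have "\<kappa> (\<pi> (s ?y)) = \<kappa> ?y" using c(3)[of "s ?y"] elim by (simp add: g_def)
    moreover have "\<pi> (s ?y) \<in> \<pi> ` U" using \<open>s ?y \<in> U\<close> by blast
    ultimately show ?case using chartD(2)[OF c(2)] elim by (metis inj_onD)
  qed
  then have s2: "sect x s" unfolding section_at_def using s1 by blast
  have "eventually (\<lambda>z. u_loc U \<psi> \<kappa> s z = u z) (nhds z0)"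
    using ev
  proof eventually_elim
    case (elim z)
    then have "\<psi> (s (inv_into (\<pi> ` U) \<kappa> z)) = g z" by (simp add: s_def f_inv_into_f)
    then show ?case by (simp add: u_loc_def g_def)
  qed
  then show ?thesis using that[OF x kx s2] sx e by simp
qed

lemma dom1_iff: "\<theta> \<in> dom1 U \<longleftrightarrow> (\<exists>x s. sect x s \<and> s x \<in> U \<and> \<theta> = J x s)"
proof -
  have d: "dom1 U = {\<theta> \<in> {J x s | x s. sect x s}. jet_target \<theta> \<in> U}"
    unfolding jet1_domain_def jet_space_def local_section_iff[OF M] J_def ..
  show ?thesis
  proof
    assume "\<theta> \<in> dom1 U"
    then obtain x s where "sect x s" "\<theta> = J x s" "jet_target \<theta> \<in> U" unfolding d by blast
    then show "\<exists>x s. sect x s \<and> s x \<in> U \<and> \<theta> = J x s"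
      using jet1_target[of x s] by (intro exI[of _ x] exI[of _ s]) simp
  next
    assume "\<exists>x s. sect x s \<and> s x \<in> U \<and> \<theta> = J x s"
    then show "\<theta> \<in> dom1 U" unfolding d using jet1_target by force
  qed
qed

lemma J_dom1: "sect x s \<Longrightarrow> s x \<in> U \<Longrightarrow> J x s \<in> dom1 U"
  unfolding dom1_iff by blast

text \<open>Every slope p is attained: the affine function with value u0 and linear part given by p
  is the coordinate form of a section. Allowing a subset W of U covers overlaps of two
  charts.\<close>

lemma jet1_chart_image:
  assumes U: "bundle_chart U \<psi> \<kappa>" and W: "W \<subseteq> U"
  shows "jet1_chart \<pi> U \<psi> \<kappa> ` dom1 W = {z. (fst z, fst (snd z)) \<in> \<psi> ` W}"
proof
  show "jet1_chart \<pi> U \<psi> \<kappa> ` dom1 W \<subseteq> {z. (fst z, fst (snd z)) \<in> \<psi> ` W}"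
  proof
    fix z assume "z \<in> jet1_chart \<pi> U \<psi> \<kappa> ` dom1 W"
    then obtain \<theta> where "\<theta> \<in> dom1 W" "z = jet1_chart \<pi> U \<psi> \<kappa> \<theta>" by (metis imageE)
    then obtain x s where s: "sect x s" "s x \<in> W" "z = jet1_chart \<pi> U \<psi> \<kappa> (J x s)"
      unfolding dom1_iff by blast
    have sU: "s x \<in> U" using s(2) W by blast
    have "fst (\<psi> (s x)) = \<kappa> x" using bundle_chartD(3)[OF U sU] sectD(2)[OF s(1)] by simp
    then have "(fst z, fst (snd z)) = \<psi> (s x)"
      unfolding s(3) jet1_chart_J[OF U s(1) sU] using u_loc_value[OF U sect_base[OF s(1) sU]]
      by (simp add: prod_eq_iff)
    then show "z \<in> {z. (fst z, fst (snd z)) \<in> \<psi> ` W}" using s(2) by simp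
  qed
  show "{z. (fst z, fst (snd z)) \<in> \<psi> ` W} \<subseteq> jet1_chart \<pi> U \<psi> \<kappa> ` dom1 W"
  proof
    fix z :: "(real^'n) \<times> (real^'m) \<times> (real^'m^'n)" assume "z \<in> {z. (fst z, fst (snd z)) \<in> \<psi> ` W}"
    then obtain z0 u0 p where z: "z = (z0, u0, p)" "(z0, u0) \<in> \<psi> ` W" by (cases z) auto
    define l where "l = (\<lambda>v :: real^'n. \<Sum>i\<in>UNIV. (v $ i) *\<^sub>R (p $ i))"
    have l: "bounded_linear l" unfolding l_def
      by (intro bounded_linear_sum bounded_linear_compose[OF bounded_linear_scaleR_left bounded_linear_vec_nth])
    define u where "u = (\<lambda>y. l y + (u0 - l z0))"
    have u: "smooth_near z0 u" unfolding u_def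
      by (intro smooth_near_add smooth_near_linear[OF l] smooth_near_const)
    have du: "dd v u z0 = l v" for v
      unfolding u_def
      by (rule dd_eqI[where f' = l])
        (use bounded_linear_imp_has_derivative[OF l] in \<open>auto intro!: derivative_eq_intros\<close>)
    have "u z0 = u0" by (simp add: u_def)
    then have "(z0, u z0) \<in> \<psi> ` U" using z(2) W by auto
    then obtain x s where s: "x \<in> \<pi> ` U" "\<kappa> x = z0" "sect x s" "s x \<in> U" "\<psi> (s x) = (z0, u z0)"
      "eventually (\<lambda>z. u_loc U \<psi> \<kappa> s z = u z) (nhds z0)"
      by (rule section_from_loc[OF U u]) (rule that)
    have "l (axis i 1) = p $ i" for i
      by (simp add: l_def axis_def if_distrib[of "\<lambda>c. c *\<^sub>R _"] sum.delta cong: if_cong)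
    then have "jet1_chart \<pi> U \<psi> \<kappa> (J x s) = z"
      unfolding jet1_chart_J[OF U s(3,4)] s(2) dd_cong[OF s(6)] du
      using eventually_nhds_x_imp_x[OF s(6)] \<open>u z0 = u0\<close> by (simp add: z vec_eq_iff)
    moreover have "s x \<in> W"
    proof -
      obtain e where e: "e \<in> W" "\<psi> e = (z0, u0)" using z(2) by (metis imageE)
      then have "s x = e"
        using s(4,5) \<open>u z0 = u0\<close> W by (intro inj_onD[OF chartD(2)[OF bundle_chartD(1)[OF U]]]) auto
      then show ?thesis using e(1) by simp
    qed
    ultimately show "z \<in> jet1_chart \<pi> U \<psi> \<kappa> ` dom1 W" using J_dom1[OF s(3)] by blast
  qed
qed

lemma jet1_chart_inj:
  assumes U: "bundle_chart U \<psi> \<kappa>"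
  shows "inj_on (jet1_chart \<pi> U \<psi> \<kappa>) (dom1 U)"
proof (rule inj_onI)
  fix \<theta> \<theta>' assume \<theta>: "\<theta> \<in> dom1 U" "\<theta>' \<in> dom1 U" and e: "jet1_chart \<pi> U \<psi> \<kappa> \<theta> = jet1_chart \<pi> U \<psi> \<kappa> \<theta>'"
  obtain x s where s: "sect x s" "s x \<in> U" "\<theta> = J x s" using \<theta>(1) unfolding dom1_iff by blast
  obtain x' s' where s': "sect x' s'" "s' x' \<in> U" "\<theta>' = J x' s'" using \<theta>(2) unfolding dom1_iff by blast
  show "\<theta> = \<theta>'" unfolding s(3) s'(3) by (rule J_eqI[OF U s(1,2) s'(1,2) e[unfolded s(3) s'(3)]])
qed

text \<open>The classical rule for first derivatives under a change of coordinates. Here g is the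
  change of bundle coordinates and \<open>w j\<close> the j-th column of the Jacobian of the old
  base coordinates with respect to the new ones; the new p is the u-component of the derivative of g
  along \<open>w j\<close> lifted by the old p. Taking the base change from new to old avoids
  inverting a matrix.\<close>

definition prolonged_transition ::
  "'e set \<Rightarrow> ('e \<Rightarrow> (real^'n) \<times> (real^'m)) \<Rightarrow> ('b \<Rightarrow> real^'n) \<Rightarrow>
   'e set \<Rightarrow> ('e \<Rightarrow> (real^'n) \<times> (real^'m)) \<Rightarrow> ('b \<Rightarrow> real^'n) \<Rightarrow>
   (real^'n) \<times> (real^'m) \<times> (real^'m^'n) \<Rightarrow> (real^'n) \<times> (real^'m) \<times> (real^'m^'n)" where
  "prolonged_transition U \<psi> \<kappa> U' \<psi>' \<kappa>' z =
    (let g = \<psi>' \<circ> inv_into U \<psi>; y = g (fst z, fst (snd z));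
         w = (\<lambda>j. dd (axis j 1) (\<kappa> \<circ> inv_into (\<pi> ` U') \<kappa>') (fst y)) in
     (fst y, snd y, \<chi> j. snd (dd (w j, \<Sum>i\<in>UNIV. (w j $ i) *\<^sub>R (snd (snd z) $ i)) g (fst z, fst (snd z)))))"

text \<open>In new coordinates the section is the second component of g (k z, u (k z)), with k the
  base change from new to old coordinates; its first derivatives involve u only through its
  1-jet.\<close>

lemma jet1_transition:
  assumes U: "bundle_chart U \<psi> \<kappa>" and U': "bundle_chart U' \<psi>' \<kappa>'"
    and s: "sect x s" "s x \<in> U" "s x \<in> U'"
  shows "jet1_chart \<pi> U' \<psi>' \<kappa>' (J x s) = prolonged_transition U \<psi> \<kappa> U' \<psi>' \<kappa>' (jet1_chart \<pi> U \<psi> \<kappa> (J x s))"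
proof -
  note c = bundle_chartD[OF U] and c' = bundle_chartD[OF U']
  note x = sect_base[OF s(1,2)] and x' = sect_base[OF s(1,3)]
  define g where "g = \<psi>' \<circ> inv_into U \<psi>"
  define k where "k = \<kappa> \<circ> inv_into (\<pi> ` U') \<kappa>'"
  define u where "u = u_loc U \<psi> \<kappa> s"
  have g: "smooth_near (\<psi> (s x)) g" unfolding g_def by (rule smooth_transition[OF E c(1) c'(1) s(2,3)])
  have k: "smooth_near (\<kappa>' x) k" "k (\<kappa>' x) = \<kappa> x"
    unfolding k_def using smooth_transition[OF M c'(2) c(2) x' x] base_inv(1)[OF U' x'] by simp_all
  have u: "smooth_near (\<kappa> x) u" unfolding u_def by (rule loc_smooth(2)[OF U sectD(1)[OF s(1)] s(2) x])
  have psx: "\<psi> (s x) = (\<kappa> x, u (\<kappa> x))"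
    using c(3)[OF s(2)] sectD(2)[OF s(1)] u_loc_value[OF U x] by (simp add: u_def prod_eq_iff)
  have gsx: "g (\<psi> (s x)) = \<psi>' (s x)" using chartD(2)[OF c(1)] s(2) by (simp add: g_def)
  have psx': "\<psi>' (s x) = (\<kappa>' x, u_loc U' \<psi>' \<kappa>' s (\<kappa>' x))"
    using c'(3)[OF s(3)] sectD(2)[OF s(1)] u_loc_value[OF U' x'] by (simp add: prod_eq_iff)
  let ?v = "\<lambda>z. (k z, u (k z))"
  have "near M x (\<lambda>y. (y \<in> \<pi> ` U \<and> sect y s \<and> s y \<in> U) \<and> y \<in> \<pi> ` U' \<and> sect y s \<and> s y \<in> U')"
    by (rule near_conj[OF M sect_near_domain[OF U s(1,2)] sect_near_domain[OF U' s(1,3)]])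
  then have "eventually (\<lambda>z. u_loc U' \<psi>' \<kappa>' s z = snd (g (?v z))) (nhds (\<kappa>' x))"
    unfolding base_near[OF U' x']
  proof eventually_elim
    case (elim z)
    let ?y = "inv_into (\<pi> ` U') \<kappa>' z"
    have "k z = \<kappa> ?y" by (simp add: k_def)
    moreover have "u (k z) = snd (\<psi> (s ?y))" using elim u_loc_value[OF U, of ?y s] by (simp add: u_def k_def)
    moreover have "fst (\<psi> (s ?y)) = \<kappa> ?y" using c(3)[of "s ?y"] elim sectD(2) by simp
    ultimately have "?v z = \<psi> (s ?y)" by (simp add: prod_eq_iff)
    then show ?case using elim chartD(2)[OF c(1)] by (simp add: g_def u_loc_def)
  qed
  from dd_cong[OF this]
  have d1: "dd e (u_loc U' \<psi>' \<kappa>' s) (\<kappa>' x) = dd e (\<lambda>z. snd (g (?v z))) (\<kappa>' x)" for e .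
  have uk: "smooth_near (\<kappa>' x) (\<lambda>z. u (k z))"
    using smooth_near_compose[OF k(1), of u] u k(2) by simp
  have v: "smooth_near (\<kappa>' x) ?v"
    by (rule smooth_near_Pair[OF k(1) uk])
  have gv: "smooth_near (?v (\<kappa>' x)) g" using g psx k(2) by simp
  have d2: "dd e (\<lambda>z. snd (g (?v z))) (\<kappa>' x) = snd (dd (dd e ?v (\<kappa>' x)) g (?v (\<kappa>' x)))" for e
    using dd_snd[OF smooth_near_compose[OF v gv], of e]
      dd_compose[OF smooth_near_differentiable[OF v] smooth_near_differentiable[OF gv], of e] by simp
  have d3: "dd e ?v (\<kappa>' x) = (dd e k (\<kappa>' x), dd (dd e k (\<kappa>' x)) u (\<kappa> x))" for e
    using dd_Pair[OF k(1) uk, of e]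
      dd_compose[of k "\<kappa>' x" u e] smooth_near_differentiable[OF k(1)] smooth_near_differentiable[OF u] k(2)
    by simp
  have d4: "dd w u (\<kappa> x) = (\<Sum>i\<in>UNIV. (w $ i) *\<^sub>R dd (axis i 1) u (\<kappa> x))" for w
    by (rule dd_vec[OF smooth_near_differentiable[OF u]])
  have "dd e (u_loc U' \<psi>' \<kappa>' s) (\<kappa>' x) =
      snd (dd (dd e k (\<kappa>' x), \<Sum>i\<in>UNIV. (dd e k (\<kappa>' x) $ i) *\<^sub>R dd (axis i 1) u (\<kappa> x)) g (\<kappa> x, u (\<kappa> x)))" for e
    unfolding d1 d2 d3 d4[of "dd e k (\<kappa>' x)"] k(2) ..
  then show ?thesis
    unfolding jet1_chart_J[OF U s(1,2)] jet1_chart_J[OF U' s(1,3)] prolonged_transition_def Let_def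
      g_def[symmetric] k_def[symmetric] u_def[symmetric]
    using psx psx' gsx by simp
qed

lemma prolonged_transition_smooth:
  assumes U: "bundle_chart U \<psi> \<kappa>" and U': "bundle_chart U' \<psi>' \<kappa>'"
    and e: "e \<in> U" "e \<in> U'" "(fst z, fst (snd z)) = \<psi> e"
  shows "smooth_near z (prolonged_transition U \<psi> \<kappa> U' \<psi>' \<kappa>')"
proof -
  note c = bundle_chartD[OF U] and c' = bundle_chartD[OF U']
  define g where "g = \<psi>' \<circ> inv_into U \<psi>"
  define k where "k = \<kappa> \<circ> inv_into (\<pi> ` U') \<kappa>'"
  have g: "smooth_near (\<psi> e) g" unfolding g_def by (rule smooth_transition[OF E c(1) c'(1) e(1,2)])
  have ge: "g (\<psi> e) = \<psi>' e" using chartD(2)[OF c(1)] e(1) by (simp add: g_def)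
  have k: "smooth_near (\<kappa>' (\<pi> e)) k"
    unfolding k_def by (rule smooth_transition[OF M c'(2) c(2)]) (use e in auto)
  let ?q = "\<lambda>z :: (real^'n) \<times> (real^'m) \<times> (real^'m^'n). (fst z, fst (snd z))"
  have q: "smooth_near z ?q"
    by (intro smooth_near_Pair smooth_near_fst smooth_near_snd smooth_near_id)
  have gq: "smooth_near (?q z) g" using g e(3) by simp
  have y: "smooth_near z (\<lambda>z. g (?q z))" by (rule smooth_near_compose[OF q gq])
  have ky: "smooth_near (fst (g (?q z))) k" using k ge e(3) c'(3)[OF e(2)] by simp
  have w: "smooth_near z (\<lambda>z. dd (axis j 1) k (fst (g (?q z))))" for j
    by (rule smooth_near_dd_variable[OF smooth_near_const smooth_near_fst[OF y] ky])
  show ?thesis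
    unfolding prolonged_transition_def[abs_def] Let_def g_def[symmetric] k_def[symmetric]
    by (intro smooth_near_Pair smooth_near_fst[OF y] smooth_near_snd[OF y] smooth_near_vec_lambda
        smooth_near_snd[OF smooth_near_dd_variable[OF _ q gq]] w smooth_near_sum smooth_near_scaleR
        smooth_near_vec_nth smooth_near_snd smooth_near_id)
qed

text \<open>An overlap is an open set of (x, u) times all slopes p, and on it the transition map
  coincides with \<open>prolonged_transition\<close>.\<close>

lemma smooth_atlas_J1: "smooth_atlas J1"
proof -
  have tr: "open (jet1_chart \<pi> U \<psi> \<kappa> ` (dom1 U \<inter> dom1 U')) \<and>
      smooth_on (jet1_chart \<pi> U \<psi> \<kappa> ` (dom1 U \<inter> dom1 U')) (jet1_chart \<pi> U' \<psi>' \<kappa>' \<circ> inv_into (dom1 U) (jet1_chart \<pi> U \<psi> \<kappa>))"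
    if U: "bundle_chart U \<psi> \<kappa>" and U': "bundle_chart U' \<psi>' \<kappa>'" for U \<psi> \<kappa> U' \<psi>' \<kappa>'
  proof -
    note c = bundle_chartD[OF U] and c' = bundle_chartD[OF U']
    have d: "dom1 U \<inter> dom1 U' = dom1 (U \<inter> U')" unfolding jet1_domain_def by auto
    let ?O = "{z :: (real^'n) \<times> (real^'m) \<times> (real^'m^'n). (fst z, fst (snd z)) \<in> \<psi> ` (U \<inter> U')}"
    have im: "jet1_chart \<pi> U \<psi> \<kappa> ` (dom1 U \<inter> dom1 U') = ?O"
      unfolding d by (rule jet1_chart_image[OF U]) simp
    have "mopen E (U \<inter> U')" by (rule mopen_Int[OF E chartD(1)[OF c(1)] chartD(1)[OF c'(1)]])
    then have "open (\<psi> ` (U \<inter> U'))"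
      using chartD(3)[OF local_diffeo_subset[OF E smooth_atlas_euclidean c(1)]] by simp
    then have "open ((\<lambda>z :: (real^'n) \<times> (real^'m) \<times> (real^'m^'n). (fst z, fst (snd z))) -` (\<psi> ` (U \<inter> U')))"
      by (intro open_vimage continuous_intros)
    then have o: "open ?O" by (simp add: vimage_def)
    have "smooth_near z (jet1_chart \<pi> U' \<psi>' \<kappa>' \<circ> inv_into (dom1 U) (jet1_chart \<pi> U \<psi> \<kappa>))" if z: "z \<in> ?O" for z
    proof (rule smooth_near_cong)
      obtain e where "e \<in> U \<inter> U'" "(fst z, fst (snd z)) = \<psi> e" using z by auto
      then show "smooth_near z (prolonged_transition U \<psi> \<kappa> U' \<psi>' \<kappa>')"
        using prolonged_transition_smooth[OF U U'] by blast
      show "eventually (\<lambda>y. prolonged_transition U \<psi> \<kappa> U' \<psi>' \<kappa>' y =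
          (jet1_chart \<pi> U' \<psi>' \<kappa>' \<circ> inv_into (dom1 U) (jet1_chart \<pi> U \<psi> \<kappa>)) y) (nhds z)"
        using eventually_nhds_in_open[OF o z]
      proof eventually_elim
        case (elim y)
        then obtain \<theta> where \<theta>: "\<theta> \<in> dom1 (U \<inter> U')" "y = jet1_chart \<pi> U \<psi> \<kappa> \<theta>"
          unfolding im[symmetric] d by blast
        then obtain x s where s: "sect x s" "s x \<in> U" "s x \<in> U'" "\<theta> = J x s" unfolding dom1_iff by blast
        have "inv_into (dom1 U) (jet1_chart \<pi> U \<psi> \<kappa>) y = J x s"
          unfolding \<theta>(2) s(4) by (rule inv_into_f_f[OF jet1_chart_inj[OF U] J_dom1[OF s(1,2)]])
        then show ?case using jet1_transition[OF U U' s(1-3)] \<theta>(2) s(4) by simp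
      qed
    qed
    then show ?thesis unfolding im using o smooth_on_iff_near[OF o] by blast
  qed
  show ?thesis
    unfolding smooth_atlas_def jet1_atlas_def using jet1_chart_inj tr by auto
qed

lemma J1_chart: "bundle_chart U \<psi> \<kappa> \<Longrightarrow> (dom1 U, jet1_chart \<pi> U \<psi> \<kappa>) \<in> J1"
  unfolding jet1_atlas_def by blast

lemma fst_dom1:
  assumes U: "bundle_chart U \<psi> \<kappa>"
  shows "fst ` dom1 U = \<pi> ` U"
proof
  show "fst ` dom1 U \<subseteq> \<pi> ` U"
  proof
    fix x assume "x \<in> fst ` dom1 U"
    then obtain \<theta> where "\<theta> \<in> dom1 U" "x = fst \<theta>" by blast
    then obtain y s where "sect y s" "s y \<in> U" "x = fst (J y s)" unfolding dom1_iff by blast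
    then show "x \<in> \<pi> ` U" using sect_base by simp
  qed
  show "\<pi> ` U \<subseteq> fst ` dom1 U"
  proof
    fix x assume "x \<in> \<pi> ` U"
    then obtain e where e: "e \<in> U" "x = \<pi> e" by blast
    have "(fst (\<psi> e), (\<lambda>z. snd (\<psi> e)) (fst (\<psi> e))) \<in> \<psi> ` U" using e(1) by simp
    then obtain y s where "y \<in> \<pi> ` U" "\<kappa> y = fst (\<psi> e)" "sect y s" "s y \<in> U"
      by (rule section_from_loc[OF U smooth_near_const]) (rule that)
    moreover from this have "y = x"
      using chartD(2)[OF bundle_chartD(2)[OF U]] bundle_chartD(3)[OF U e(1)] e by (metis image_eqI inj_onD)
    ultimately show "x \<in> fst ` dom1 U" using J_dom1 by (metis fst_J image_eqI)
  qed
qed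

lemma J1_adapted:
  assumes U: "bundle_chart U \<psi> \<kappa>"
  shows "adapted J1 M fst (dom1 U) (jet1_chart \<pi> U \<psi> \<kappa>) \<kappa>"
  unfolding adapted_def fst_dom1[OF U]
  using atlas_chart[OF smooth_atlas_J1 J1_chart[OF U]] bundle_chartD(2)[OF U]
  by (simp add: jet1_chart_def Let_def)

lemma J1_carrierE:
  assumes "\<theta> \<in> carrier J1"
  obtains U \<psi> \<kappa> where "bundle_chart U \<psi> \<kappa>" "\<theta> \<in> dom1 U"
  using assms unfolding carrier_def jet1_atlas_def by auto

definition lift where "lift s = (\<lambda>y. J y s)"

lemma lift_loc:
  assumes U: "bundle_chart U \<psi> \<kappa>" and s: "sect x s" "s x \<in> U"
  shows "eventually (\<lambda>z. (jet1_chart \<pi> U \<psi> \<kappa> \<circ> lift s \<circ> inv_into (\<pi> ` U) \<kappa>) z =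
    (z, u_loc U \<psi> \<kappa> s z, \<chi> i. dd (axis i 1) (u_loc U \<psi> \<kappa> s) z)) (nhds (\<kappa> x))"
  using sect_near_domain[OF U s, unfolded base_near[OF U sect_base[OF s]]] base_inv(2)[OF U sect_base[OF s]]
  by eventually_elim (simp add: lift_def jet1_chart_J[OF U])

lemma lift_section:
  assumes "sect x s"
  shows "section_at J1 M fst x (lift s)"
proof -
  have "s x \<in> carrier E" using smooth_at_carrier(2)[OF sectD(1)[OF assms]] .
  then obtain U \<psi> \<kappa> where U: "bundle_chart U \<psi> \<kappa>" "s x \<in> U"
    by (rule smooth_bundle_adapted_chart[OF E_bundle])
  note x = sect_base[OF assms U(2)]
  have u: "smooth_near (\<kappa> x) (u_loc U \<psi> \<kappa> s)" by (rule loc_smooth(2)[OF U(1) sectD(1)[OF assms] U(2) x])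
  have "smooth_near (\<kappa> x) (\<lambda>z. (z, u_loc U \<psi> \<kappa> s z, \<chi> i. dd (axis i 1) (u_loc U \<psi> \<kappa> s) z))"
    by (intro smooth_near_Pair smooth_near_id u smooth_near_vec_lambda smooth_near_dd axis_1_Basis)
  then have "smooth_near (\<kappa> x) (jet1_chart \<pi> U \<psi> \<kappa> \<circ> lift s \<circ> inv_into (\<pi> ` U) \<kappa>)"
    by (rule smooth_near_cong[rotated]) (use lift_loc[OF U(1) assms U(2)] in \<open>simp add: eq_commute\<close>)
  moreover have "near M x (\<lambda>y. lift s y \<in> dom1 U)"
    using sect_near_domain[OF U(1) assms U(2)] by (rule near_mono) (simp add: lift_def J_dom1)
  ultimately have 1: "smooth_at M J1 x (lift s)"
    by (intro smooth_at_chartI[OF M smooth_atlas_J1 bundle_chartD(2)[OF U(1)]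
          atlas_chart[OF smooth_atlas_J1 J1_chart[OF U(1)]] x])
  have "near M x (\<lambda>y. fst (lift s y) = y)"
    using sectD(3)[OF assms] by (rule near_mono) (simp add: lift_def)
  then show ?thesis unfolding section_at_def using 1 by blast
qed

end

section \<open>Contactness as an algebraic condition, holonomy of images, and the case of contact
  transformations\<close>

section \<open>Contact symmetries\<close>

lemma polynomial_fun_sum:
  "(\<And>i. i \<in> A \<Longrightarrow> polynomial_fun I (p i)) \<Longrightarrow> polynomial_fun I (\<lambda>w. \<Sum>i\<in>A. p i w)"
  by (induction A rule: infinite_finite_induct) (auto intro: polynomial_fun.intros)

lemma dd_inverse_germs:
  assumes A: "smooth_atlas A" and V: "chart A V c" "a \<in> V" and W: "chart A W d" "f a \<in> W"
    and f: "smooth_at A A a f" and g: "smooth_at A A (f a) g" and gf: "near A a (\<lambda>y. g (f y) = y)"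
  shows "dd (dd v (d \<circ> f \<circ> inv_into V c) (c a)) (c \<circ> g \<circ> inv_into W d) (d (f a)) = v"
proof -
  let ?f = "d \<circ> f \<circ> inv_into V c" and ?g = "c \<circ> g \<circ> inv_into W d"
  have fa: "?f (c a) = d (f a)" by (rule smooth_at_local_value[OF V])
  have sf: "smooth_near (c a) ?f" by (rule smooth_at_local[OF A A V(1) W(1) V(2) W(2) f])
  have "g (f a) \<in> V" using near_point[OF gf] V(2) by simp
  then have sg: "smooth_near (?f (c a)) ?g"
    unfolding fa by (rule smooth_at_local[OF A A W(1) V(1) W(2) _ g])
  have "near A a (\<lambda>y. f y \<in> W)"
    by (rule smooth_at_vimage[OF A A f near_mopen[OF chartD(1)[OF W(1)] W(2)]])
  from near_conj[OF A this gf, unfolded near_chart[OF A V]] eventually_chart[OF V]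
  have "eventually (\<lambda>z. ?g (?f z) = z) (nhds (c a))"
    by eventually_elim (use chartD(2)[OF W(1)] in simp)
  from dd_cong[OF this, of v] show ?thesis
    using dd_compose[OF smooth_near_differentiable[OF sf] smooth_near_differentiable[OF sg], of v]
    unfolding fa by (simp add: dd_ident comp_def)
qed

text \<open>Represents, through the inner product, the component along e of the contact form du - p
  dx; the contact plane is thereby cut out by linear equations.\<close>

definition contact_normal ::
  "(real^'n) \<times> (real^'m) \<times> (real^'m^'n) \<Rightarrow> real^'m \<Rightarrow> (real^'n) \<times> (real^'m) \<times> (real^'m^'n)" where
  "contact_normal z e = (- (\<chi> i. snd (snd z) $ i \<bullet> e), e, 0)"

lemma contact_plane_iff: "v \<in> contact_plane z \<longleftrightarrow> (\<forall>e\<in>Basis. v \<bullet> contact_normal z e = 0)"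
proof -
  obtain dx du dp where v: "v = (dx, du, dp)" by (cases v) auto
  have "v \<bullet> contact_normal z e = du \<bullet> e - (\<Sum>i\<in>UNIV. (dx $ i) *\<^sub>R (snd (snd z) $ i)) \<bullet> e" for e
    by (simp add: v contact_normal_def inner_vec_def[of dx] inner_sum_left sum_negf)
  then have "(\<forall>e\<in>Basis. v \<bullet> contact_normal z e = 0) \<longleftrightarrow>
      (\<forall>e\<in>Basis. du \<bullet> e = (\<Sum>i\<in>UNIV. (dx $ i) *\<^sub>R (snd (snd z) $ i)) \<bullet> e)"
    by simp
  also have "\<dots> \<longleftrightarrow> du = (\<Sum>i\<in>UNIV. (dx $ i) *\<^sub>R (snd (snd z) $ i))"
    by (rule euclidean_eq_iff[symmetric])
  finally show ?thesis by (simp add: v contact_plane_def)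
qed

context jet_bundle
begin

text \<open>Only an inclusion of contact planes is asked. Once source and target are fixed, this is
  linear in the first derivatives of f, with no reference to its inverse.\<close>

definition contact_at :: "('b, 'e) jet \<Rightarrow> (('b, 'e) jet \<Rightarrow> ('b, 'e) jet) \<Rightarrow> bool" where
  "contact_at \<theta> f \<longleftrightarrow> (\<forall>(V, c)\<in>J1. \<forall>(W, d)\<in>J1. \<theta> \<in> V \<and> f \<theta> \<in> W \<longrightarrow>
     (\<forall>v\<in>contact_plane (c \<theta>). dd v (d \<circ> f \<circ> inv_into V c) (c \<theta>) \<in> contact_plane (d (f \<theta>))))"

lemma contact_atD:
  assumes "contact_at \<theta> f" "(V, c) \<in> J1" "(W, d) \<in> J1" "\<theta> \<in> V" "f \<theta> \<in> W" "v \<in> contact_plane (c \<theta>)"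
  shows "dd v (d \<circ> f \<circ> inv_into V c) (c \<theta>) \<in> contact_plane (d (f \<theta>))"
  using assms unfolding contact_at_def by blast

lemma contact_atI:
  assumes "\<And>V c W d v. (V, c) \<in> J1 \<Longrightarrow> (W, d) \<in> J1 \<Longrightarrow> \<theta> \<in> V \<Longrightarrow> f \<theta> \<in> W \<Longrightarrow> v \<in> contact_plane (c \<theta>) \<Longrightarrow>
    dd v (d \<circ> f \<circ> inv_into V c) (c \<theta>) \<in> contact_plane (d (f \<theta>))"
  shows "contact_at \<theta> f"
  unfolding contact_at_def using assms by blast

text \<open>Over fixed source and target both contact planes are fixed, so each pair of a vector of
  one plane and a normal of the other gives one equation of first order.\<close>

lemma contact_at_algebraic: "algebraic_at J1 (max 1 k) a b (contact_at a)"
proof -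
  note A = smooth_atlas_J1
  have 1: "algebraic_at J1 1 a b (\<lambda>f. \<forall>v\<in>contact_plane (c a).
      dd v (d \<circ> f \<circ> inv_into V c) (c a) \<in> contact_plane (d b))"
    if V: "(V, c) \<in> J1" "a \<in> V" and W: "(W, d) \<in> J1" "b \<in> W" for V c W d
  proof -
    \<comment> \<open>The pairing of the image of v with a contact normal at b, written as a linear
      form in the first-order jet coordinates w.\<close>
    define q where "q v e = (\<lambda>w. \<Sum>x\<in>Basis. \<Sum>y\<in>Basis. (v \<bullet> x) * (contact_normal (d b) e \<bullet> y) * w ([x], y))"
      for v :: "(real^'n) \<times> (real^'m) \<times> (real^'m^'n)" and e :: "real^'m"
    let ?P = "{q v e | v e. v \<in> contact_plane (c a) \<and> e \<in> Basis}"
    show ?thesis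
    proof (rule algebraic_atI[OF A atlas_chart[OF A V(1)] V(2) atlas_chart[OF A W(1)] W(2), where P = ?P])
      fix p assume "p \<in> ?P"
      then obtain v e where p: "p = q v e" by blast
      show "polynomial_fun (jet_vars 1) p"
        unfolding p q_def by (intro polynomial_fun_sum polynomial_fun.mult polynomial_fun.const polynomial_fun.var)
          (simp add: jet_vars_def)
    next
      fix f assume f: "diffeo_at J1 a f" "f a = b"
      let ?f = "d \<circ> f \<circ> inv_into V c"
      have "smooth_near (c a) ?f"
        using smooth_at_local[OF A A atlas_chart[OF A V(1)] atlas_chart[OF A W(1)] V(2) _ diffeo_at_smooth[OF f(1)]]
          W(2) f(2) by simp
      then have df: "?f differentiable (at (c a))" by (rule smooth_near_differentiable)
      have q: "dd v ?f (c a) \<bullet> contact_normal (d b) e = q v e (jet_coords V c d a f)" for v e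
      proof -
        have "dd x ?f (c a) \<bullet> contact_normal (d b) e =
            (\<Sum>y\<in>Basis. (contact_normal (d b) e \<bullet> y) * jet_coords V c d a f ([x], y))" for x
          using euclidean_inner[of "dd x ?f (c a)" "contact_normal (d b) e"]
          by (simp add: jet_coords_def iter_deriv_Cons mult.commute del: iter_deriv.simps(2))
        then show ?thesis
          unfolding q_def
          by (simp add: dd_linear_combination[OF df, of v] inner_sum_left sum_distrib_left mult.assoc
              del: iter_deriv.simps)
      qed
      show "(\<forall>v\<in>contact_plane (c a). dd v ?f (c a) \<in> contact_plane (d b)) \<longleftrightarrow>
          (\<forall>p\<in>?P. p (jet_coords V c d a f) = 0)"
        unfolding contact_plane_iff[of _ "d b"] q by blast
    qed
  qed
  define I where "I = {((V, c), (W, d)) | V c W d. (V, c) \<in> J1 \<and> (W, d) \<in> J1 \<and> a \<in> V \<and> b \<in> W}"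
  have "algebraic_at J1 1 a b (\<lambda>f. \<forall>i\<in>I. (\<lambda>((V, c), (W, d)) f. \<forall>v\<in>contact_plane (c a).
      dd v (d \<circ> f \<circ> inv_into V c) (c a) \<in> contact_plane (d b)) i f)"
    by (rule algebraic_at_Ball) (use 1 in \<open>auto simp: I_def\<close>)
  then have "algebraic_at J1 1 a b (contact_at a)"
    by (rule algebraic_at_cong[rotated]) (fastforce simp: I_def contact_at_def)
  then show ?thesis by (rule algebraic_at_mono) simp
qed

text \<open>The derivatives of f and of its inverse are mutually inverse, so the two inclusions
  together amount to equality of the planes.\<close>

lemma contact_diffeo_iff:
  "contact_diffeo E M \<pi> S f \<longleftrightarrow>
    local_diffeo J1 J1 S f \<and> (\<forall>a\<in>S. contact_at a f \<and> contact_at (f a) (inv_into S f))"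
proof (cases "local_diffeo J1 J1 S f")
  case l: True
  note A = smooth_atlas_J1
  let ?g = "inv_into S f"
  have fg: "dd (dd v (d \<circ> f \<circ> inv_into V c) (c a)) (c \<circ> ?g \<circ> inv_into W d) (d (f a)) = v"
    "dd (dd v (c \<circ> ?g \<circ> inv_into W d) (d (f a))) (d \<circ> f \<circ> inv_into V c) (c a) = v"
    if a: "a \<in> S" and V: "(V, c) \<in> J1" "a \<in> V" and W: "(W, d) \<in> J1" "f a \<in> W" for a V c W d v
  proof -
    note g = local_diffeo_germs[OF l a]
    note cV = atlas_chart[OF A V(1)] V(2) and cW = atlas_chart[OF A W(1)] W(2)
    show "dd (dd v (d \<circ> f \<circ> inv_into V c) (c a)) (c \<circ> ?g \<circ> inv_into W d) (d (f a)) = v"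
      by (rule dd_inverse_germs[OF A cV cW g(1,2,3)])
    show "dd (dd v (c \<circ> ?g \<circ> inv_into W d) (d (f a))) (d \<circ> f \<circ> inv_into V c) (c a) = v"
      using dd_inverse_germs[OF A cW cV(1) _ g(2) _ g(4), of v] cV(2) g(1,5) by simp
  qed
  have image: "frechet_derivative h (at z) ` T = (\<lambda>v. dd v h z) ` T"
    for h :: "(real^'n) \<times> (real^'m) \<times> (real^'m^'n) \<Rightarrow> (real^'n) \<times> (real^'m) \<times> (real^'m^'n)" and z T
    by (simp add: dd_def)
  show ?thesis
  proof
    assume "contact_diffeo E M \<pi> S f"
    then have e: "(\<lambda>v. dd v (d \<circ> f \<circ> inv_into V c) (c a)) ` contact_plane (c a) = contact_plane (d (f a))"
      if "a \<in> S" "(V, c) \<in> J1" "a \<in> V" "(W, d) \<in> J1" "f a \<in> W" for a V c W d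
      using that unfolding contact_diffeo_def image by blast
    have "contact_at a f \<and> contact_at (f a) ?g" if a: "a \<in> S" for a
    proof
      show "contact_at a f" by (rule contact_atI) (use e[OF a] in blast)
      have ga: "?g (f a) = a" using local_diffeo_germs(5)[OF l a] .
      show "contact_at (f a) ?g"
      proof (rule contact_atI, unfold ga)
        fix W d V c v assume h: "(W, d) \<in> J1" "(V, c) \<in> J1" "f a \<in> W" "a \<in> V" "v \<in> contact_plane (d (f a))"
        obtain u where u: "u \<in> contact_plane (c a)" "v = dd u (d \<circ> f \<circ> inv_into V c) (c a)"
          using e[OF a h(2,4,1,3)] h(5) by blast
        show "dd v (c \<circ> ?g \<circ> inv_into W d) (d (f a)) \<in> contact_plane (c a)"
          unfolding u(2) fg(1)[OF a h(2,4,1,3)] by (rule u(1))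
      qed
    qed
    then show "local_diffeo J1 J1 S f \<and> (\<forall>a\<in>S. contact_at a f \<and> contact_at (f a) ?g)" using l by blast
  next
    assume h: "local_diffeo J1 J1 S f \<and> (\<forall>a\<in>S. contact_at a f \<and> contact_at (f a) ?g)"
    have "(\<lambda>v. dd v (d \<circ> f \<circ> inv_into V c) (c a)) ` contact_plane (c a) = contact_plane (d (f a))"
      if a: "a \<in> S" and V: "(V, c) \<in> J1" "a \<in> V" and W: "(W, d) \<in> J1" "f a \<in> W" for a V c W d
    proof
      have B: "contact_at a f" "contact_at (f a) ?g" using h a by blast+
      have ga: "?g (f a) = a" using local_diffeo_germs(5)[OF l a] .
      show "(\<lambda>v. dd v (d \<circ> f \<circ> inv_into V c) (c a)) ` contact_plane (c a) \<subseteq> contact_plane (d (f a))"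
        using contact_atD[OF B(1) V(1) W(1) V(2) W(2)] by blast
      show "contact_plane (d (f a)) \<subseteq> (\<lambda>v. dd v (d \<circ> f \<circ> inv_into V c) (c a)) ` contact_plane (c a)"
      proof
        fix v assume v: "v \<in> contact_plane (d (f a))"
        have "dd v (c \<circ> ?g \<circ> inv_into W d) (d (f a)) \<in> contact_plane (c a)"
          using contact_atD[OF B(2) W(1) V(1) W(2) _ v] V(2) unfolding ga by blast
        then show "v \<in> (\<lambda>v. dd v (d \<circ> f \<circ> inv_into V c) (c a)) ` contact_plane (c a)"
          using fg(2)[OF a V W, of v] by (intro image_eqI[where x = "dd v (c \<circ> ?g \<circ> inv_into W d) (d (f a))"]) simp_all
      qed
    qed
    then show "contact_diffeo E M \<pi> S f" unfolding contact_diffeo_def image using l by blast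
  qed
next
  case False then show ?thesis unfolding contact_diffeo_def by blast
qed

lemma J_dom1_iff: "sect x s \<Longrightarrow> J x s \<in> dom1 U \<longleftrightarrow> s x \<in> U"
proof
  assume s: "sect x s" and "J x s \<in> dom1 U"
  then obtain y r where r: "sect y r" "r y \<in> U" "J x s = J y r" unfolding dom1_iff by blast
  have "s x = r y" using jet1_target[OF s] jet1_target[OF r(1)] r(3) by simp
  then show "s x \<in> U" using r(2) by simp
qed (rule J_dom1)

text \<open>The image of the graph of \<open>j\<^sup>1 s\<close> is tangent to the contact distribution, and a section of
  1-jets tangent to it is the 1-jet of its underlying section.\<close>

lemma contact_image_holonomic:
  assumes f: "local_diffeo J1 J1 S f" and contact: "\<And>\<theta>. \<theta> \<in> S \<Longrightarrow> contact_at \<theta> f" and a: "a \<in> S"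
    and s: "sect (fst a) s" "J (fst a) s = a"
    and t: "section_at J1 M fst (fst (f a)) t" "t (fst (f a)) = f a"
    and tr: "transports M fst (fst a) f (lift s) t"
  shows "\<exists>r. sect (fst (f a)) r \<and> J (fst (f a)) r = f a \<and> near M (fst (f a)) (\<lambda>y. lift r y = t y)"
proof -
  note A = smooth_atlas_J1
  note g = local_diffeo_germs[OF f a]
  obtain U \<psi> \<kappa> where U: "bundle_chart U \<psi> \<kappa>" "a \<in> dom1 U"
    using J1_carrierE[OF smooth_at_carrier(1)[OF g(1)]] by metis
  obtain U' \<psi>' \<kappa>' where U': "bundle_chart U' \<psi>' \<kappa>'" "f a \<in> dom1 U'"
    using J1_carrierE[OF smooth_at_carrier(2)[OF g(1)]] by metis
  let ?c = "jet1_chart \<pi> U \<psi> \<kappa>" and ?c' = "jet1_chart \<pi> U' \<psi>' \<kappa>'"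
  define x where "x = fst a"
  define x' where "x' = fst (f a)"
  have sx: "s x \<in> U" using J_dom1_iff[OF s(1), of U] U(2) s(2) by (simp add: x_def)
  have s': "sect x s" using s(1) by (simp add: x_def)
  interpret T: section_transport J1 M fst "dom1 U" ?c \<kappa> a "dom1 U'" ?c' \<kappa>' "f a" "lift s"
    by standard (use A M J1_adapted[OF U(1)] J1_adapted[OF U'(1)] U(2) U'(2) lift_section[OF s(1)] s(2)
      in \<open>simp_all add: lift_def\<close>)
  have fg: "f \<in> T.germs" unfolding T.germs_def diffeo_at_def using f a by blast
  have ti: "t \<in> T.image_sections f" unfolding T.image_sections_def using t tr by blast
  define u where "u = u_loc U \<psi> \<kappa> s"
  have x0: "T.x0 = \<kappa> x" by (simp add: T.x0_def x_def)
  note dom = fst_dom1[OF U(1)] and dom' = fst_dom1[OF U'(1)]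
  note xU = sect_base[OF s' sx]
  have u: "smooth_near T.x0 u" unfolding x0 u_def by (rule loc_smooth(2)[OF U(1) sectD(1)[OF s'] sx xU])
  let ?l = "\<lambda>z. (z, u z, \<chi> i. dd (axis i 1) u z)"
  have sl: "eventually (\<lambda>z. T.s_loc z = ?l z) (nhds T.x0)"
    using lift_loc[OF U(1) s' sx] unfolding T.s_loc_def dom x0 u_def .
  \<comment> \<open>In coordinates the prolonged section is (z, u, du), and its derivative satisfies
    du = p dx identically.\<close>
  have tangent: "eventually (\<lambda>y. \<forall>v. dd v T.s_loc y \<in> contact_plane (T.s_loc y)) (nhds T.x0)"
    using sl[THEN eventually_eventually[THEN iffD2]] sl smooth_near_eventually[OF u]
  proof eventually_elim
    case (elim y)
    have q: "smooth_near y (\<lambda>z. \<chi> i. dd (axis i 1) u z)"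
      by (intro smooth_near_vec_lambda smooth_near_dd elim(3) axis_1_Basis)
    have d: "dd v T.s_loc y = (v, dd v u y, dd v (\<lambda>z. \<chi> i. dd (axis i 1) u z) y)" for v
      unfolding dd_cong[OF elim(1)] dd_Pair[OF smooth_near_id smooth_near_Pair[OF elim(3) q]]
        dd_Pair[OF elim(3) q] dd_ident ..
    show ?case
    proof
      fix v
      show "dd v T.s_loc y \<in> contact_plane (T.s_loc y)"
        using dd_vec[OF smooth_near_differentiable[OF elim(3)], of v]
        unfolding d elim(2) contact_plane_def by simp
    qed
  qed
  have "near M x (\<lambda>m. lift s m \<in> S)"
    using smooth_at_vimage[OF M A T.s_smooth, of "\<lambda>p. p \<in> S"] near_mopen[of J1 S a] f a s(2)
    unfolding local_diffeo_def x_def lift_def by simp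
  then have "near M (fst a) (\<lambda>m. (m \<in> fst ` dom1 U \<and> lift s m \<in> dom1 U \<and> f (lift s m) \<in> dom1 U' \<and> fst (lift s m) = m)
      \<and> lift s m \<in> S)"
    unfolding x_def by (intro near_conj[OF M T.near_domains[OF fg]])
  \<comment> \<open>Contactness enters at every jet of the graph near a; this is where contactness
    at the single jet a would not be enough.\<close>
  from this[unfolded T.near_base]
  have con: "eventually (\<lambda>y. \<forall>v\<in>contact_plane (T.s_loc y).
      dd v (T.f_loc f) (T.s_loc y) \<in> contact_plane (T.f_loc f (T.s_loc y))) (nhds T.x0)"
  proof eventually_elim
    case (elim y)
    let ?\<theta> = "lift s (inv_into (fst ` dom1 U) \<kappa> y)"
    have "T.s_loc y = ?c ?\<theta>" by (simp add: T.s_loc_def)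
    moreover have "T.f_loc f (?c ?\<theta>) = ?c' (f ?\<theta>)" using elim by (simp add: T.f_loc_def T.inv_chart)
    ultimately show ?case
      using contact_atD[OF contact J1_chart[OF U(1)] J1_chart[OF U'(1)], of ?\<theta>] elim
      by (simp add: T.f_loc_def)
  qed
  let ?X = "T.X f" and ?t = "T.t_loc t"
  have z0: "?X T.x0 = \<kappa>' x'" using T.X_x0[OF fg] by (simp add: x'_def)
  have st: "smooth_near (\<kappa>' x') ?t" using T.t_loc_smooth[OF ti] by (simp add: x'_def)
  have pair: "eventually (\<lambda>y. T.f_loc f (T.s_loc y) = (?X y, ?t (?X y))) (nhds T.x0)"
    using T.t_loc_X[OF fg ti] by eventually_elim (simp add: T.X_def prod_eq_iff)
  have nd: "jdet ?X T.x0 \<noteq> 0" by (rule T.X_nondegenerate[OF fg ti])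
  have sX: "smooth_near T.x0 ?X" by (rule T.X_smooth[OF fg])
  have ev1: "eventually (\<lambda>y. jdet ?X y \<noteq> 0) (nhds T.x0)"
    using smooth_near_filterlim[OF smooth_near_jdet[OF sX]] nd by (metis tendsto_imp_eventually_ne)
  have ev2: "eventually (\<lambda>y. smooth_near (?X y) ?t) (nhds T.x0)"
    using eventually_compose_filterlim[OF smooth_near_eventually[OF st], of ?X] smooth_near_filterlim[OF sX]
    unfolding z0 by blast
  have ev3: "eventually (\<lambda>y. smooth_near (T.s_loc y) (T.f_loc f)) (nhds T.x0)"
    using eventually_compose_filterlim[OF smooth_near_eventually[OF T.f_loc(1)[OF fg]], of T.s_loc]
      smooth_near_filterlim[OF T.s_loc(1)] unfolding T.s_loc(2) by blast
  let ?H = "\<lambda>z. \<forall>w. fst (dd w ?t z) = (\<Sum>i\<in>UNIV. (w $ i) *\<^sub>R (snd (?t z) $ i))"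
  \<comment> \<open>Tangency of the image says that the derivative of the first component of t is
    prescribed by its second component. It is obtained for directions of the form
    \<open>dd v ?X y\<close> and then extended to all directions w.\<close>
  have HX: "eventually (\<lambda>y. ?H (?X y)) (nhds T.x0)"
    using tangent con pair pair[THEN eventually_eventually[THEN iffD2]] ev1 ev2 ev3
      smooth_near_eventually[OF sX] smooth_near_eventually[OF T.s_loc(1)]
  proof eventually_elim
    case (elim y)
    have H: "fst (dd (dd v ?X y) ?t (?X y)) = (\<Sum>i\<in>UNIV. (dd v ?X y $ i) *\<^sub>R (snd (?t (?X y)) $ i))" for v
    proof -
      have "dd (dd v T.s_loc y) (T.f_loc f) (T.s_loc y) = dd v (\<lambda>y. T.f_loc f (T.s_loc y)) y"
        by (rule dd_compose[symmetric]) (intro smooth_near_differentiable elim(9,7))+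
      also have "\<dots> = dd v (\<lambda>y. (?X y, ?t (?X y))) y" by (rule dd_cong[OF elim(4)])
      also have "\<dots> = (dd v ?X y, dd v (\<lambda>y. ?t (?X y)) y)"
        by (rule dd_Pair[OF elim(8) smooth_near_compose[OF elim(8,6)]])
      also have "dd v (\<lambda>y. ?t (?X y)) y = dd (dd v ?X y) ?t (?X y)"
        by (rule dd_compose) (intro smooth_near_differentiable elim(8,6))+
      finally have "(dd v ?X y, dd (dd v ?X y) ?t (?X y)) \<in> contact_plane (?X y, ?t (?X y))"
        using elim(1,2,3) by metis
      then show ?thesis by (simp add: contact_plane_def case_prod_unfold)
    qed
    show ?case
    proof
      fix w
      have l: "linear (\<lambda>v. dd v ?X y)"
        using has_derivative_dd[OF smooth_near_differentiable[OF elim(8)]] has_derivative_linear by blast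
      \<comment> \<open>Coefficients of a preimage of w under the derivative of X, by Cramer's
        rule.\<close>
      let ?k = "\<lambda>i. inverse (jdet ?X y) * jcof ?X i w y"
      have w: "dd (\<Sum>i\<in>UNIV. ?k i *\<^sub>R basis_vec i) ?X y = w"
        using jacobian_cramer[OF elim(5), of w] linear_sum[OF l, of "\<lambda>i. ?k i *\<^sub>R basis_vec i" UNIV]
        by (simp add: linear_cmul[OF l])
      show "fst (dd w ?t (?X y)) = (\<Sum>i\<in>UNIV. (w $ i) *\<^sub>R (snd (?t (?X y)) $ i))"
        using H[of "\<Sum>i\<in>UNIV. ?k i *\<^sub>R basis_vec i"] unfolding w .
    qed
  qed
  obtain Y where Y: "smooth_near (?X T.x0) Y" "Y (?X T.x0) = T.x0"
    "eventually (\<lambda>y. Y (?X y) = y) (nhds T.x0)" "eventually (\<lambda>z. ?X (Y z) = z) (nhds (?X T.x0))"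
    by (rule smooth_inverse_function[OF sX nd]) (rule that)
  have fl: "filterlim Y (nhds T.x0) (nhds (\<kappa>' x'))"
    using smooth_near_filterlim[OF Y(1), unfolded Y(2)] by (simp only: z0)
  \<comment> \<open>The relation holds along X; composing with the local inverse Y spreads it over a
    neighbourhood in the base.\<close>
  have "eventually (\<lambda>z. ?H (?X (Y z))) (nhds (\<kappa>' x'))"
    by (rule eventually_compose_filterlim[OF HX fl])
  then have H: "eventually ?H (nhds (\<kappa>' x'))"
    using Y(4) unfolding z0 by eventually_elim simp
  \<comment> \<open>The u-component of t defines the underlying section r; by H its first
    derivatives form the p-component of t, so t is the prolongation of r.\<close>
  define u' where "u' = (\<lambda>z. fst (?t z))"
  have u': "smooth_near (\<kappa>' x') u'" unfolding u'_def by (rule smooth_near_fst[OF st])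
  have du': "eventually (\<lambda>z. \<forall>i. dd (axis i 1) u' z = snd (?t z) $ i) (nhds (\<kappa>' x'))"
    using H smooth_near_eventually[OF st]
  proof eventually_elim
    case (elim z)
    show ?case
    proof
      fix i
      have "dd (axis i 1) u' z = (\<Sum>j\<in>UNIV. (axis i 1 $ j) *\<^sub>R (snd (?t z) $ j))"
        unfolding u'_def dd_fst[OF elim(2)] using elim(1) by blast
      also have "\<dots> = snd (?t z) $ i"
        by (simp add: axis_def if_distrib[of "\<lambda>c. c *\<^sub>R _"] sum.delta cong: if_cong)
      finally show "dd (axis i 1) u' z = snd (?t z) $ i" .
    qed
  qed
  have x'U: "x' \<in> \<pi> ` U'" using U'(2) dom' unfolding x'_def by blast
  have tx: "?t (\<kappa>' x') = snd (?c' (f a))"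
    using T.inv_chart(2)[of x'] x'U t(2) unfolding dom' by (simp add: T.t_loc_def dom' x'_def)
  have "(fst (?c' (f a)), fst (snd (?c' (f a)))) \<in> \<psi>' ` U'"
    using jet1_chart_image[OF U'(1) order_refl] U'(2) by blast
  moreover have "fst (?c' (f a)) = \<kappa>' x'" by (simp add: jet1_chart_def Let_def x'_def)
  ultimately have "(\<kappa>' x', u' (\<kappa>' x')) \<in> \<psi>' ` U'" by (simp add: u'_def tx)
  then obtain y r where r: "y \<in> \<pi> ` U'" "\<kappa>' y = \<kappa>' x'" "sect y r" "r y \<in> U'"
    "eventually (\<lambda>z. u_loc U' \<psi>' \<kappa>' r z = u' z) (nhds (\<kappa>' x'))"
    by (rule section_from_loc[OF U'(1) u']) (rule that)
  have y: "y = x'" using inj_onD[OF chartD(2)[OF bundle_chartD(2)[OF U'(1)]] r(2) r(1) x'U] .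
  note r = r(3,4,5)[unfolded y]
  have "near M x' (\<lambda>m. t m \<in> dom1 U')"
    using smooth_at_vimage[OF M A T.image_sectionsD(1)[OF ti], of "\<lambda>p. p \<in> dom1 U'"]
      near_mopen[OF chartD(1)[OF T.charts(3)] U'(2)] t(2) by (simp add: x'_def)
  then have n: "near M x' (\<lambda>m. (m \<in> \<pi> ` U' \<and> sect m r \<and> r m \<in> U') \<and> fst (t m) = m \<and> t m \<in> dom1 U')"
    using T.image_sectionsD(4)[OF ti] unfolding x'_def[symmetric]
    by (intro near_conj[OF M] sect_near_domain[OF U'(1) r(1,2)])
  have "near M x' (\<lambda>m. lift r m = t m)"
    unfolding base_near[OF U'(1) x'U]
    using n[unfolded base_near[OF U'(1) x'U]] lift_loc[OF U'(1) r(1,2)] du' r(3)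
      r(3)[THEN eventually_eventually[THEN iffD2]] base_inv(2)[OF U'(1) x'U]
  proof eventually_elim
    case (elim z)
    let ?m = "inv_into (\<pi> ` U') \<kappa>' z"
    have "?c' (lift r ?m) = (z, u' z, \<chi> i. dd (axis i 1) u' z)"
      using elim(2,4) dd_cong[OF elim(5)] by simp
    also have "\<dots> = (z, ?t z)" using elim(3) by (simp add: u'_def prod_eq_iff vec_eq_iff)
    also have "\<dots> = ?c' (t ?m)"
      using elim(1,6) by (simp add: T.t_loc_def dom' prod_eq_iff jet1_chart_def Let_def)
    finally show ?case
      using elim(1) by (intro inj_onD[OF jet1_chart_inj[OF U'(1)]]) (simp_all add: lift_def J_dom1)
  qed
  moreover from near_point[OF this] have "J x' r = f a" using t(2) by (simp add: lift_def x'_def)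
  ultimately show ?thesis using r(1) unfolding x'_def by blast
qed

text \<open>A derivative of u of order at least 2 is a derivative, of one order less, of the
  p-component of the prolonged section. A first derivative is that component itself, a constant once
  \<theta> is fixed.\<close>

lemma lifted_equation:
  assumes eq: "algebraic_equation E M \<pi> Q" and \<theta>: "\<theta> \<in> carrier J1"
  shows "\<exists>U \<omega> \<kappa> P. adapted J1 M fst U \<omega> \<kappa> \<and> \<theta> \<in> U \<and> (\<forall>p\<in>P. polynomial_fun (jet_vars k) p) \<and>
    (\<forall>s. sect (fst \<theta>) s \<and> J (fst \<theta>) s = \<theta> \<longrightarrow>
      (jet M E k (fst \<theta>) s \<in> Q k \<longleftrightarrow>
        (\<forall>p\<in>P. p (jet_coords (fst ` U) \<kappa> (snd \<circ> \<omega>) (fst \<theta>) (lift s)) = 0)))"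
proof -
  obtain U \<psi> \<kappa> where U: "bundle_chart U \<psi> \<kappa>" "\<theta> \<in> dom1 U" by (rule J1_carrierE[OF \<theta>])
  let ?c = "jet1_chart \<pi> U \<psi> \<kappa>"
  define e where "e = jet_target \<theta>"
  define x where "x = fst \<theta>"
  have e: "e \<in> U" using U(2) unfolding jet1_domain_def e_def by simp
  have pe: "\<pi> e = x"
    using U(2) jet1_target sectD(2) unfolding dom1_iff e_def x_def by fastforce
  obtain P where P: "\<forall>p\<in>P. polynomial_fun (jet_vars k) p"
    "\<forall>s. local_section E M \<pi> (\<pi> e) s \<and> s (\<pi> e) = e \<longrightarrow>
      (jet M E k (\<pi> e) s \<in> Q k \<longleftrightarrow> (\<forall>p\<in>P. p (jet_coords (\<pi> ` U) \<kappa> (snd \<circ> \<psi>) (\<pi> e) s) = 0))"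
    using eq U(1) e unfolding algebraic_equation_def by blast
  \<comment> \<open>The last direction of \<sigma> is differentiated first and is absorbed into p,
    leaving \<open>butlast \<sigma>\<close> for the prolonged section. The sums with weights
    \<open>last \<sigma> $ i\<close> merely select a component of p. If no direction is left, the
    value is taken from \<theta>, since \<open>jet_vars\<close> starts at length 1.\<close>
  define q where "q = (\<lambda>(\<sigma>, b) w. if butlast \<sigma> = [] then (\<Sum>i\<in>UNIV. (last \<sigma> $ i) * (snd (snd (?c \<theta>)) $ i \<bullet> b))
      else (\<Sum>i\<in>UNIV. (last \<sigma> $ i) * w (butlast \<sigma>, (0 :: real^'m, axis i b))))"
  let ?P = "(\<lambda>p w. p (\<lambda>j. q j w)) ` P"
  have q: "polynomial_fun (jet_vars k) (q j)" if j: "j \<in> jet_vars k" for j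
  proof -
    obtain \<sigma> b where \<sigma>: "j = (\<sigma>, b)" "set \<sigma> \<subseteq> Basis" "length \<sigma> \<le> k" "b \<in> Basis"
      using j unfolding jet_vars_def by blast
    show ?thesis
    proof (cases "butlast \<sigma> = []")
      case True then show ?thesis by (simp add: q_def \<sigma>(1) polynomial_fun.const)
    next
      case False
      have "set (butlast \<sigma>) \<subseteq> Basis" using \<sigma>(2) in_set_butlastD by fast
      then have "(butlast \<sigma>, (0, axis i b)) \<in> jet_vars k" for i
        using False \<sigma>(3,4) by (simp add: jet_vars_def axis_in_Basis_iff Basis_prod_def)
      then have "polynomial_fun (jet_vars k) (\<lambda>w. \<Sum>i\<in>UNIV. (last \<sigma> $ i) * w (butlast \<sigma>, (0, axis i b)))"
        by (intro polynomial_fun_sum polynomial_fun.mult polynomial_fun.const polynomial_fun.var)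
      then show ?thesis using False by (simp add: q_def \<sigma>(1))
    qed
  qed
  have "\<forall>p\<in>?P. polynomial_fun (jet_vars k) p"
  proof -
    have "polynomial_fun (jet_vars k) (\<lambda>w. p (\<lambda>j. q j w))" if "p \<in> P" for p
      by (rule polynomial_fun_compose[OF P(1)[rule_format, OF that] q])
    then show ?thesis by blast
  qed
  moreover have "jet M E k (fst \<theta>) s \<in> Q k \<longleftrightarrow>
      (\<forall>p\<in>?P. p (jet_coords (fst ` dom1 U) \<kappa> (snd \<circ> ?c) (fst \<theta>) (lift s)) = 0)"
    if s: "sect (fst \<theta>) s" "J (fst \<theta>) s = \<theta>" for s
  proof -
    have s1: "sect x s" "J x s = \<theta>" using s by (simp_all add: x_def)
    have se: "s x = e" using jet1_target[OF s1(1)] s1(2) by (simp add: e_def)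
    then have sU: "s x \<in> U" using e by simp
    note xU = sect_base[OF s1(1) sU]
    define u where "u = u_loc U \<psi> \<kappa> s"
    have u: "smooth_near (\<kappa> x) u" unfolding u_def by (rule loc_smooth(2)[OF U(1) sectD(1)[OF s1(1)] sU xU])
    let ?h = "\<lambda>z. (u z, \<chi> i. dd (axis i 1) u z)"
    have h: "smooth_near (\<kappa> x) ?h"
      by (intro smooth_near_Pair u smooth_near_vec_lambda smooth_near_dd axis_1_Basis)
    have lh: "eventually (\<lambda>z. (snd \<circ> ?c \<circ> lift s \<circ> inv_into (\<pi> ` U) \<kappa>) z = ?h z) (nhds (\<kappa> x))"
      using lift_loc[OF U(1) s1(1) sU] by eventually_elim (simp add: u_def)
    have cth: "snd (snd (?c \<theta>)) $ i = dd (axis i 1) u (\<kappa> x)" for i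
      using jet1_chart_J[OF U(1) s1(1) sU] s1(2) by (simp add: u_def)
    have pick: "(\<Sum>i\<in>UNIV. (axis j 1 $ i) * g i) = g j" for j :: 'n and g :: "'n \<Rightarrow> real"
      by (simp add: axis_def if_distrib[of "\<lambda>c. c * _"] sum.delta cong: if_cong)
    have "jet_coords (\<pi> ` U) \<kappa> (snd \<circ> \<psi>) x s j = q j (jet_coords (\<pi> ` U) \<kappa> (snd \<circ> ?c) x (lift s))"
      if j: "j \<in> jet_vars k" for j
    proof -
      obtain \<sigma> b where \<sigma>: "j = (\<sigma>, b)" "set \<sigma> \<subseteq> Basis" "0 < length \<sigma>" "b \<in> Basis"
        using j unfolding jet_vars_def by blast
      then obtain \<tau> v where \<tau>: "\<sigma> = \<tau> @ [v]" by (metis length_greater_0_conv rev_exhaust)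
      then have v: "v \<in> Basis" and \<tau>B: "set \<tau> \<subseteq> Basis" using \<sigma>(2) by auto
      obtain i where i: "v = axis i 1" using v by (rule Basis_realvecE)
      have L: "jet_coords (\<pi> ` U) \<kappa> (snd \<circ> \<psi>) x s j = iter_deriv \<tau> (dd (axis i 1) u) (\<kappa> x) \<bullet> b"
        by (simp add: jet_coords_def \<sigma>(1) \<tau> i iter_deriv_snoc u_def u_loc_def)
      show ?thesis
      proof (cases "\<tau> = []")
        case True
        then show ?thesis unfolding L by (simp add: q_def \<sigma>(1) \<tau> i pick cth)
      next
        case False
        have "jet_coords (\<pi> ` U) \<kappa> (snd \<circ> ?c) x (lift s) (\<tau>, (0, axis i b)) =
            iter_deriv \<tau> ?h (\<kappa> x) \<bullet> (0, axis i b)"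
          unfolding jet_coords_def using iter_deriv_cong[OF lh] by (simp add: comp_def)
        also have "\<dots> = iter_deriv \<tau> (\<lambda>z. ?h z \<bullet> (0, axis i b)) (\<kappa> x)"
          by (rule iter_deriv_inner[OF h \<tau>B, symmetric])
        also have "\<dots> = iter_deriv \<tau> (\<lambda>z. dd (axis i 1) u z \<bullet> b) (\<kappa> x)"
          by (simp add: inner_axis)
        also have "\<dots> = iter_deriv \<tau> (dd (axis i 1) u) (\<kappa> x) \<bullet> b"
          by (rule iter_deriv_inner[OF smooth_near_dd[OF axis_1_Basis u] \<tau>B])
        finally show ?thesis unfolding L using False by (simp add: q_def \<sigma>(1) \<tau> i pick)
      qed
    qed
    then have p: "p (jet_coords (\<pi> ` U) \<kappa> (snd \<circ> \<psi>) x s) =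
        p (\<lambda>j. q j (jet_coords (\<pi> ` U) \<kappa> (snd \<circ> ?c) x (lift s)))" if "p \<in> P" for p
      by (rule polynomial_fun_cong[OF P(1)[rule_format, OF that]])
    have "jet M E k x s \<in> Q k \<longleftrightarrow> (\<forall>p\<in>P. p (jet_coords (\<pi> ` U) \<kappa> (snd \<circ> \<psi>) x s) = 0)"
      using P(2) s1(1) se unfolding pe local_section_iff[OF M] by blast
    also have "\<dots> \<longleftrightarrow> (\<forall>p\<in>P. p (\<lambda>j. q j (jet_coords (\<pi> ` U) \<kappa> (snd \<circ> ?c) x (lift s))) = 0)"
      by (intro ball_cong refl arg_cong[where f = "\<lambda>r. r = 0"] p)
    finally show ?thesis unfolding fst_dom1[OF U(1)] x_def[symmetric] by simp
  qed
  ultimately have "adapted J1 M fst (dom1 U) ?c \<kappa> \<and> \<theta> \<in> dom1 U \<and> (\<forall>p\<in>?P. polynomial_fun (jet_vars k) p) \<and>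
    (\<forall>s. sect (fst \<theta>) s \<and> J (fst \<theta>) s = \<theta> \<longrightarrow>
      (jet M E k (fst \<theta>) s \<in> Q k \<longleftrightarrow>
        (\<forall>p\<in>?P. p (jet_coords (fst ` dom1 U) \<kappa> (snd \<circ> ?c) (fst \<theta>) (lift s)) = 0)))"
    using J1_adapted[OF U(1)] U(2) by simp
  then show ?thesis by (intro exI)
qed

text \<open>R must also make sense for sections of 1-jets that are not prolongations, where Q has
  nothing to say. It is defined by the polynomials of \<open>lifted_equation\<close>, and agrees
  with Q on prolongations by \<open>R_lift\<close>. The starting order is 1, as contact symmetries
  constrain k-jets for k at least 1.\<close>

theorem algebraic_contact_symmetries:
  assumes eq: "algebraic_equation E M \<pi> Q"
  shows "algebraic_pseudogroup J1 (contact_symmetries E M \<pi> Q)"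
proof -
  note A = smooth_atlas_J1
  \<comment> \<open>Chart and polynomials form one tuple, so that a single choice for each k and
    \<theta> fixes them together.\<close>
  define good where "good k \<theta> = (\<lambda>(U, \<omega>, \<kappa>, P). adapted J1 M fst U \<omega> \<kappa> \<and> \<theta> \<in> U \<and>
    (\<forall>p\<in>P. polynomial_fun (jet_vars k) p) \<and>
    (\<forall>s. sect (fst \<theta>) s \<and> J (fst \<theta>) s = \<theta> \<longrightarrow>
      (jet M E k (fst \<theta>) s \<in> Q k \<longleftrightarrow>
        (\<forall>p\<in>P. p (jet_coords (fst ` U) \<kappa> (snd \<circ> \<omega>) (fst \<theta>) (lift s)) = 0))))" for k \<theta>
  define T where "T k \<theta> = (SOME T. good k \<theta> T)" for k \<theta>
  have T: "good k \<theta> (T k \<theta>)" if \<theta>: "\<theta> \<in> carrier J1" for k \<theta>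
  proof -
    obtain U \<omega> \<kappa> P where "good k \<theta> (U, \<omega>, \<kappa>, P)"
      using lifted_equation[OF eq \<theta>, of k] unfolding good_def by auto
    then show ?thesis unfolding T_def by (rule someI)
  qed
  define R where "R k \<theta> t = (case T k \<theta> of (U, \<omega>, \<kappa>, P) \<Rightarrow>
    (\<forall>p\<in>P. p (jet_coords (fst ` U) \<kappa> (snd \<circ> \<omega>) (fst \<theta>) t) = 0))" for k \<theta> t
  define Lifts where "Lifts \<theta> = {lift s | s. sect (fst \<theta>) s \<and> J (fst \<theta>) s = \<theta>}" for \<theta>
  have R_lift: "R k \<theta> (lift s) \<longleftrightarrow> jet M E k (fst \<theta>) s \<in> Q k" if s: "sect (fst \<theta>) s" "J (fst \<theta>) s = \<theta>" for k \<theta> s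
  proof -
    have "\<theta> \<in> carrier J1"
      using smooth_at_carrier(2)[of M J1 "fst \<theta>" "lift s"] lift_section[OF s(1)] s(2)
      unfolding section_at_def lift_def by simp
    from T[OF this, of k] show ?thesis
      using s unfolding R_def good_def by (cases "T k \<theta>") simp
  qed
  show ?thesis
  proof (rule algebraic_lifted_symmetries[OF A M, where R = R and Lifts = Lifts
        and B = "\<lambda>k. contact_at" and ?k0.0 = 1])
    fix k b assume "b \<in> carrier J1"
    from T[OF this, of k]
    show "\<exists>U \<omega> \<kappa> P. adapted J1 M fst U \<omega> \<kappa> \<and> b \<in> U \<and> (\<forall>p\<in>P. polynomial_fun (jet_vars k) p) \<and>
        (\<forall>t. section_at J1 M fst (fst b) t \<and> t (fst b) = b \<longrightarrow>
          (R k b t \<longleftrightarrow> (\<forall>p\<in>P. p (jet_coords (fst ` U) \<kappa> (snd \<circ> \<omega>) (fst b) t) = 0)))"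
      unfolding R_def good_def by (cases "T k b") auto
  next
    fix a s assume "s \<in> Lifts a"
    then show "section_at J1 M fst (fst a) s \<and> s (fst a) = a"
      unfolding Lifts_def using lift_section by (auto simp: lift_def)
  next
    fix k a b show "algebraic_at J1 (max 1 k) a b (contact_at a)" by (rule contact_at_algebraic)
  next
    fix S f a s t
    assume f: "local_diffeo J1 J1 S f" and b: "\<forall>a\<in>S. \<forall>k::nat. contact_at a f \<and> contact_at (f a) (inv_into S f)"
      and a: "a \<in> S" and s: "s \<in> Lifts a"
      and t: "section_at J1 M fst (fst (f a)) t" "t (fst (f a)) = f a" "transports M fst (fst a) f s t"
    obtain r where r: "s = lift r" "sect (fst a) r" "J (fst a) r = a" using s unfolding Lifts_def by blast
    obtain r' where "sect (fst (f a)) r'" "J (fst (f a)) r' = f a" "near M (fst (f a)) (\<lambda>y. lift r' y = t y)"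
      using contact_image_holonomic[OF f _ a r(2,3) t(1,2)] b t(3) r(1) by blast
    then show "\<exists>t'\<in>Lifts (f a). near M (fst (f a)) (\<lambda>y. t' y = t y)" unfolding Lifts_def by blast
  next
    fix S f
    show "(S, f) \<in> contact_symmetries E M \<pi> Q \<longleftrightarrow> local_diffeo J1 J1 S f \<and>
       (\<forall>a\<in>S. \<forall>k::nat. contact_at a f \<and> contact_at (f a) (inv_into S f)) \<and>
       (\<forall>k\<ge>1. \<forall>a\<in>S. \<forall>s\<in>Lifts a. \<forall>s'\<in>Lifts (f a). transports M fst (fst a) f s s' \<longrightarrow>
         (R k a s \<longleftrightarrow> R k (f a) s'))" (is "?l \<longleftrightarrow> ?r")
    proof
      assume l: ?l
      then have c: "contact_diffeo E M \<pi> S f"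
        and q: "\<And>k \<theta> \<theta>'. 1 \<le> k \<Longrightarrow> contact_prolongation E M \<pi> S f k \<theta> \<theta>' \<Longrightarrow> (\<theta> \<in> Q k \<longleftrightarrow> \<theta>' \<in> Q k)"
        unfolding contact_symmetries_def by blast+
      have d: "local_diffeo J1 J1 S f" using c contact_diffeo_iff by blast
      have "R k a s \<longleftrightarrow> R k (f a) s'"
        if k: "1 \<le> k" and a: "a \<in> S" and s: "s \<in> Lifts a" and s': "s' \<in> Lifts (f a)"
          and t: "transports M fst (fst a) f s s'" for k a s s'
      proof -
        obtain r where r: "s = lift r" "sect (fst a) r" "J (fst a) r = a" using s unfolding Lifts_def by blast
        obtain r' where r': "s' = lift r'" "sect (fst (f a)) r'" "J (fst (f a)) r' = f a"
          using s' unfolding Lifts_def by blast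
        have "near M (fst a) (\<lambda>y. lift r y \<in> S)"
          using smooth_at_vimage[OF M A, of "fst a" "lift r" "\<lambda>p. p \<in> S"] lift_section[OF r(2)] r(3)
            near_mopen[of J1 S a] a d
          unfolding section_at_def local_diffeo_def by (simp add: lift_def)
        from near_conj[OF M this t[unfolded transports_def]]
        obtain V where V: "mopen M V" "fst a \<in> V"
          "\<forall>y\<in>V. J y r \<in> S \<and> f (J y r) = J (fst (f (J y r))) r'"
          unfolding near_def r(1) r'(1) lift_def by blast
        have "contact_prolongation E M \<pi> S f k (jet M E k (fst a) r) (jet M E k (fst (f a)) r')"
          unfolding contact_prolongation_def local_section_iff[OF M] J_def[symmetric]
          using r(2,3) r'(2) V
          by (intro exI[of _ "fst a"] exI[of _ r] exI[of _ "fst (f a)"] exI[of _ r']) auto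
        from q[OF k this] show ?thesis unfolding r(1) r'(1) R_lift[OF r(2,3)] R_lift[OF r'(2,3)] .
      qed
      then show ?r using c unfolding contact_diffeo_iff by blast
    next
      assume r: ?r
      have "\<theta> \<in> Q k \<longleftrightarrow> \<theta>' \<in> Q k" if k: "1 \<le> k" and prol: "contact_prolongation E M \<pi> S f k \<theta> \<theta>'" for k \<theta> \<theta>'
      proof -
        obtain x s x' s' V where h: "sect x s" "\<theta> = jet M E k x s" "sect x' s'"
          "\<theta>' = jet M E k x' s'" "x' = fst (f (J x s))" "mopen M V" "x \<in> V"
          "\<forall>y\<in>V. J y s \<in> S \<and> f (J y s) = J (fst (f (J y s))) s'"
          using prol unfolding contact_prolongation_def local_section_iff[OF M] J_def[symmetric] by blast
        let ?a = "J x s"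
        have fa: "J (fst (f ?a)) s' = f ?a" "?a \<in> S" using h(7,8) by simp_all
        have l: "lift s \<in> Lifts ?a" unfolding Lifts_def using h(1) by auto
        have s': "sect (fst (f ?a)) s'" using h(3,5) by simp
        then have l': "lift s' \<in> Lifts (f ?a)" unfolding Lifts_def using fa by blast
        have "transports M fst (fst ?a) f (lift s) (lift s')"
          unfolding transports_def near_def lift_def using h(6,7,8) by auto
        then have "R k ?a (lift s) \<longleftrightarrow> R k (f ?a) (lift s')" using r k fa(2) l l' by blast
        then show ?thesis
          using R_lift[of ?a s k] R_lift[OF s' fa(1), of k] h by simp
      qed
      then show ?l unfolding contact_symmetries_def using r contact_diffeo_iff by blast
    qed
  qed
qed

end

theorem theorem5:
  fixes E :: "('e, (real^'n) \<times> (real^'m)) atlas"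
    and M :: "('b, real^'n) atlas"
    and F :: "('f, real^'m) atlas"
    and \<pi> :: "'e \<Rightarrow> 'b"
    and Q :: "nat \<Rightarrow> ('b, 'e) jet set"
  assumes "smooth_bundle E M F \<pi>"
    and "algebraic_equation E M \<pi> Q"
  shows "algebraic_pseudogroup E (point_symmetries E M \<pi> Q) \<and>
    (CARD('m) = 1 \<longrightarrow>
      algebraic_pseudogroup (jet1_atlas E M \<pi>) (contact_symmetries E M \<pi> Q))"
  using algebraic_point_symmetries[OF assms]
    jet_bundle.algebraic_contact_symmetries[OF jet_bundle.intro[OF assms(1)] assms(2)]
  by blast

end
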